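(* For every fixed integer $k \ge 2$, $$\frac{W_{0,k}}{\log n/n} \stackrel{p}{\longrightarrow} 2k-1 \quad\text{as } n\to\infty ,$$ where $\stackrel{p}{\to}$ denotes convergence in probability and $W_{0,k}=\max\{w(S): S\subset V,\ |S|=k\}$ is the maximum, over all $k$-element vertex sets $S$, of the weight $w(S)$ of the minimum-weight Steiner tree connecting $S$ in the randomly weighted complete graph on $n$ vertices.
   Context: For each $n$ (large enough that $n\ge k$), let $G=(V,E)$ be the complete undirected graph on $n$ vertices $V=\{v_1,\dots,v_n\}$. Assign to its edges i.i.d. random weights having the exponential distribution with mean $1$; $T_{ij}=T_{ji}$ denotes the weight of the edge between $v_i$ and $v_j$. For $S\subset V$, $w(S)$ denotes the minimum, over all connected subgraphs of $G$ containing all vertices of $S$, of the total weight (sum of the edge weights) of the subgraph; the minimiser is almost surely a unique tree (the Steiner tree of $S$). $\log$ is the natural logarithm. *)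

theory Defs
  imports "HOL-Probability.Probability"
begin

text \<open>
  Undirected simple graphs are given by a vertex set and a set of two-element sets of vertices.
  A weight function on edges assigns one value to the unordered pair \<open>{u, v}\<close>, so the
  symmetry \<open>T\<^sub>i\<^sub>j = T\<^sub>j\<^sub>i\<close> is built in.
\<close>

definition complete_edges :: "'v set \<Rightarrow> 'v set set" where
  "complete_edges V = {e. e \<subseteq> V \<and> card e = 2}"

definition is_subgraph :: "'v set \<Rightarrow> 'v set set \<Rightarrow> 'v set \<Rightarrow> 'v set set \<Rightarrow> bool" where
  "is_subgraph U F V E \<longleftrightarrow> U \<subseteq> V \<and> F \<subseteq> E \<and> \<Union>F \<subseteq> U"

definition connected_graph :: "'v set \<Rightarrow> 'v set set \<Rightarrow> bool" where
  "connected_graph U F \<longleftrightarrow> U \<noteq> {} \<and> (\<forall>u\<in>U. \<forall>v\<in>U. (u, v) \<in> {(x, y). {x, y} \<in> F}\<^sup>*)"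

text \<open>
  In a finite graph only finitely many subgraphs compete, so \<^const>\<open>Min\<close> below is a genuine
  minimum as soon as some connected subgraph contains \<open>S\<close>.
\<close>

definition steiner_weight ::
    "'v set \<Rightarrow> 'v set set \<Rightarrow> ('v set \<Rightarrow> real) \<Rightarrow> 'v set \<Rightarrow> real" where
  "steiner_weight V E w S =
     Min {\<Sum>e\<in>F. w e | U F. is_subgraph U F V E \<and> connected_graph U F \<and> S \<subseteq> U}"

definition max_steiner_weight ::
    "'v set \<Rightarrow> 'v set set \<Rightarrow> ('v set \<Rightarrow> real) \<Rightarrow> nat \<Rightarrow> real" where
  "max_steiner_weight V E w k = Max {steiner_weight V E w S | S. S \<subseteq> V \<and> card S = k}"

text \<open>
  Convergence in probability to a constant; the \<open>n\<close>-th variable may live on its own probability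
  space \<open>M n\<close>. Measurability is part of the definition because \<^const>\<open>measure\<close>
  is \<open>0\<close> on non-measurable sets.
\<close>

definition converges_in_probability ::
    "(nat \<Rightarrow> 'a measure) \<Rightarrow> (nat \<Rightarrow> 'a \<Rightarrow> real) \<Rightarrow> real \<Rightarrow> bool" where
  "converges_in_probability M X c \<longleftrightarrow>
     (\<forall>\<^sub>F n in sequentially. X n \<in> borel_measurable (M n)) \<and>
     (\<forall>\<epsilon>>0. (\<lambda>n. measure (M n) {\<omega> \<in> space (M n). \<bar>X n \<omega> - c\<bar> > \<epsilon>}) \<longlonglongrightarrow> 0)"

end

theory Submission
  imports Defs "HOL-Real_Asymp.Real_Asymp"
begin

text \<open>
  Write \<open>\<ell> = ln n / n\<close>. For the upper bound, split every weight as the minimum of two independent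
  exponential weights of rates \<open>1 - \<delta>\<close> and \<open>\<delta>\<close>. In the first layer, the time at which
  first-passage percolation from a vertex reaches \<open>r + 1\<close> vertices is a sum of independent
  exponentials of rates \<open>(1 - \<delta>) * i * (n - i)\<close>, and its exponential moment at about \<open>(1 - \<delta>) * n\<close>
  telescopes to \<open>O(r)\<close>. By Markov's inequality all balls of radius \<open>(1 + \<epsilon>) * \<ell>\<close> contain at least
  \<open>ln n\<close> vertices and all balls of radius \<open>(2 + \<epsilon>) * \<ell>\<close> contain a fraction \<open>1 - 1 / (2 * k)\<close> of
  all vertices. The second layer joins the small ball of one terminal to the intersection of the
  large balls of the other \<open>k - 1\<close> terminals at cost \<open>\<epsilon> * \<ell>\<close>, and fails to do so with
  superpolynomially small probability, so a union bound over all terminal sets gives total weight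
  \<open>(1 + 2 * (k - 1)) * \<ell>\<close>.

  For the lower bound, about \<open>n\<^bsup>\<epsilon>\<^esup>\<close> vertices have all their edges heavier than
  \<open>(1 - \<epsilon>) * \<ell>\<close>. A tree through \<open>k\<close> of them pays this amount \<open>k\<close> times, and a first moment bound
  with an exponential moment at about \<open>n\<close> shows that on average over the terminal sets the rest costs
  at least \<open>(k - 1 - \<epsilon>) * \<ell>\<close>.
\<close>

section \<open>Products of exponential distributions\<close>

text \<open>Two layers are used because growth failures, summed over all vertices, are only a small
  negative power of \<open>n\<close>; a union over \<open>n ^ k\<close> terminal sets cannot be
  afforded. Growth is thus controlled per vertex, and all that depends on the terminal set is left
  to the second layer: about \<open>ln n * n / 2\<close> candidate edges, each of which must exceed
  \<open>\<epsilon> * ln n / n\<close>, fail together with probability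
  \<open>exp (- const * (ln n)^2)\<close>. The radii 1 and 2 come from the slowest stage of growth,
  leaving a single vertex at rate about \<open>n\<close>. Exponential moments exist only below that
  rate, so radius \<open>b * ln n / n\<close> has a tail of about \<open>n ^ (-b)\<close> times the
  moment \<open>O(r)\<close>. The union over vertices then needs \<open>b > 1\<close> for
  \<open>r\<close> near \<open>ln n\<close> and \<open>b > 2\<close> for \<open>r\<close> near
  \<open>n\<close>. In the lower bound the vertices with only heavy edges form a random set, so no
  terminals are singled out. If the maximum were small, every \<open>k\<close>-subset of that set
  would be cheap; the expected number of cheap \<open>k\<close>-subsets is smaller than the typical
  number of all \<open>k\<close>-subsets by a vanishing factor.\<close>

abbreviation expo :: "real \<Rightarrow> real measure" where
  "expo \<rho> \<equiv> density lborel (exponential_density \<rho>)"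

lemma sets_PiM_expo [measurable_cong]:
  "sets (Pi\<^sub>M I (\<lambda>i. expo \<rho>)) = sets (Pi\<^sub>M I (\<lambda>i. borel))"
  by (intro sets_PiM_cong) simp_all

lemma space_PiM_expo [simp]: "space (Pi\<^sub>M I (\<lambda>i. expo \<rho>)) = space (Pi\<^sub>M I (\<lambda>i. borel))"
  by (simp add: space_PiM)

lemma product_prob_space_expo: "0 < \<rho> \<Longrightarrow> product_prob_space (\<lambda>i. expo \<rho>)"
  by (intro product_prob_spaceI prob_space_exponential_density)

lemma nn_integral_expo:
  assumes [measurable]: "f \<in> borel_measurable borel"
  shows "(\<integral>\<^sup>+ x. f x \<partial>expo \<rho>) = (\<integral>\<^sup>+ x. ennreal (exponential_density \<rho> x) * f x \<partial>lborel)"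
  by (subst nn_integral_density) simp_all

lemma nn_integral_expo_exp_atLeast:
  assumes "0 < \<rho>" "0 < \<rho> + \<kappa>" "0 \<le> a"
  shows "(\<integral>\<^sup>+ x. indicator {a..} x * ennreal (exp (- \<kappa> * x)) \<partial>expo \<rho>)
    = ennreal (\<rho> / (\<rho> + \<kappa>) * exp (- (\<rho> + \<kappa>) * a))"
proof -
  have "(\<integral>\<^sup>+ x. indicator {a..} x * ennreal (exp (- \<kappa> * x)) \<partial>expo \<rho>)
    = (\<integral>\<^sup>+ x. ennreal (\<rho> * exp (- (\<rho> + \<kappa>) * x)) * indicator {a..} x \<partial>lborel)"
    using assms by (subst nn_integral_expo, simp, intro nn_integral_cong)
      (auto simp: exponential_density_def indicator_def ennreal_mult'[symmetric] exp_add[symmetric]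
        algebra_simps)
  also have "\<dots> = ennreal (0 - (- (\<rho> / (\<rho> + \<kappa>)) * exp (- (\<rho> + \<kappa>) * a)))"
  proof (rule nn_integral_FTC_atLeast)
    show "((\<lambda>x. - (\<rho> / (\<rho> + \<kappa>)) * exp (- (\<rho> + \<kappa>) * x)) \<longlongrightarrow> 0) at_top"
      using assms by real_asymp
    fix x
    have "\<rho> + \<kappa> \<noteq> 0" using assms by simp
    thus "DERIV (\<lambda>x. - (\<rho> / (\<rho> + \<kappa>)) * exp (- (\<rho> + \<kappa>) * x)) x :> \<rho> * exp (- (\<rho> + \<kappa>) * x)"
      by (auto intro!: derivative_eq_intros simp: divide_simps) (auto simp: algebra_simps)
  qed (use assms in auto)
  finally show ?thesis by simp
qed

lemma AE_expo_nonneg: "AE x in expo \<rho>. 0 \<le> x"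
  by (subst AE_density) (auto simp: exponential_density_def)

lemma nn_integral_expo_exp:
  assumes "0 < \<rho>" "0 < \<rho> + \<kappa>"
  shows "(\<integral>\<^sup>+ x. ennreal (exp (- \<kappa> * x)) \<partial>expo \<rho>) = ennreal (\<rho> / (\<rho> + \<kappa>))"
proof -
  have "(\<integral>\<^sup>+ x. ennreal (exp (- \<kappa> * x)) \<partial>expo \<rho>)
      = (\<integral>\<^sup>+ x. indicator {0..} x * ennreal (exp (- \<kappa> * x)) \<partial>expo \<rho>)"
    using AE_expo_nonneg[of \<rho>] by (intro nn_integral_cong_AE) (auto simp: indicator_def)
  thus ?thesis using nn_integral_expo_exp_atLeast[OF assms, of 0] by simp
qed

text \<open>Memorylessness in integral form: for \<open>z \<ge> 0\<close> the density at
  \<open>y + z\<close> is \<open>exp (- \<rho> * y)\<close> times the density at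
  \<open>z\<close>.\<close>

lemma nn_integral_expo_shift:
  assumes "0 < \<rho>" "0 \<le> y" and [measurable]: "g \<in> borel_measurable borel"
  shows "(\<integral>\<^sup>+ z. indicator {y..} z * g (z - y) \<partial>expo \<rho>) = ennreal (exp (- \<rho> * y)) * (\<integral>\<^sup>+ z. g z \<partial>expo \<rho>)"
proof -
  let ?h = "\<lambda>z. ennreal (exponential_density \<rho> z) * (indicator {y..} z * g (z - y))"
  have "(\<integral>\<^sup>+ z. indicator {y..} z * g (z - y) \<partial>expo \<rho>) = (\<integral>\<^sup>+ z. ?h z \<partial>lborel)"
    by (subst nn_integral_expo) simp_all
  also have "\<dots> = (\<integral>\<^sup>+ z. ?h (y + 1 * z) \<partial>lborel)"
    by (subst nn_integral_real_affine[where c = 1 and t = y]) simp_all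
  also have "\<dots> = (\<integral>\<^sup>+ z. ennreal (exp (- \<rho> * y)) * (ennreal (exponential_density \<rho> z) * g z) \<partial>lborel)"
  proof (intro nn_integral_cong)
    fix z
    show "?h (y + 1 * z) = ennreal (exp (- \<rho> * y)) * (ennreal (exponential_density \<rho> z) * g z)"
    proof (cases "0 \<le> z")
      case True
      hence "exponential_density \<rho> (y + z) = exp (- \<rho> * y) * exponential_density \<rho> z"
        using assms by (simp add: exponential_density_def exp_add[symmetric] algebra_simps)
      thus ?thesis using True by (simp add: ennreal_mult' mult.assoc)
    qed (simp add: exponential_density_def)
  qed
  also have "\<dots> = ennreal (exp (- \<rho> * y)) * (\<integral>\<^sup>+ z. g z \<partial>expo \<rho>)"
    by (subst nn_integral_cmult) (simp_all add: nn_integral_expo)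
  finally show ?thesis .
qed

lemma distr_min_expo:
  assumes "0 < a" "0 < b"
  shows "distr (expo a \<Otimes>\<^sub>M expo b) borel (\<lambda>p. min (fst p) (snd p)) = expo (a + b)"
proof -
  interpret A: prob_space "expo a" using assms prob_space_exponential_density by auto
  interpret B: prob_space "expo b" using assms prob_space_exponential_density by auto
  interpret pair_prob_space "expo a" "expo b" ..
  let ?P = "expo a \<Otimes>\<^sub>M expo b"
  have 1: "distr ?P borel fst = expo a"
    using B.distr_pair_fst[of "expo a"] by (simp cong: distr_cong)
  have "distr ?P (expo b) snd = expo b"
  proof -
    have "distr ?P (expo b) snd = distr (expo b \<Otimes>\<^sub>M expo a) (expo b) fst"
      by (subst distr_pair_swap, subst distr_distr) (auto simp: comp_def case_prod_beta intro!: distr_cong)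
    thus ?thesis using A.distr_pair_fst[of "expo b"] by simp
  qed
  hence 2: "distr ?P borel snd = expo b" by (simp cong: distr_cong)
  have "indep_var borel fst borel snd"
    unfolding indep_var_distribution_eq 1 2
    by (auto intro!: distr_id2[symmetric] sets_pair_measure_cong)
  moreover have "distributed ?P lborel fst (exponential_density a)"
    using 1 assms by (auto simp: distributed_def cong: distr_cong)
  moreover have "distributed ?P lborel snd (exponential_density b)"
    using 2 assms by (auto simp: distributed_def cong: distr_cong)
  ultimately have "distributed ?P lborel (\<lambda>p. min (fst p) (snd p)) (exponential_density (a + b))"
    using assms by (intro exponential_distributed_min)
  thus ?thesis by (simp add: distributed_def cong: distr_cong)
qed

lemma emeasure_distr_eq_nn_integral:
  assumes T: "T \<in> measurable M N" and A: "A \<in> sets N"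
  shows "emeasure (distr M N T) A = (\<integral>\<^sup>+ x. indicator A (T x) \<partial>M)"
proof -
  have "emeasure (distr M N T) A = (\<integral>\<^sup>+ x. indicator A x \<partial>distr M N T)"
    using A by simp
  also have "\<dots> = (\<integral>\<^sup>+ x. indicator A (T x) \<partial>M)"
    using A by (intro nn_integral_distr[OF T]) simp
  finally show ?thesis .
qed

text \<open>It is enough to compare both measures on boxes. The indicator of a box is a product over
  coordinates, so Fubini reduces the claim to a single edge, where it is the minimum of two
  independent exponentials. This is what permits the two independent layers.\<close>

lemma distr_min_PiM_expo:
  assumes "finite I" "0 < a" "0 < b"
  shows "distr (Pi\<^sub>M I (\<lambda>i. expo a) \<Otimes>\<^sub>M Pi\<^sub>M I (\<lambda>i. expo b)) (Pi\<^sub>M I (\<lambda>i. borel))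
      (\<lambda>p. \<lambda>i\<in>I. min (fst p i) (snd p i)) = Pi\<^sub>M I (\<lambda>i. expo (a + b))"
proof -
  interpret C: product_prob_space "\<lambda>i. expo (a + b)" using assms by (intro product_prob_space_expo) simp
  interpret A: product_prob_space "\<lambda>i. expo a" using assms by (intro product_prob_space_expo) simp
  interpret B: product_prob_space "\<lambda>i. expo b" using assms by (intro product_prob_space_expo) simp
  have sf': "sigma_finite_measure (expo b)"
    using assms by (intro prob_space_imp_sigma_finite prob_space_exponential_density)
  have sf: "sigma_finite_measure (Pi\<^sub>M I (\<lambda>i. expo b))"
    using assms by (intro prob_space_imp_sigma_finite prob_space_PiM prob_space_exponential_density)
  let ?N = "Pi\<^sub>M I (\<lambda>i. expo a) \<Otimes>\<^sub>M Pi\<^sub>M I (\<lambda>i. expo b)"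
  show ?thesis
  proof (rule C.PiM_eqI[OF assms(1)])
    show "sets (distr ?N (Pi\<^sub>M I (\<lambda>i. borel)) (\<lambda>p. \<lambda>i\<in>I. min (fst p i) (snd p i)))
       = sets (Pi\<^sub>M I (\<lambda>i. expo (a + b)))"
      by (simp add: sets_PiM_expo)
    fix S assume "\<And>i. i \<in> I \<Longrightarrow> S i \<in> sets (expo (a + b))"
    hence S [measurable]: "\<And>i. i \<in> I \<Longrightarrow> S i \<in> sets borel" by simp
    have [measurable]: "(\<lambda>p. \<lambda>i\<in>I. min (fst p i) (snd p i)) \<in> ?N \<rightarrow>\<^sub>M Pi\<^sub>M I (\<lambda>i. borel)"
      by measurable
    have SS: "Pi\<^sub>E I S \<in> sets (Pi\<^sub>M I (\<lambda>i. borel))" using S assms(1) by (intro sets_PiM_I_finite) auto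
    have "emeasure (distr ?N (Pi\<^sub>M I (\<lambda>i. borel)) (\<lambda>p. \<lambda>i\<in>I. min (fst p i) (snd p i))) (Pi\<^sub>E I S)
      = (\<integral>\<^sup>+ p. indicator (Pi\<^sub>E I S) (\<lambda>i\<in>I. min (fst p i) (snd p i)) \<partial>?N)"
      using SS by (intro emeasure_distr_eq_nn_integral) simp_all
    also have "\<dots> = (\<integral>\<^sup>+ p. (\<Prod>i\<in>I. indicator (S i) (min (fst p i) (snd p i))) \<partial>?N)"
    proof (intro nn_integral_cong)
      fix p :: "('a \<Rightarrow> real) \<times> ('a \<Rightarrow> real)"
      show "indicator (Pi\<^sub>E I S) (\<lambda>i\<in>I. min (fst p i) (snd p i)) = (\<Prod>i\<in>I. indicator (S i) (min (fst p i) (snd p i)) :: ennreal)"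
      proof (cases "\<forall>i\<in>I. min (fst p i) (snd p i) \<in> S i")
        case True
        thus ?thesis by (simp add: indicator_def)
      next
        case False
        then obtain i where "i \<in> I" "min (fst p i) (snd p i) \<notin> S i" by blast
        hence "(\<Prod>i\<in>I. indicator (S i) (min (fst p i) (snd p i)) :: ennreal) = 0"
          using assms(1) by (intro prod_zero) (auto intro!: bexI[of _ i])
        thus ?thesis using \<open>i \<in> I\<close> \<open>min (fst p i) (snd p i) \<notin> S i\<close> by (auto simp: indicator_def PiE_iff)
      qed
    qed
    also have "\<dots> = (\<integral>\<^sup>+ x. \<integral>\<^sup>+ y. (\<Prod>i\<in>I. indicator (S i) (min (x i) (y i))) \<partial>Pi\<^sub>M I (\<lambda>i. expo b) \<partial>Pi\<^sub>M I (\<lambda>i. expo a))"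
      by (subst sigma_finite_measure.nn_integral_fst[OF sf, symmetric]) simp_all
    also have "\<dots> = (\<integral>\<^sup>+ x. (\<Prod>i\<in>I. \<integral>\<^sup>+ y. indicator (S i) (min (x i) y) \<partial>expo b) \<partial>Pi\<^sub>M I (\<lambda>i. expo a))"
      using assms(1) by (intro nn_integral_cong B.product_nn_integral_prod) simp_all
    also have "\<dots> = (\<Prod>i\<in>I. \<integral>\<^sup>+ x. \<integral>\<^sup>+ y. indicator (S i) (min x y) \<partial>expo b \<partial>expo a)"
      using assms(1) by (intro A.product_nn_integral_prod) simp_all
    also have "\<dots> = (\<Prod>i\<in>I. emeasure (expo (a + b)) (S i))"
    proof (intro prod.cong refl)
      fix i assume i: "i \<in> I"
      have "(\<integral>\<^sup>+ x. \<integral>\<^sup>+ y. indicator (S i) (min x y) \<partial>expo b \<partial>expo a)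
        = (\<integral>\<^sup>+ p. indicator (S i) (min (fst p) (snd p)) \<partial>(expo a \<Otimes>\<^sub>M expo b))"
        using i by (subst sigma_finite_measure.nn_integral_fst[OF sf', symmetric]) simp_all
      also have "\<dots> = emeasure (expo (a + b)) (S i)"
        using i by (subst distr_min_expo[OF assms(2,3), symmetric])
          (simp add: emeasure_distr_eq_nn_integral)
      finally show "(\<integral>\<^sup>+ x. \<integral>\<^sup>+ y. indicator (S i) (min x y) \<partial>expo b \<partial>expo a) = emeasure (expo (a + b)) (S i)" .
    qed
    finally show "emeasure (distr ?N (Pi\<^sub>M I (\<lambda>i. borel)) (\<lambda>p. \<lambda>i\<in>I. min (fst p i) (snd p i))) (Pi\<^sub>E I S)
      = (\<Prod>i\<in>I. emeasure (expo (a + b)) (S i))" .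
  qed
qed

section \<open>Memorylessness for families of independent exponentials\<close>

text \<open>Residual weights: what remains of the coordinates in \<open>J\<close> once they are
  known to be at least \<open>y\<close>.\<close>

definition shift_on :: "'i set \<Rightarrow> real \<Rightarrow> ('i \<Rightarrow> real) \<Rightarrow> 'i \<Rightarrow> real" where
  "shift_on J y x = (\<lambda>i. if i \<in> J then x i - y else x i)"

lemma measurable_shift_on_comp:
  assumes "J \<subseteq> I" "T \<in> measurable M (Pi\<^sub>M I (\<lambda>i. borel))" "c \<in> borel_measurable M"
  shows "(\<lambda>x. shift_on J (c x) (T x)) \<in> measurable M (Pi\<^sub>M I (\<lambda>i. borel))"
proof (rule measurable_PiM_single')
  fix i assume i: "i \<in> I"
  have "(\<lambda>x. T x i) \<in> borel_measurable M"
    using measurable_component_singleton[OF i] assms(2) by (rule measurable_compose[rotated])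
  thus "(\<lambda>x. shift_on J (c x) (T x) i) \<in> borel_measurable M"
    using assms(3) by (cases "i \<in> J") (simp_all add: shift_on_def)
next
  have "T x \<in> space (Pi\<^sub>M I (\<lambda>i. borel :: real measure))" if "x \<in> space M" for x
    using assms(2) that by (rule measurable_space)
  thus "(\<lambda>x. shift_on J (c x) (T x)) \<in> space M \<rightarrow> (\<Pi>\<^sub>E i\<in>I. space borel)"
    using assms(1) by (auto simp: space_PiM PiE_iff extensional_def shift_on_def)
qed

lemma measurable_upd_comp:
  assumes "j \<in> I" "T \<in> measurable M (Pi\<^sub>M I (\<lambda>i. borel :: real measure))" "c \<in> borel_measurable M"
  shows "(\<lambda>x. (T x)(j := c x)) \<in> measurable M (Pi\<^sub>M I (\<lambda>i. borel))"
proof (rule measurable_PiM_single')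
  fix i assume i: "i \<in> I"
  have "(\<lambda>x. T x i) \<in> borel_measurable M"
    using measurable_component_singleton[OF i] assms(2) by (rule measurable_compose[rotated])
  thus "(\<lambda>x. ((T x)(j := c x)) i) \<in> borel_measurable M"
    using assms(3) by (cases "i = j") simp_all
next
  have "T x \<in> space (Pi\<^sub>M I (\<lambda>i. borel :: real measure))" if "x \<in> space M" for x
    using assms(2) that by (rule measurable_space)
  thus "(\<lambda>x. (T x)(j := c x)) \<in> space M \<rightarrow> (\<Pi>\<^sub>E i\<in>I. space borel)"
    using assms(1) by (auto simp: space_PiM PiE_iff extensional_def)
qed

lemma indicator_ball_ge_measurable:
  fixes f :: "'i \<Rightarrow> 'a \<Rightarrow> real"
  assumes "finite J" "\<And>i. i \<in> J \<Longrightarrow> f i \<in> borel_measurable M" "c \<in> borel_measurable M"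
  shows "(\<lambda>x. indicator {x. \<forall>i\<in>J. c x \<le> f i x} x :: ennreal) \<in> borel_measurable M"
proof -
  have "{x \<in> space M. \<forall>i\<in>J. c x \<le> f i x} \<in> sets M"
    using assms by (intro sets.sets_Collect_finite_All borel_measurable_le) auto
  hence "(\<lambda>x. indicator {x \<in> space M. \<forall>i\<in>J. c x \<le> f i x} x :: ennreal) \<in> borel_measurable M"
    by simp
  thus ?thesis by (rule measurable_cong[THEN iffD1, rotated]) (auto simp: indicator_def)
qed

lemma nn_integral_PiM_expo_shift1:
  assumes "finite I" "j \<in> I" "0 < \<rho>" "0 \<le> y" "h \<in> borel_measurable (Pi\<^sub>M I (\<lambda>i. borel))"
  shows "(\<integral>\<^sup>+ x. indicator {y..} (x j) * h (x(j := x j - y)) \<partial>Pi\<^sub>M I (\<lambda>i. expo \<rho>))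
    = ennreal (exp (- \<rho> * y)) * (\<integral>\<^sup>+ x. h x \<partial>Pi\<^sub>M I (\<lambda>i. expo \<rho>))"
proof -
  interpret product_prob_space "\<lambda>i. expo \<rho>" using assms by (intro product_prob_space_expo) simp
  define I' where "I' = I - {j}"
  have I: "I = insert j I'" "finite I'" "j \<notin> I'" using assms by (auto simp: I'_def)
  have h [measurable]: "h \<in> borel_measurable (Pi\<^sub>M (insert j I') (\<lambda>i. borel))" using assms I by simp
  have [measurable]: "(\<lambda>x. x(j := x j - y)) \<in> measurable (Pi\<^sub>M (insert j I') (\<lambda>i. borel)) (Pi\<^sub>M (insert j I') (\<lambda>i. borel))"
    by (intro measurable_upd_comp) simp_all
  have "(\<integral>\<^sup>+ x. indicator {y..} (x j) * h (x(j := x j - y)) \<partial>Pi\<^sub>M I (\<lambda>i. expo \<rho>))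
    = (\<integral>\<^sup>+ x. \<integral>\<^sup>+ z. indicator {y..} z * h (x(j := z - y)) \<partial>expo \<rho> \<partial>Pi\<^sub>M I' (\<lambda>i. expo \<rho>))"
    unfolding I(1) using I by (subst product_nn_integral_insert) (simp_all, measurable)
  also have "\<dots> = (\<integral>\<^sup>+ x. ennreal (exp (- \<rho> * y)) * (\<integral>\<^sup>+ z. h (x(j := z)) \<partial>expo \<rho>) \<partial>Pi\<^sub>M I' (\<lambda>i. expo \<rho>))"
    using assms by (intro nn_integral_cong nn_integral_expo_shift measurable_compose[OF measurable_fun_upd h]
        measurable_const) simp_all
  also have "\<dots> = ennreal (exp (- \<rho> * y)) * (\<integral>\<^sup>+ x. h x \<partial>Pi\<^sub>M I (\<lambda>i. expo \<rho>))"
    unfolding I(1) using I by (subst product_nn_integral_insert, simp, simp, measurable, subst nn_integral_cmult) measurable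
  finally show ?thesis .
qed

text \<open>Memorylessness, applied to the coordinates in \<open>J\<close> one after another. It
  serves both halves of the proof: residual weights in an exploration, and conditioning on all edges
  at the terminals being heavy.\<close>

lemma nn_integral_PiM_expo_shift:
  assumes "finite I" "J \<subseteq> I" "0 < \<rho>" "0 \<le> y" and g: "g \<in> borel_measurable (Pi\<^sub>M I (\<lambda>i. borel))"
  shows "(\<integral>\<^sup>+ x. indicator {x. \<forall>i\<in>J. y \<le> x i} x * g (shift_on J y x) \<partial>Pi\<^sub>M I (\<lambda>i. expo \<rho>))
    = ennreal (exp (- \<rho> * y * real (card J))) * (\<integral>\<^sup>+ x. g x \<partial>Pi\<^sub>M I (\<lambda>i. expo \<rho>))"
proof -
  have "finite J" using assms finite_subset by blast
  from this assms(2) show ?thesis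
  proof (induction J)
    case empty
    thus ?case by (simp add: shift_on_def)
  next
    case (insert j J)
    define h where "h = (\<lambda>x. indicator {x. \<forall>i\<in>J. y \<le> x i} x * g (shift_on J y x))"
    have m: "h \<in> borel_measurable (Pi\<^sub>M I (\<lambda>i. borel))"
      unfolding h_def using insert.prems insert.hyps
      by (intro borel_measurable_times_ennreal indicator_ball_ge_measurable
          measurable_compose[OF measurable_shift_on_comp g] measurable_component_singleton) auto
    have "indicator {x. \<forall>i\<in>insert j J. y \<le> x i} x * g (shift_on (insert j J) y x)
        = indicator {y..} (x j) * h (x(j := x j - y))" for x
    proof -
      have 1: "shift_on J y (x(j := x j - y)) = shift_on (insert j J) y x"
        using insert.hyps by (auto simp: shift_on_def)
      have 2: "(\<forall>i\<in>J. y \<le> (x(j := x j - y)) i) = (\<forall>i\<in>J. y \<le> x i)"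
        using insert.hyps by (intro ball_cong) auto
      show ?thesis unfolding h_def indicator_def mem_Collect_eq 1 2 by (cases "y \<le> x j") simp_all
    qed
    hence "(\<integral>\<^sup>+ x. indicator {x. \<forall>i\<in>insert j J. y \<le> x i} x * g (shift_on (insert j J) y x) \<partial>Pi\<^sub>M I (\<lambda>i. expo \<rho>))
      = (\<integral>\<^sup>+ x. indicator {y..} (x j) * h (x(j := x j - y)) \<partial>Pi\<^sub>M I (\<lambda>i. expo \<rho>))"
      by simp
    also have "\<dots> = ennreal (exp (- \<rho> * y)) * (\<integral>\<^sup>+ x. h x \<partial>Pi\<^sub>M I (\<lambda>i. expo \<rho>))"
      using assms insert.prems m by (intro nn_integral_PiM_expo_shift1) auto
    also have "\<dots> = ennreal (exp (- \<rho> * y * real (card (insert j J)))) * (\<integral>\<^sup>+ x. g x \<partial>Pi\<^sub>M I (\<lambda>i. expo \<rho>))"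
    proof -
      have "exp (- \<rho> * y * real (card (insert j J))) = exp (- \<rho> * y) * exp (- \<rho> * y * real (card J))"
        using insert.hyps by (simp add: exp_add[symmetric] algebra_simps)
      thus ?thesis using insert by (simp add: h_def ennreal_mult' mult.assoc)
    qed
    finally show ?case .
  qed
qed

text \<open>One exploration step. Given that \<open>e\<close> is lightest in \<open>J\<close> with
  weight \<open>z\<close>, the residuals of the others are fresh exponentials, and the others exceed
  \<open>z\<close> with probability \<open>exp (- \<rho> * z * (card J - 1))\<close>. Integrating
  this times \<open>exp (\<mu> * z)\<close> over \<open>z\<close> gives the constant. The function
  \<open>f\<close> must ignore \<open>e\<close>, whose randomness is used up by the step.\<close>

lemma nn_integral_PiM_expo_argmin:
  assumes "finite I" "J \<subseteq> I" "e \<in> J" "0 < \<rho>" "\<mu> < \<rho> * real (card J)"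
    and f: "f \<in> borel_measurable (Pi\<^sub>M I (\<lambda>i. borel))" and fe: "\<And>x z. f (x(e := z)) = f x"
  shows "(\<integral>\<^sup>+ x. indicator {x. \<forall>i\<in>J. x e \<le> x i} x * ennreal (exp (\<mu> * x e)) * f (shift_on (J - {e}) (x e) x)
        \<partial>Pi\<^sub>M I (\<lambda>i. expo \<rho>))
    = ennreal (\<rho> / (\<rho> * real (card J) - \<mu>)) * (\<integral>\<^sup>+ x. f x \<partial>Pi\<^sub>M I (\<lambda>i. expo \<rho>))"
proof -
  interpret product_prob_space "\<lambda>i. expo \<rho>" using assms by (intro product_prob_space_expo) simp
  have e1: "emeasure (expo \<rho>) UNIV = 1"
    using prob_space.emeasure_space_1[OF prob_space_exponential_density[OF assms(4)]] by simp
  define I' where "I' = I - {e}"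
  define J' where "J' = J - {e}"
  have finJ: "finite J" using assms finite_subset by blast
  have "card J = Suc (card J')"
    unfolding J'_def by (rule card_Suc_Diff1[OF finJ assms(3), symmetric])
  hence cJ: "real (card J) = 1 + real (card J')" by simp
  have J': "J' \<subseteq> I'" using assms by (auto simp: I'_def J'_def)
  have I: "I = insert e I'" "finite I'" "e \<notin> I'" using assms by (auto simp: I'_def)
  note f' = f[unfolded I(1)]
  \<comment> \<open>Coordinate \<open>e\<close> is pinned to \<open>0\<close>, which by
    \<open>fe\<close> leaves the value unchanged, so that \<open>f\<close> becomes a function of the
    coordinates in \<open>I'\<close>.\<close>
  define f0 where "f0 = (\<lambda>x. f (x(e := 0)))"
  have f0: "f0 \<in> borel_measurable (Pi\<^sub>M I' (\<lambda>i. borel))"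
    unfolding f0_def by (rule measurable_compose[OF _ f']) simp
  have C: "(\<integral>\<^sup>+ x. f x \<partial>Pi\<^sub>M I (\<lambda>i. expo \<rho>)) = (\<integral>\<^sup>+ x. f0 x \<partial>Pi\<^sub>M I' (\<lambda>i. expo \<rho>))"
    unfolding I(1) using I f' fe
    by (subst product_nn_integral_insert) (simp_all add: f0_def e1 cong: measurable_cong_sets)
  have "(\<integral>\<^sup>+ x. indicator {x. \<forall>i\<in>J. x e \<le> x i} x * ennreal (exp (\<mu> * x e)) * f (shift_on (J - {e}) (x e) x)
        \<partial>Pi\<^sub>M I (\<lambda>i. expo \<rho>))
    = (\<integral>\<^sup>+ z. \<integral>\<^sup>+ x. indicator {x. \<forall>i\<in>J. (x(e := z)) e \<le> (x(e := z)) i} x * ennreal (exp (\<mu> * z)) * f (shift_on J' z (x(e := z)))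
         \<partial>Pi\<^sub>M I' (\<lambda>i. expo \<rho>) \<partial>expo \<rho>)"
    unfolding I(1)
  proof (subst product_nn_integral_insert_rev)
    have "(\<lambda>x. indicator {x. \<forall>i\<in>J. x e \<le> x i} x * ennreal (exp (\<mu> * x e)) * f (shift_on (J - {e}) (x e) x))
      \<in> borel_measurable (Pi\<^sub>M (insert e I') (\<lambda>i. borel))"
      using assms(2) finJ unfolding I(1)
      by (intro borel_measurable_times_ennreal indicator_ball_ge_measurable
          measurable_compose[OF measurable_shift_on_comp f'] measurable_component_singleton) auto
    thus "(\<lambda>x. indicator {x. \<forall>i\<in>J. x e \<le> x i} x * ennreal (exp (\<mu> * x e)) * f (shift_on (J - {e}) (x e) x))
      \<in> borel_measurable (Pi\<^sub>M (insert e I') (\<lambda>i. expo \<rho>))"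
      by (simp cong: measurable_cong_sets)
  qed (use I in \<open>simp_all add: J'_def indicator_def\<close>)
  also have "\<dots> = (\<integral>\<^sup>+ z. ennreal (exp (\<mu> * z)) * (\<integral>\<^sup>+ x. indicator {x. \<forall>i\<in>J'. z \<le> x i} x * f0 (shift_on J' z x)
         \<partial>Pi\<^sub>M I' (\<lambda>i. expo \<rho>)) \<partial>expo \<rho>)"
  proof (intro nn_integral_cong)
    fix z :: real
    have "f (shift_on J' z (x(e := z))) = f0 (shift_on J' z x)" for x
    proof -
      have "(shift_on J' z x)(e := z) = shift_on J' z (x(e := z))" by (auto simp: shift_on_def J'_def)
      thus ?thesis by (simp add: f0_def fe flip: \<open>(shift_on J' z x)(e := z) = shift_on J' z (x(e := z))\<close>)
    qed
    moreover have "(indicator {x. \<forall>i\<in>J. (x(e := z)) e \<le> (x(e := z)) i} x :: ennreal) = indicator {x. \<forall>i\<in>J'. z \<le> x i} x" for x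
      by (auto simp: J'_def indicator_def)
    ultimately have "(\<integral>\<^sup>+ x. indicator {x. \<forall>i\<in>J. (x(e := z)) e \<le> (x(e := z)) i} x * ennreal (exp (\<mu> * z)) * f (shift_on J' z (x(e := z))) \<partial>Pi\<^sub>M I' (\<lambda>i. expo \<rho>))
       = (\<integral>\<^sup>+ x. ennreal (exp (\<mu> * z)) * (indicator {x. \<forall>i\<in>J'. z \<le> x i} x * f0 (shift_on J' z x)) \<partial>Pi\<^sub>M I' (\<lambda>i. expo \<rho>))"
      by (simp add: ac_simps)
    also have "\<dots> = ennreal (exp (\<mu> * z)) * (\<integral>\<^sup>+ x. indicator {x. \<forall>i\<in>J'. z \<le> x i} x * f0 (shift_on J' z x) \<partial>Pi\<^sub>M I' (\<lambda>i. expo \<rho>))"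
    proof (rule nn_integral_cmult)
      have "(\<lambda>x. indicator {x. \<forall>i\<in>J'. z \<le> x i} x * f0 (shift_on J' z x)) \<in> borel_measurable (Pi\<^sub>M I' (\<lambda>i. borel))"
        using J' finJ
        by (intro borel_measurable_times_ennreal indicator_ball_ge_measurable
          measurable_compose[OF measurable_shift_on_comp f0] measurable_component_singleton) (auto simp: J'_def)
      thus "(\<lambda>x. indicator {x. \<forall>i\<in>J'. z \<le> x i} x * f0 (shift_on J' z x)) \<in> borel_measurable (Pi\<^sub>M I' (\<lambda>i. expo \<rho>))"
        by (simp cong: measurable_cong_sets)
    qed
    finally show "(\<integral>\<^sup>+ x. indicator {x. \<forall>i\<in>J. (x(e := z)) e \<le> (x(e := z)) i} x * ennreal (exp (\<mu> * z)) * f (shift_on J' z (x(e := z))) \<partial>Pi\<^sub>M I' (\<lambda>i. expo \<rho>))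
      = ennreal (exp (\<mu> * z)) * (\<integral>\<^sup>+ x. indicator {x. \<forall>i\<in>J'. z \<le> x i} x * f0 (shift_on J' z x) \<partial>Pi\<^sub>M I' (\<lambda>i. expo \<rho>))" .
  qed
  \<comment> \<open>Equality only almost everywhere: memorylessness needs
    \<open>0 \<le> z\<close>.\<close>
  also have "\<dots> = (\<integral>\<^sup>+ z. ennreal (exp (- (\<rho> * real (card J') - \<mu>) * z)) * (\<integral>\<^sup>+ x. f x \<partial>Pi\<^sub>M I (\<lambda>i. expo \<rho>)) \<partial>expo \<rho>)"
  proof (rule nn_integral_cong_AE)
    show "AE z in expo \<rho>. ennreal (exp (\<mu> * z)) * (\<integral>\<^sup>+ x. indicator {x. \<forall>i\<in>J'. z \<le> x i} x * f0 (shift_on J' z x)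
         \<partial>Pi\<^sub>M I' (\<lambda>i. expo \<rho>)) = ennreal (exp (- (\<rho> * real (card J') - \<mu>) * z)) * (\<integral>\<^sup>+ x. f x \<partial>Pi\<^sub>M I (\<lambda>i. expo \<rho>))"
      using AE_expo_nonneg
    proof eventually_elim
      case (elim z)
      have "exp (- (\<rho> * real (card J') - \<mu>) * z) = exp (\<mu> * z) * exp (- \<rho> * z * real (card J'))"
        by (simp add: exp_add[symmetric] algebra_simps)
      thus ?case unfolding C
        using nn_integral_PiM_expo_shift[OF I(2) J' assms(4) elim f0]
        by (simp add: ennreal_mult' mult.assoc)
    qed
  qed
  also have "\<dots> = (\<integral>\<^sup>+ z. ennreal (exp (- (\<rho> * real (card J') - \<mu>) * z)) \<partial>expo \<rho>) * (\<integral>\<^sup>+ x. f x \<partial>Pi\<^sub>M I (\<lambda>i. expo \<rho>))"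
    by (rule nn_integral_multc) simp
  also have "(\<integral>\<^sup>+ z. ennreal (exp (- (\<rho> * real (card J') - \<mu>) * z)) \<partial>expo \<rho>) = ennreal (\<rho> / (\<rho> * real (card J) - \<mu>))"
    using assms cJ by (subst nn_integral_expo_exp) (simp_all add: algebra_simps)
  finally show ?thesis .
qed

section \<open>First-passage exploration\<close>

definition boundary :: "'v set \<Rightarrow> 'v set \<Rightarrow> 'v set set" where
  "boundary V B = {e \<in> complete_edges V. e \<inter> B \<noteq> {} \<and> \<not> e \<subseteq> B}"

lemma finite_complete_edges: "finite V \<Longrightarrow> finite (complete_edges V)"
  by (rule finite_subset[of _ "Pow V"]) (auto simp: complete_edges_def)

lemma boundary_subset: "boundary V B \<subseteq> complete_edges V"
  by (auto simp: boundary_def)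

lemma boundary_eq_image:
  assumes "B \<subseteq> V"
  shows "boundary V B = (\<lambda>(u, w). {u, w}) ` (B \<times> (V - B))"
proof
  show "boundary V B \<subseteq> (\<lambda>(u, w). {u, w}) ` (B \<times> (V - B))"
  proof
    fix e assume e: "e \<in> boundary V B"
    then obtain x y where xy: "e = {x, y}" "x \<noteq> y" "e \<subseteq> V"
      by (auto simp: boundary_def complete_edges_def card_2_iff)
    hence "(x \<in> B \<and> y \<in> V - B) \<or> (y \<in> B \<and> x \<in> V - B)"
      using e by (auto simp: boundary_def)
    thus "e \<in> (\<lambda>(u, w). {u, w}) ` (B \<times> (V - B))"
      using xy by (auto simp: image_iff insert_commute)
  qed
  show "(\<lambda>(u, w). {u, w}) ` (B \<times> (V - B)) \<subseteq> boundary V B"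
    using assms by (auto simp: boundary_def complete_edges_def card_2_iff)
qed

lemma card_boundary:
  assumes "finite V" "B \<subseteq> V"
  shows "card (boundary V B) = card B * (card V - card B)"
proof -
  have "inj_on (\<lambda>(u, w). {u, w}) (B \<times> (V - B))"
    by (auto simp: inj_on_def doubleton_eq_iff)
  thus ?thesis
    using assms by (simp add: boundary_eq_image card_image card_cartesian_product card_Diff_subset finite_subset)
qed

text \<open>
  First-passage exploration from \<open>B\<close>, run for a given number of steps: the lightest boundary
  edge is used and its weight is subtracted from the other boundary weights, which by
  memorylessness leaves independent exponential residual weights. The value is
  \<open>exp (\<mu> * t)\<close> for the elapsed time \<open>t\<close>; ties are summed over, which avoids choosing a minimal edge.
\<close>
fun explore :: "real \<Rightarrow> 'v set \<Rightarrow> nat \<Rightarrow> 'v set \<Rightarrow> ('v set \<Rightarrow> real) \<Rightarrow> ennreal" where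
  "explore \<mu> V 0 B x = 1"
| "explore \<mu> V (Suc r) B x = (\<Sum>e\<in>boundary V B.
     indicator {x. \<forall>f\<in>boundary V B. x e \<le> x f} x * ennreal (exp (\<mu> * x e)) *
     explore \<mu> V r (B \<union> e) (shift_on (boundary V B - {e}) (x e) x))"

text \<open>Later steps inspect only boundary edges of larger sets, so edges inside \<open>B\<close>
  are never read. After absorbing \<open>e\<close>, the edge \<open>e\<close> lies inside
  \<open>B \<union> e\<close>; this supplies the independence from coordinate \<open>e\<close>
  demanded by \<open>nn_integral_PiM_expo_argmin\<close>.\<close>

lemma explore_cong:
  assumes "\<And>f. f \<in> complete_edges V \<Longrightarrow> \<not> f \<subseteq> B \<Longrightarrow> x f = y f"
  shows "explore \<mu> V r B x = explore \<mu> V r B y"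
  using assms
proof (induction r arbitrary: B x y)
  case (Suc r)
  have b: "x f = y f" if "f \<in> boundary V B" for f
    using that Suc.prems by (auto simp: boundary_def)
  have "explore \<mu> V r (B \<union> e) (shift_on (boundary V B - {e}) (x e) x)
      = explore \<mu> V r (B \<union> e) (shift_on (boundary V B - {e}) (y e) y)" if "e \<in> boundary V B" for e
  proof (rule Suc.IH)
    fix f assume "f \<in> complete_edges V" "\<not> f \<subseteq> B \<union> e"
    thus "shift_on (boundary V B - {e}) (x e) x f = shift_on (boundary V B - {e}) (y e) y f"
      using Suc.prems[of f] b[OF that] by (auto simp: shift_on_def)
  qed
  thus ?case using b by (auto intro!: sum.cong simp: indicator_def)
qed simp

lemma explore_measurable:
  assumes "finite V"
  shows "explore \<mu> V r B \<in> borel_measurable (Pi\<^sub>M (complete_edges V) (\<lambda>i. borel))"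
proof (induction r arbitrary: B)
  case 0
  have "explore \<mu> V 0 B = (\<lambda>x. 1)" by (rule ext) simp
  thus ?case by simp
next
  case (Suc r)
  have f: "finite (boundary V B)"
    using finite_complete_edges[OF assms] boundary_subset by (rule finite_subset[rotated])
  have b: "e \<in> complete_edges V" if "e \<in> boundary V B" for e using that boundary_subset by blast
  have 0: "explore \<mu> V (Suc r) B = (\<lambda>x. \<Sum>e\<in>boundary V B.
     indicator {x. \<forall>f\<in>boundary V B. x e \<le> x f} x * ennreal (exp (\<mu> * x e)) *
     explore \<mu> V r (B \<union> e) (shift_on (boundary V B - {e}) (x e) x))"
    by (rule ext) simp
  have c: "(\<lambda>x. x e) \<in> borel_measurable (Pi\<^sub>M (complete_edges V) (\<lambda>i. borel :: real measure))" if "e \<in> boundary V B" for e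
    using b[OF that] by simp
  have "(\<lambda>x. ennreal (exp (\<mu> * x e))) \<in> borel_measurable (Pi\<^sub>M (complete_edges V) (\<lambda>i. borel))"
    if "e \<in> boundary V B" for e
    using c[OF that] by simp
  thus ?case unfolding 0
    by (intro borel_measurable_sum borel_measurable_times_ennreal
        indicator_ball_ge_measurable f c measurable_compose[OF measurable_shift_on_comp Suc.IH])
      (auto dest: b)
qed

text \<open>All \<open>card B * (card V - card B)\<close> boundary edges contribute equally to a
  step, and their sum is the exponential moment of an exponential variable of that many times the
  rate \<open>\<rho>\<close>. Iteration yields the moment of a sum of independent waiting times;
  \<open>\<mu>\<close> has to lie below each of their rates.\<close>

lemma nn_integral_explore:
  assumes V: "finite V" and \<rho>: "0 < \<rho>"
    and "B \<subseteq> V" "B \<noteq> {}" "card B + r \<le> card V"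
    and "\<And>i. card B \<le> i \<Longrightarrow> i < card B + r \<Longrightarrow> \<mu> < \<rho> * (real i * (real (card V) - real i))"
  shows "(\<integral>\<^sup>+ x. explore \<mu> V r B x \<partial>Pi\<^sub>M (complete_edges V) (\<lambda>i. expo \<rho>))
    = ennreal (\<Prod>i=card B..<card B + r. \<rho> * (real i * (real (card V) - real i))
        / (\<rho> * (real i * (real (card V) - real i)) - \<mu>))"
  using assms(3-)
proof (induction r arbitrary: B)
  case 0
  interpret prob_space "Pi\<^sub>M (complete_edges V) (\<lambda>i. expo \<rho>)"
    using \<rho> by (intro prob_space_PiM prob_space_exponential_density)
  show ?case by (simp add: emeasure_space_1[unfolded space_PiM_expo])
next
  case (Suc r)
  let ?P = "Pi\<^sub>M (complete_edges V) (\<lambda>i. expo \<rho>)"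
  let ?J = "boundary V B"
  let ?t = "\<lambda>i. \<rho> * (real i * (real (card V) - real i))"
  let ?\<Pi> = "\<Prod>i=Suc (card B)..<Suc (card B) + r. ?t i / (?t i - \<mu>)"
  have finB: "finite B" using Suc.prems V finite_subset by blast
  have cJ: "real (card ?J) = real (card B) * (real (card V) - real (card B))"
    using Suc.prems V by (simp add: card_boundary of_nat_diff card_mono)
  have fJ: "finite ?J" 
    using finite_complete_edges[OF V] boundary_subset by (rule finite_subset[rotated])
  have lt: "\<mu> < \<rho> * real (card ?J)" using Suc.prems(4)[of "card B"] cJ by simp
  have e: "(\<integral>\<^sup>+ x. indicator {x. \<forall>f\<in>?J. x e \<le> x f} x * ennreal (exp (\<mu> * x e)) *
     explore \<mu> V r (B \<union> e) (shift_on (?J - {e}) (x e) x) \<partial>?P)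
     = ennreal (\<rho> / (\<rho> * real (card ?J) - \<mu>)) * ennreal ?\<Pi>" if eJ: "e \<in> ?J" for e
  proof -
    have "e \<subseteq> V" using eJ by (auto simp: boundary_def complete_edges_def)
    obtain u w where uw: "e = {u, w}" "u \<in> B" "w \<in> V - B"
      using eJ unfolding boundary_eq_image[OF Suc.prems(1)] by auto
    have cB: "card (B \<union> e) = Suc (card B)" using uw finB by (simp add: insert_absorb)
    have "explore \<mu> V r (B \<union> e) (x(e := z)) = explore \<mu> V r (B \<union> e) x" for x z
      by (intro explore_cong) auto
    hence "(\<integral>\<^sup>+ x. indicator {x. \<forall>f\<in>?J. x e \<le> x f} x * ennreal (exp (\<mu> * x e)) *
     explore \<mu> V r (B \<union> e) (shift_on (?J - {e}) (x e) x) \<partial>?P)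
      = ennreal (\<rho> / (\<rho> * real (card ?J) - \<mu>)) * (\<integral>\<^sup>+ x. explore \<mu> V r (B \<union> e) x \<partial>?P)"
      using eJ \<rho> lt V
      by (intro nn_integral_PiM_expo_argmin finite_complete_edges boundary_subset explore_measurable) auto
    also have "(\<integral>\<^sup>+ x. explore \<mu> V r (B \<union> e) x \<partial>?P) = ennreal ?\<Pi>"
      using Suc.prems \<open>e \<subseteq> V\<close> by (subst Suc.IH) (auto simp: cB)
    finally show ?thesis .
  qed
  have m: "(\<lambda>x. indicator {x. \<forall>f\<in>?J. x e \<le> x f} x * ennreal (exp (\<mu> * x e)) *
     explore \<mu> V r (B \<union> e) (shift_on (?J - {e}) (x e) x)) \<in> borel_measurable ?P" if "e \<in> ?J" for e
  proof -
    have b: "i \<in> complete_edges V" if "i \<in> ?J" for i using that boundary_subset by blast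
    have c: "(\<lambda>x. x i) \<in> borel_measurable (Pi\<^sub>M (complete_edges V) (\<lambda>i. borel :: real measure))" if "i \<in> ?J" for i
      using b[OF that] by simp
    have "(\<lambda>x. ennreal (exp (\<mu> * x e))) \<in> borel_measurable (Pi\<^sub>M (complete_edges V) (\<lambda>i. borel))"
      using c[OF that] by simp
    hence "(\<lambda>x. indicator {x. \<forall>f\<in>?J. x e \<le> x f} x * ennreal (exp (\<mu> * x e)) *
     explore \<mu> V r (B \<union> e) (shift_on (?J - {e}) (x e) x)) \<in> borel_measurable (Pi\<^sub>M (complete_edges V) (\<lambda>i. borel))"
      using that by (intro borel_measurable_times_ennreal
        indicator_ball_ge_measurable fJ c measurable_compose[OF measurable_shift_on_comp explore_measurable[OF V]])
        (auto dest: b)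
    thus ?thesis by (simp cong: measurable_cong_sets)
  qed
  have "(\<integral>\<^sup>+ x. explore \<mu> V (Suc r) B x \<partial>?P)
    = (\<Sum>e\<in>?J. \<integral>\<^sup>+ x. indicator {x. \<forall>f\<in>?J. x e \<le> x f} x * ennreal (exp (\<mu> * x e)) *
     explore \<mu> V r (B \<union> e) (shift_on (?J - {e}) (x e) x) \<partial>?P)"
    using m by (simp add: nn_integral_sum)
  also have "\<dots> = of_nat (card ?J) * (ennreal (\<rho> / (\<rho> * real (card ?J) - \<mu>)) * ennreal ?\<Pi>)"
    by (simp add: e)
  also have "\<dots> = ennreal (real (card ?J) * (\<rho> / (\<rho> * real (card ?J) - \<mu>)) * ?\<Pi>)"
  proof -
    have "of_nat m * (ennreal a * ennreal b) = ennreal (real m * a * b)" if "0 \<le> a" for m a b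
      using that by (simp add: ennreal_of_nat_eq_real_of_nat ennreal_mult' mult.assoc)
    thus ?thesis using \<rho> lt by simp
  qed
  also have "real (card ?J) * (\<rho> / (\<rho> * real (card ?J) - \<mu>)) = ?t (card B) / (?t (card B) - \<mu>)"
    by (simp add: cJ)
  also have "?t (card B) / (?t (card B) - \<mu>) * ?\<Pi> = (\<Prod>i=card B..<card B + Suc r. ?t i / (?t i - \<mu>))"
    by (subst (2) prod.atLeast_Suc_lessThan) simp_all
  finally show ?case .
qed

section \<open>Reachability by cheap edge sets and the tail of the growth time\<close>

abbreviation edge_rel :: "'v set set \<Rightarrow> ('v \<times> 'v) set" where
  "edge_rel F \<equiv> {(x, y). {x, y} \<in> F}"

lemma edge_rel_rtrancl_mono: "F \<subseteq> F' \<Longrightarrow> p \<in> (edge_rel F)\<^sup>* \<Longrightarrow> p \<in> (edge_rel F')\<^sup>*"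
  using rtrancl_mono[of "edge_rel F" "edge_rel F'"] by auto

lemma edge_rel_rtrancl_sym: "(x, y) \<in> (edge_rel F)\<^sup>* \<Longrightarrow> (y, x) \<in> (edge_rel F)\<^sup>*"
  by (rule symD[OF sym_rtrancl]) (auto simp: sym_def insert_commute)

text \<open>
  The connecting set \<open>F\<close> either is empty or leaves \<open>B\<close> through exactly one edge; this makes the
  weight of \<open>F\<close> grow by exactly the subtracted amount when one exploration step is undone.
\<close>
lemma explore_reach:
  assumes "finite V" "B \<subseteq> V" "B \<noteq> {}" "card B + r \<le> card V"
    and "\<And>f. f \<in> complete_edges V \<Longrightarrow> 0 \<le> x f"
  shows "\<exists>D c. D \<subseteq> V \<and> card D = card B + r \<and> 0 \<le> c \<and> ennreal (exp (\<mu> * c)) \<le> explore \<mu> V r B x \<and>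
    (\<forall>w\<in>D. \<exists>F\<subseteq>complete_edges V. \<exists>b\<in>B. (b, w) \<in> (edge_rel F)\<^sup>* \<and> sum x F \<le> c \<and>
      (F = {} \<or> (\<exists>z\<in>V - B. {f \<in> F. f \<inter> B \<noteq> {}} = {{b, z}})))"
  using assms(2-)
proof (induction r arbitrary: B x)
  case 0
  show ?case
    by (rule exI[of _ B], rule exI[of _ 0]) (use 0 in \<open>auto intro!: exI[of _ "{}"]\<close>)
next
  case (Suc r)
  let ?J = "boundary V B" and ?E = "complete_edges V"
  have finB: "finite B" using Suc.prems assms(1) finite_subset by blast
  have fJ: "finite ?J" 
    using finite_complete_edges[OF assms(1)] boundary_subset by (rule finite_subset[rotated])
  have "card ?J > 0" using Suc.prems finB by (simp add: card_boundary assms(1) card_gt_0_iff)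
  hence "?J \<noteq> {}" by auto
  then obtain e where e: "e \<in> ?J" "\<forall>f\<in>?J. x e \<le> x f"
    using fJ ex_min_if_finite[of "x ` ?J"] by (auto simp: not_less) 
  obtain u v where uv: "e = {u, v}" "u \<in> B" "v \<in> V - B"
    using e(1) unfolding boundary_eq_image[OF Suc.prems(1)] by auto
  have cB: "card (B \<union> e) = Suc (card B)" using uv finB by (simp add: insert_absorb)
  define y where "y = shift_on (?J - {e}) (x e) x"
  have eE: "e \<in> ?E" using e boundary_subset by blast
  have y0: "0 \<le> y f" if "f \<in> ?E" for f
    using e Suc.prems(4)[OF that] by (auto simp: y_def shift_on_def)
  have "\<exists>D c. D \<subseteq> V \<and> card D = card (B \<union> e) + r \<and> 0 \<le> c \<and> ennreal (exp (\<mu> * c)) \<le> explore \<mu> V r (B \<union> e) y \<and>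
    (\<forall>w\<in>D. \<exists>F\<subseteq>?E. \<exists>b\<in>B \<union> e. (b, w) \<in> (edge_rel F)\<^sup>* \<and> sum y F \<le> c \<and>
      (F = {} \<or> (\<exists>z\<in>V - (B \<union> e). {f \<in> F. f \<inter> (B \<union> e) \<noteq> {}} = {{b, z}})))"
    using Suc.prems uv cB y0 by (intro Suc.IH) auto
  then obtain D c where D: "D \<subseteq> V" "card D = card B + Suc r" "0 \<le> c"
     "ennreal (exp (\<mu> * c)) \<le> explore \<mu> V r (B \<union> e) y"
     and DF: "\<And>w. w \<in> D \<Longrightarrow> \<exists>F\<subseteq>?E. \<exists>b\<in>B \<union> e. (b, w) \<in> (edge_rel F)\<^sup>* \<and> sum y F \<le> c \<and>
      (F = {} \<or> (\<exists>z\<in>V - (B \<union> e). {f \<in> F. f \<inter> (B \<union> e) \<noteq> {}} = {{b, z}}))"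
    using cB by auto
  have "ennreal (exp (\<mu> * (x e + c))) = ennreal (exp (\<mu> * x e)) * ennreal (exp (\<mu> * c))"
    by (simp add: distrib_left exp_add ennreal_mult')
  also have "\<dots> \<le> indicator {x. \<forall>f\<in>?J. x e \<le> x f} x * ennreal (exp (\<mu> * x e)) * explore \<mu> V r (B \<union> e) y"
    using D e by (auto intro!: mult_left_mono)
  \<comment> \<open>A single lightest edge suffices: the other summands are nonnegative, so ties
    only enlarge the right-hand side.\<close>
  also have "\<dots> \<le> explore \<mu> V (Suc r) B x"
    unfolding explore.simps y_def using e fJ
    by (intro member_le_sum[where i = e and f = "\<lambda>e. indicator {x. \<forall>f\<in>?J. x e \<le> x f} x *
      ennreal (exp (\<mu> * x e)) * explore \<mu> V r (B \<union> e) (shift_on (?J - {e}) (x e) x)"]) auto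
  finally have le: "ennreal (exp (\<mu> * (x e + c))) \<le> explore \<mu> V (Suc r) B x" .
  have xe: "0 \<le> x e" using Suc.prems eE by auto
  have "\<exists>F\<subseteq>?E. \<exists>b\<in>B. (b, w) \<in> (edge_rel F)\<^sup>* \<and> sum x F \<le> x e + c \<and>
      (F = {} \<or> (\<exists>z\<in>V - B. {f \<in> F. f \<inter> B \<noteq> {}} = {{b, z}}))" if w: "w \<in> D" for w
  proof -
    obtain F b where F: "F \<subseteq> ?E" "b \<in> B \<union> e" "(b, w) \<in> (edge_rel F)\<^sup>*" "sum y F \<le> c"
      and F0: "F = {} \<or> (\<exists>z\<in>V - (B \<union> e). {f \<in> F. f \<inter> (B \<union> e) \<noteq> {}} = {{b, z}})"
      using DF[OF w] by (elim exE conjE bexE) (rule that)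
    have finF: "finite F" using F(1) finite_complete_edges[OF assms(1)] finite_subset by blast
    have bcase: "b \<in> B \<or> b = v" using F(2) uv by auto
    show ?thesis
    \<comment> \<open>If \<open>b\<close> is an old vertex, \<open>F\<close> leaves \<open>B\<close>
      only through \<open>{b, z}\<close>, whose weight was lowered by exactly \<open>x e\<close>,
      unless \<open>F\<close> is empty. If \<open>b = v\<close>, no edge of \<open>F\<close> meets
      \<open>B\<close>, so its weights were not lowered, and \<open>e\<close> itself is put in
      front.\<close>
    proof (cases "b = v")
      case False
      hence b: "b \<in> B" using bcase by simp
      show ?thesis
      proof (cases "F = {}")
        case True
        thus ?thesis using b F D(3) xe by (intro exI[of _ F]) auto
      next
        case F1: False
        then obtain z where z: "z \<in> V - (B \<union> e)" "{f \<in> F. f \<inter> (B \<union> e) \<noteq> {}} = {{b, z}}"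
          using F0 by auto
        have bzF: "{b, z} \<in> F" using z by blast
        have tB: "{f \<in> F. f \<inter> B \<noteq> {}} = {{b, z}}"
          using z b bzF by blast
        have bz: "{b, z} \<in> ?J - {e}"
          using z b F(1) bzF uv by (auto simp: boundary_def doubleton_eq_iff)
        have "sum x (F - {{b, z}}) = sum y (F - {{b, z}})"
        proof (rule sum.cong)
          fix f assume "f \<in> F - {{b, z}}"
          hence "f \<inter> B = {}" using tB by auto
          hence "f \<notin> ?J" by (auto simp: boundary_def)
          thus "x f = y f" by (simp add: y_def shift_on_def)
        qed simp
        moreover have "x {b, z} = y {b, z} + x e" using bz by (simp add: y_def shift_on_def)
        ultimately have "sum x F = sum y F + x e"
          using finF bzF by (simp add: sum.remove[of F "{b, z}"])
        thus ?thesis using b F z tB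
          by (intro exI[of _ F] conjI bexI[of _ b]) auto
      qed
    next
      case True
      have nF: "f \<inter> B = {}" if fF: "f \<in> F" for f
      proof (rule ccontr)
        assume a: "f \<inter> B \<noteq> {}"
        then obtain z where z: "z \<in> V - (B \<union> e)" "{f \<in> F. f \<inter> (B \<union> e) \<noteq> {}} = {{b, z}}"
          using F0 fF by auto
        have "f \<in> {f \<in> F. f \<inter> (B \<union> e) \<noteq> {}}" using a fF by auto
        hence "f = {b, z}" using z by simp
        thus False using a True uv z by auto
      qed
      have eF: "e \<notin> F" using nF uv by auto
      have "sum x F = sum y F"
      proof (rule sum.cong)
        fix f assume "f \<in> F"
        hence "f \<notin> ?J" using nF by (auto simp: boundary_def)
        thus "x f = y f" by (simp add: y_def shift_on_def)
      qed simp
      hence "sum x (insert e F) \<le> x e + c" using finF eF F by simp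
      moreover have "(u, w) \<in> (edge_rel (insert e F))\<^sup>*"
        using edge_rel_rtrancl_mono[of F "insert e F", OF _ F(3)] True uv
        by (intro converse_rtrancl_into_rtrancl[of u v]) auto
      moreover have "{f \<in> insert e F. f \<inter> B \<noteq> {}} = {{u, v}}" using nF uv by auto
      ultimately show ?thesis
        using uv F eE by (intro exI[of _ "insert e F"] conjI bexI[of _ u]) auto
    qed
  qed
  thus ?case using D le xe by (intro exI[of _ D] exI[of _ "x e + c"]) auto
qed

text \<open>The factor at \<open>i = 1\<close> is exactly \<open>(n - 1) / (\<eta> * n - 1)\<close>
  and forces \<open>1 < \<eta> * n\<close>. For \<open>i \<ge> 2\<close> the denominator is at least
  \<open>(i - 1) * (n - i - 1)\<close>, after which the product of \<open>i / (i - 1)\<close> and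
  \<open>(n - i) / (n - i - 1)\<close> telescopes.\<close>

lemma explore_prod_telescope:
  assumes "1 \<le> r" "r + 2 \<le> n" "1 < \<eta> * real n"
  shows "(\<Prod>i=1..<1 + r. real i * (real n - real i) / (real i * (real n - real i) - (1 - \<eta>) * real n))
    \<le> (real n - 1) / (\<eta> * real n - 1) * (real r * (real n - 2) / (real n - real r - 1))"
  using assms(1,2)
proof (induction r rule: dec_induct)
  case base
  have "real n \<ge> 3" using base by simp
  hence "real n - 2 \<noteq> 0" by simp
  thus ?case by (simp add: algebra_simps)
next
  case (step r)
  let ?t = "\<lambda>i::nat. real i * (real n - real i)"
  have r: "real r \<ge> 1" "real n - real r \<ge> 3" using step by linarith+
  have pos: "real r * (real n - real r - 2) > 0" using r by (intro mult_pos_pos) auto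
  \<comment> \<open>The two sides differ by exactly \<open>\<eta> * real n - 1\<close>.\<close>
  have le: "real r * (real n - real r - 2) \<le> ?t (Suc r) - (1 - \<eta>) * real n"
    using assms(3) by (simp add: algebra_simps)
  have t0: "0 \<le> ?t (Suc r)" using r by (intro mult_nonneg_nonneg) auto
  have "?t (Suc r) / (?t (Suc r) - (1 - \<eta>) * real n) \<le> ?t (Suc r) / (real r * (real n - real r - 2))"
    using pos le t0 by (intro divide_left_mono) auto
  moreover have "0 \<le> ?t (Suc r) / (?t (Suc r) - (1 - \<eta>) * real n)"
    using pos le t0 by (intro divide_nonneg_nonneg) auto
  moreover have "(\<Prod>i=1..<1 + r. ?t i / (?t i - (1 - \<eta>) * real n))
      \<le> (real n - 1) / (\<eta> * real n - 1) * (real r * (real n - 2) / (real n - real r - 1))"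
    using step by simp
  moreover have "0 \<le> (real n - 1) / (\<eta> * real n - 1) * (real r * (real n - 2) / (real n - real r - 1))"
    using r assms(3) by (intro mult_nonneg_nonneg divide_nonneg_nonneg) auto
  ultimately have "(\<Prod>i=1..<1 + r. ?t i / (?t i - (1 - \<eta>) * real n)) * (?t (Suc r) / (?t (Suc r) - (1 - \<eta>) * real n))
    \<le> (real n - 1) / (\<eta> * real n - 1) * (real r * (real n - 2) / (real n - real r - 1)) *
       (?t (Suc r) / (real r * (real n - real r - 2)))"
    by (intro mult_mono) auto
  also have "\<dots> = (real n - 1) / (\<eta> * real n - 1) * (real (Suc r) * (real n - 2) / (real n - real (Suc r) - 1))"
  proof -
    have "real r * (real n - 2) / (real n - real r - 1) * (?t (Suc r) / (real r * (real n - real r - 2)))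
       = real (Suc r) * (real n - 2) / (real n - real (Suc r) - 1)"
      using r by (simp add: divide_simps)
    thus ?thesis by (simp only: mult.assoc)
  qed
  finally show ?case by simp
qed

text \<open>Phrased with the total weight of an edge set instead of a shortest path, so that unions
  of such sets directly become candidates for a Steiner subgraph.\<close>

definition reaches :: "'v set \<Rightarrow> ('v set \<Rightarrow> real) \<Rightarrow> real \<Rightarrow> 'v \<Rightarrow> 'v \<Rightarrow> bool" where
  "reaches V x t v w \<longleftrightarrow> (\<exists>F\<subseteq>complete_edges V. (v, w) \<in> (edge_rel F)\<^sup>* \<and> sum x F \<le> t)"

text \<open>Markov's inequality for \<open>explore\<close>, which dominates
  \<open>exp (\<mu> * c)\<close> for the elapsed time \<open>c\<close>, with \<open>\<mu>\<close>
  just below the smallest rate \<open>\<rho> * (card V - 1)\<close>. A measurable exceptional set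
  \<open>Z\<close> is produced, so that measurability of the ball event itself need not be
  discussed.\<close>

lemma ball_growth_tail:
  assumes V: "finite V" "v \<in> V" and \<rho>: "0 < \<rho>" and \<eta>: "1 < \<eta> * real (card V)" "\<eta> < 1"
    and r: "1 \<le> r" "r + 2 \<le> card V"
  obtains Z where "Z \<in> sets (Pi\<^sub>M (complete_edges V) (\<lambda>i. borel))"
    and "emeasure (Pi\<^sub>M (complete_edges V) (\<lambda>i. expo \<rho>)) Z \<le> ennreal (exp (- (\<rho> * (1 - \<eta>) * real (card V) * t)) *
      ((real (card V) - 1) / (\<eta> * real (card V) - 1) * (real r * (real (card V) - 2) / (real (card V) - real r - 1))))"
    and "\<And>x. x \<in> space (Pi\<^sub>M (complete_edges V) (\<lambda>i. borel)) - Z \<Longrightarrow> (\<And>f. f \<in> complete_edges V \<Longrightarrow> 0 \<le> x f) \<Longrightarrow>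
      \<exists>D\<subseteq>V. card D = r + 1 \<and> (\<forall>w\<in>D. reaches V x t v w)"
proof -
  let ?E = "complete_edges V" and ?n = "real (card V)"
  let ?P = "Pi\<^sub>M ?E (\<lambda>i. expo \<rho>)"
  define \<mu> where "\<mu> = \<rho> * (1 - \<eta>) * ?n"
  define Z where "Z = {x \<in> space ?P. 1 \<le> ennreal (exp (- (\<mu> * t))) * explore \<mu> V r {v} x}"
  have n: "?n \<ge> 3" using r by simp
  have \<mu>: "0 < \<mu>" unfolding \<mu>_def using \<rho> \<eta> n by (intro mult_pos_pos) auto
  have [measurable]: "explore \<mu> V r {v} \<in> borel_measurable ?P"
    using explore_measurable[OF V(1)] by (simp cong: measurable_cong_sets)
  have lt: "(1 - \<eta>) * ?n < real i * (?n - real i)" if "1 \<le> i" "i < 1 + r" for i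
  proof -
    \<comment> \<open>This product is \<open>i * (n - i) - (n - 1)\<close>: the smallest rate occurs
      at \<open>i = 1\<close>, and \<open>1 < \<eta> * n\<close> puts \<open>\<mu>\<close> below
      it.\<close>
    have "0 \<le> (real i - 1) * (?n - real i - 1)" using that r by (intro mult_nonneg_nonneg) auto
    thus ?thesis using \<eta> by (simp add: algebra_simps)
  qed
  have "(\<integral>\<^sup>+ x. explore \<mu> V r {v} x \<partial>?P)
    = ennreal (\<Prod>i=1..<1 + r. \<rho> * (real i * (?n - real i)) / (\<rho> * (real i * (?n - real i)) - \<mu>))"
    using lt V \<rho> r by (subst nn_integral_explore) (auto simp: \<mu>_def mult.assoc)
  also have "(\<Prod>i=1..<1 + r. \<rho> * (real i * (?n - real i)) / (\<rho> * (real i * (?n - real i)) - \<mu>))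
    = (\<Prod>i=1..<1 + r. real i * (?n - real i) / (real i * (?n - real i) - (1 - \<eta>) * ?n))"
  proof (rule prod.cong)
    fix i
    have "\<rho> * (real i * (?n - real i)) - \<mu> = \<rho> * (real i * (?n - real i) - (1 - \<eta>) * ?n)"
      by (simp add: \<mu>_def algebra_simps)
    thus "\<rho> * (real i * (?n - real i)) / (\<rho> * (real i * (?n - real i)) - \<mu>)
      = real i * (?n - real i) / (real i * (?n - real i) - (1 - \<eta>) * ?n)"
      using \<rho> by (simp only: mult_divide_mult_cancel_left)
  qed simp
  finally have I: "(\<integral>\<^sup>+ x. explore \<mu> V r {v} x \<partial>?P) \<le>
     ennreal ((?n - 1) / (\<eta> * ?n - 1) * (real r * (?n - 2) / (?n - real r - 1)))"
    using explore_prod_telescope[OF r \<eta>(1)] by (simp add: ennreal_leI)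
  show thesis
  proof (rule that[of Z])
    have "Z \<in> sets ?P" unfolding Z_def by measurable
    thus "Z \<in> sets (Pi\<^sub>M ?E (\<lambda>i. borel))" by (simp only: sets_PiM_expo)
    have "emeasure ?P Z \<le> ennreal (exp (- (\<mu> * t))) * (\<integral>\<^sup>+ x. explore \<mu> V r {v} x * indicator (space ?P) x \<partial>?P)"
      unfolding Z_def by (intro nn_integral_Markov_inequality) simp_all
    also have "(\<integral>\<^sup>+ x. explore \<mu> V r {v} x * indicator (space ?P) x \<partial>?P) = (\<integral>\<^sup>+ x. explore \<mu> V r {v} x \<partial>?P)"
      by (intro nn_integral_cong) simp
    also have "ennreal (exp (- (\<mu> * t))) * \<dots> \<le> ennreal (exp (- (\<mu> * t))) *
       ennreal ((?n - 1) / (\<eta> * ?n - 1) * (real r * (?n - 2) / (?n - real r - 1)))"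
      using I by (intro mult_left_mono) auto
    finally show "emeasure ?P Z \<le> ennreal (exp (- (\<rho> * (1 - \<eta>) * ?n * t)) *
      ((?n - 1) / (\<eta> * ?n - 1) * (real r * (?n - 2) / (?n - real r - 1))))"
      by (simp only: \<mu>_def ennreal_mult' exp_ge_zero)
    fix x assume x: "x \<in> space (Pi\<^sub>M ?E (\<lambda>i. borel)) - Z" "\<And>f. f \<in> ?E \<Longrightarrow> 0 \<le> x f"
    obtain D c where D: "D \<subseteq> V" "card D = r + 1" "ennreal (exp (\<mu> * c)) \<le> explore \<mu> V r {v} x"
      and R: "\<And>w. w \<in> D \<Longrightarrow> reaches V x c v w"
      using explore_reach[of V "{v}" r x \<mu>] V r x(2) unfolding reaches_def by fastforce
    have "ennreal (exp (- (\<mu> * t))) * ennreal (exp (\<mu> * c)) \<le> ennreal (exp (- (\<mu> * t))) * explore \<mu> V r {v} x"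
      using D by (intro mult_left_mono) auto
    also have "\<dots> < 1" using x(1) by (auto simp: Z_def)
    finally have "exp (\<mu> * c - \<mu> * t) < 1"
      by (simp add: exp_diff exp_minus divide_inverse mult.commute flip: ennreal_mult')
    hence "c < t" using \<mu> by simp
    hence "\<forall>w\<in>D. reaches V x t v w" using R unfolding reaches_def by (meson less_imp_le order_trans)
    thus "\<exists>D\<subseteq>V. card D = r + 1 \<and> (\<forall>w\<in>D. reaches V x t v w)" using D by blast
  qed
qed

lemma emeasure_PiM_expo_atLeast:
  assumes "finite I" "J \<subseteq> I" "0 < \<rho>" "0 \<le> s"
  shows "emeasure (Pi\<^sub>M I (\<lambda>i. expo \<rho>)) {x \<in> space (Pi\<^sub>M I (\<lambda>i. borel)). \<forall>i\<in>J. s \<le> x i} = ennreal (exp (- \<rho> * s * real (card J)))"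
proof -
  interpret prob_space "Pi\<^sub>M I (\<lambda>i. expo \<rho>)"
    using assms by (intro prob_space_PiM prob_space_exponential_density)
  have m: "{x \<in> space (Pi\<^sub>M I (\<lambda>i. borel)). \<forall>i\<in>J. s \<le> x i} \<in> sets (Pi\<^sub>M I (\<lambda>i. expo \<rho>))"
    unfolding sets_PiM_expo using assms finite_subset[of J I]
    by (intro sets.sets_Collect_finite_All borel_measurable_le measurable_const measurable_component_singleton) auto
  have "emeasure (Pi\<^sub>M I (\<lambda>i. expo \<rho>)) {x \<in> space (Pi\<^sub>M I (\<lambda>i. borel)). \<forall>i\<in>J. s \<le> x i}
     = (\<integral>\<^sup>+ x. indicator {x \<in> space (Pi\<^sub>M I (\<lambda>i. borel)). \<forall>i\<in>J. s \<le> x i} x \<partial>Pi\<^sub>M I (\<lambda>i. expo \<rho>))"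
    using m by (rule nn_integral_indicator[symmetric])
  also have "\<dots> = (\<integral>\<^sup>+ x. indicator {x. \<forall>i\<in>J. s \<le> x i} x * 1 \<partial>Pi\<^sub>M I (\<lambda>i. expo \<rho>))"
    by (intro nn_integral_cong) (simp add: indicator_def)
  also have "\<dots> = ennreal (exp (- \<rho> * s * real (card J)))"
    using nn_integral_PiM_expo_shift[OF assms(1-4), of "\<lambda>_. 1"]
    by (simp add: emeasure_space_1[unfolded space_PiM_expo])
  finally show ?thesis .
qed

lemma AE_PiM_expo_nonneg:
  assumes "finite I" "0 < \<rho>"
  shows "AE x in Pi\<^sub>M I (\<lambda>i. expo \<rho>). \<forall>i\<in>I. 0 \<le> x i"
proof -
  have "AE x in Pi\<^sub>M I (\<lambda>i. expo \<rho>). 0 \<le> x i" if "i \<in> I" for i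
    using that assms AE_expo_nonneg by (intro AE_PiM_component prob_space_exponential_density) auto
  thus ?thesis using assms by (intro AE_finite_allI) auto
qed

section \<open>Joining reachable sets into a Steiner subgraph\<close>

text \<open>Membership in the competing set is not automatic: \<open>F\<close> is first cut down to the component of \<open>d\<close>.\<close>
lemma steiner_weight_le_connecting:
  assumes "finite V" "F \<subseteq> complete_edges V" "d \<in> V" "S \<subseteq> V"
    and conn: "\<And>v. v \<in> S \<Longrightarrow> (v, d) \<in> (edge_rel F)\<^sup>*"
    and w: "\<And>f. f \<in> complete_edges V \<Longrightarrow> 0 \<le> w f"
  shows "steiner_weight V (complete_edges V) w S \<le> sum w F"
proof -
  let ?E = "complete_edges V"
  define U where "U = {u. (d, u) \<in> (edge_rel F)\<^sup>*}"
  define F' where "F' = {f \<in> F. f \<subseteq> U}"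
  have UV: "U \<subseteq> V"
  proof
    fix u assume "u \<in> U"
    hence "(d, u) \<in> (edge_rel F)\<^sup>*" by (simp add: U_def)
    thus "u \<in> V"
      by (induction rule: rtrancl_induct) (use assms in \<open>auto simp: complete_edges_def\<close>)
  qed
  have d: "(d, u) \<in> (edge_rel F')\<^sup>*" if "u \<in> U" for u
  proof -
    have "(d, u) \<in> (edge_rel F)\<^sup>*" using that by (simp add: U_def)
    thus ?thesis
    proof (induction rule: rtrancl_induct)
      case (step y z)
      hence "y \<in> U" "z \<in> U" by (auto simp: U_def intro: rtrancl_into_rtrancl)
      hence "(y, z) \<in> edge_rel F'" using step by (auto simp: F'_def)
      with step.IH show ?case by (rule rtrancl_into_rtrancl)
    qed simp
  qed
  have "connected_graph U F'"
    unfolding connected_graph_def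
  proof (intro conjI ballI)
    show "U \<noteq> {}" by (auto simp: U_def)
    fix u v assume "u \<in> U" "v \<in> U"
    thus "(u, v) \<in> (edge_rel F')\<^sup>*"
      using rtrancl_trans[OF edge_rel_rtrancl_sym[OF d] d] by simp
  qed
  moreover have "is_subgraph U F' V ?E"
    using UV assms by (auto simp: is_subgraph_def F'_def)
  moreover have "S \<subseteq> U" using edge_rel_rtrancl_sym[OF conn] by (auto simp: U_def)
  ultimately have mem: "sum w F' \<in> {\<Sum>e\<in>F. w e | U F. is_subgraph U F V ?E \<and> connected_graph U F \<and> S \<subseteq> U}"
    by blast
  have "finite {\<Sum>e\<in>F. w e | U F. is_subgraph U F V ?E \<and> connected_graph U F \<and> S \<subseteq> U}"
    by (rule finite_subset[of _ "sum w ` Pow ?E"])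
      (use finite_complete_edges[OF assms(1)] in \<open>auto simp: is_subgraph_def\<close>)
  hence "steiner_weight V ?E w S \<le> sum w F'"
    unfolding steiner_weight_def using mem by (rule Min_le)
  also have "\<dots> \<le> sum w F"
    using assms finite_complete_edges[OF assms(1)] finite_subset
    by (intro sum_mono2) (auto simp: F'_def)
  finally show ?thesis .
qed

lemma sum_UN_le:
  fixes w :: "'b \<Rightarrow> real"
  assumes "finite I" "\<And>i. i \<in> I \<Longrightarrow> finite (F i)" "\<And>i f. i \<in> I \<Longrightarrow> f \<in> F i \<Longrightarrow> 0 \<le> w f"
  shows "sum w (\<Union>i\<in>I. F i) \<le> (\<Sum>i\<in>I. sum w (F i))"
  using assms
proof (induction I)
  case (insert i I)
  have "sum w (F i \<union> (\<Union>i\<in>I. F i)) \<le> sum w (F i) + sum w (\<Union>i\<in>I. F i)"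
    using insert by (subst sum.union_inter[symmetric]) (auto intro!: sum_nonneg)
  also have "\<dots> \<le> sum w (F i) + (\<Sum>i\<in>I. sum w (F i))" using insert by auto
  finally show ?case using insert by simp
qed simp

text \<open>All terminals other than \<open>v\<close> meet at the common vertex \<open>d\<close>,
  each at cost \<open>t2\<close>; \<open>v\<close> reaches \<open>a\<close> at cost
  \<open>t1\<close>, and one second-layer edge bridges \<open>a\<close> and \<open>d\<close>. Only
  one terminal pays the small radius, hence the count \<open>1 + 2 * (k - 1)\<close>.\<close>

lemma steiner_weight_le_join:
  assumes V: "finite V" "S \<subseteq> V" "v \<in> S" "a \<in> V" "d \<in> V"
    and x: "\<And>f. f \<in> complete_edges V \<Longrightarrow> 0 \<le> x f"
    and y: "\<And>f. f \<in> complete_edges V \<Longrightarrow> 0 \<le> y f"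
    and a: "reaches V x t1 v a"
    and d: "\<And>u. u \<in> S - {v} \<Longrightarrow> reaches V x t2 u d"
    and ad: "a = d \<or> y {a, d} \<le> s" "0 \<le> s"
  shows "steiner_weight V (complete_edges V) (\<lambda>e. min (x e) (y e)) S \<le> t1 + s + (real (card S) - 1) * t2"
proof -
  let ?E = "complete_edges V" and ?w = "\<lambda>e. min (x e) (y e)"
  have finS: "finite S" using V finite_subset by blast
  obtain Fa where Fa: "Fa \<subseteq> ?E" "(v, a) \<in> (edge_rel Fa)\<^sup>*" "sum x Fa \<le> t1"
    using a unfolding reaches_def by (elim exE conjE) (rule that)
  have "\<forall>u\<in>S - {v}. \<exists>G. G \<subseteq> ?E \<and> (u, d) \<in> (edge_rel G)\<^sup>* \<and> sum x G \<le> t2"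
    using d unfolding reaches_def by simp
  from bchoice[OF this] obtain F where
    F0: "\<forall>u\<in>S - {v}. F u \<subseteq> ?E \<and> (u, d) \<in> (edge_rel (F u))\<^sup>* \<and> sum x (F u) \<le> t2" ..
  have F: "F u \<subseteq> ?E" "(u, d) \<in> (edge_rel (F u))\<^sup>*" "sum x (F u) \<le> t2" if "u \<in> S - {v}" for u
    using bspec[OF F0 that] by simp_all
  have fin: "finite G" if "G \<subseteq> ?E" for G using that finite_complete_edges[OF V(1)] finite_subset by blast
  have w0: "0 \<le> ?w f" if "f \<in> ?E" for f using x[OF that] y[OF that] by simp
  have wle: "sum ?w G \<le> sum x G" for G by (intro sum_mono) simp
  \<comment> \<open>For \<open>a = d\<close> the set \<open>{a, d}\<close> is a singleton and no
    edge, so no bridge is added.\<close>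
  define J where "J = (if a = d then {} else {{a, d}})"
  have J: "J \<subseteq> ?E" using V by (auto simp: J_def complete_edges_def)
  have wJ: "sum ?w J \<le> s" using ad by (auto simp: J_def)
  define W where "W = Fa \<union> J \<union> (\<Union>u\<in>S - {v}. F u)"
  have WE: "W \<subseteq> ?E" unfolding W_def by (intro Un_least UN_least Fa(1) J F(1))
  have "(v, a) \<in> (edge_rel W)\<^sup>*"
    by (rule edge_rel_rtrancl_mono[OF _ Fa(2)]) (simp add: W_def le_supI1)
  moreover have "(a, d) \<in> (edge_rel W)\<^sup>*"
  proof (cases "a = d")
    case False
    hence "(a, d) \<in> edge_rel W" by (simp add: W_def J_def)
    thus ?thesis by (rule r_into_rtrancl)
  qed simp
  ultimately have v: "(v, d) \<in> (edge_rel W)\<^sup>*" by (rule rtrancl_trans)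
  have conn: "(u, d) \<in> (edge_rel W)\<^sup>*" if "u \<in> S" for u
  proof (cases "u = v")
    case False
    hence u: "u \<in> S - {v}" using that by simp
    show ?thesis
      by (rule edge_rel_rtrancl_mono[OF _ F(2)[OF u]]) (use u in \<open>auto simp: W_def\<close>)
  qed (use v in simp)
  have "steiner_weight V ?E ?w S \<le> sum ?w W"
    by (rule steiner_weight_le_connecting[OF V(1) WE V(5) V(2)]) (erule conn, erule w0)
  also have "\<dots> \<le> sum ?w (Fa \<union> J) + sum ?w (\<Union>u\<in>S - {v}. F u)"
    unfolding W_def using Fa J F(1) fin w0 finS
    by (subst sum.union_inter[symmetric]) (auto intro!: sum_nonneg simp del: Int_Union Int_UN_distrib)
  also have "sum ?w (Fa \<union> J) \<le> sum ?w Fa + sum ?w J"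
    using Fa J fin w0 by (subst sum.union_inter[symmetric]) (auto intro!: sum_nonneg)
  also have "sum ?w Fa + sum ?w J \<le> t1 + s" using wle[of Fa] Fa wJ by linarith
  also have "sum ?w (\<Union>u\<in>S - {v}. F u) \<le> (\<Sum>u\<in>S - {v}. sum ?w (F u))"
    using finS F(1) fin w0 by (intro sum_UN_le) blast+
  also have "\<dots> \<le> (\<Sum>u\<in>S - {v}. t2)"
    using F(3) wle by (intro sum_mono) (meson order_trans)
  also have "\<dots> = (real (card S) - 1) * t2"
  proof -
    have "card S \<ge> 1" using V finS by (simp add: Suc_le_eq card_gt_0_iff) blast
    thus ?thesis using V(3) finS by (simp add: card_Diff_singleton of_nat_diff)
  qed
  finally show ?thesis by simp
qed

section \<open>The upper tail\<close>

lemma steiner_weight_cong: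
  assumes "\<And>e. e \<in> E \<Longrightarrow> w e = w' e"
  shows "steiner_weight V E w S = steiner_weight V E w' S"
proof -
  have "sum w F = sum w' F" if "is_subgraph U F V E" for U F
    using that assms by (intro sum.cong) (auto simp: is_subgraph_def)
  hence "{\<Sum>e\<in>F. w e | U F. is_subgraph U F V E \<and> connected_graph U F \<and> S \<subseteq> U}
    = {\<Sum>e\<in>F. w' e | U F. is_subgraph U F V E \<and> connected_graph U F \<and> S \<subseteq> U}"
    by (intro Collect_cong ex_cong) (auto; metis)
  thus ?thesis by (simp add: steiner_weight_def)
qed

lemma max_steiner_weight_cong:
  assumes "\<And>e. e \<in> E \<Longrightarrow> w e = w' e"
  shows "max_steiner_weight V E w k = max_steiner_weight V E w' k"
proof -
  have "steiner_weight V E w S = steiner_weight V E w' S" for S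
    using assms by (rule steiner_weight_cong)
  thus ?thesis by (simp add: max_steiner_weight_def)
qed

lemma max_steiner_weight_eq_image:
  "max_steiner_weight V E w k = Max ((\<lambda>S. steiner_weight V E w S) ` {S. S \<subseteq> V \<and> card S = k})"
  by (auto simp: max_steiner_weight_def intro!: arg_cong[where f = Max])

lemma finite_nsubsets: "finite V \<Longrightarrow> finite {S. S \<subseteq> V \<and> card S = k}"
  by (rule finite_subset[of _ "Pow V"]) auto

lemma nsubsets_nonempty: "finite V \<Longrightarrow> k \<le> card V \<Longrightarrow> {S. S \<subseteq> V \<and> card S = k} \<noteq> {}"
  by (metis (mono_tags, lifting) Collect_empty_eq obtain_subset_with_card_n)

lemma max_steiner_weight_less_iff:
  assumes "finite V" "k \<le> card V"
  shows "max_steiner_weight V E w k < c \<longleftrightarrow> (\<forall>S. S \<subseteq> V \<and> card S = k \<longrightarrow> steiner_weight V E w S < c)"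
  unfolding max_steiner_weight_eq_image
  using finite_nsubsets[OF assms(1)] nsubsets_nonempty[OF assms] by (subst Max_less_iff) auto

lemma max_steiner_weight_le_iff:
  assumes "finite V" "k \<le> card V"
  shows "max_steiner_weight V E w k \<le> c \<longleftrightarrow> (\<forall>S. S \<subseteq> V \<and> card S = k \<longrightarrow> steiner_weight V E w S \<le> c)"
  unfolding max_steiner_weight_eq_image
  using finite_nsubsets[OF assms(1)] nsubsets_nonempty[OF assms] by (subst Max_le_iff) auto

lemma steiner_weight_measurable:
  assumes "finite V"
  shows "(\<lambda>x. steiner_weight V (complete_edges V) x S) \<in> borel_measurable (Pi\<^sub>M (complete_edges V) (\<lambda>i. borel))"
proof -
  let ?E = "complete_edges V"
  let ?\<F> = "{F. \<exists>U. is_subgraph U F V ?E \<and> connected_graph U F \<and> S \<subseteq> U}"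
  have eq: "steiner_weight V ?E x S = Min ((\<lambda>F. sum x F) ` ?\<F>)" for x
    unfolding steiner_weight_def by (intro arg_cong[where f = Min]) auto
  have fin: "finite ?\<F>"
    by (rule finite_subset[of _ "Pow ?E"]) (use finite_complete_edges[OF assms] in \<open>auto simp: is_subgraph_def\<close>)
  show ?thesis unfolding eq
    by (intro borel_measurable_Min fin borel_measurable_sum measurable_component_singleton)
      (auto simp: is_subgraph_def)
qed

lemma max_steiner_weight_measurable:
  assumes "finite V"
  shows "(\<lambda>x. max_steiner_weight V (complete_edges V) x k) \<in> borel_measurable (Pi\<^sub>M (complete_edges V) (\<lambda>i. borel))"
  unfolding max_steiner_weight_eq_image
  by (intro borel_measurable_Max finite_nsubsets steiner_weight_measurable assms)

section \<open>Sprinkling the second layer and the union bounds\<close>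

text \<open>Union bound for the complements within \<open>V\<close>, each of size at most
  \<open>card V - b\<close>.\<close>

lemma card_Inter_ge:
  assumes "finite V" "finite I" "\<And>i. i \<in> I \<Longrightarrow> D i \<subseteq> V" "\<And>i. i \<in> I \<Longrightarrow> real (card (D i)) \<ge> b"
  shows "real (card V) - real (card I) * (real (card V) - b) \<le> real (card (V \<inter> (\<Inter>i\<in>I. D i)))"
proof -
  have "V - (V \<inter> (\<Inter>i\<in>I. D i)) = (\<Union>i\<in>I. V - D i)" by auto
  hence "card (V - (V \<inter> (\<Inter>i\<in>I. D i))) \<le> (\<Sum>i\<in>I. card (V - D i))"
    using assms card_UN_le by metis
  hence "real (card (V - (V \<inter> (\<Inter>i\<in>I. D i)))) \<le> (\<Sum>i\<in>I. real (card (V - D i)))"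
    by (metis of_nat_mono of_nat_sum)
  also have "\<dots> \<le> (\<Sum>i\<in>I. real (card V) - b)"
  proof (rule sum_mono)
    fix i assume i: "i \<in> I"
    hence "D i \<subseteq> V" using assms by simp
    hence "finite (D i)" "card (D i) \<le> card V" using assms(1) by (auto intro: finite_subset card_mono)
    thus "real (card (V - D i)) \<le> real (card V) - b"
      using assms(4)[OF i] \<open>D i \<subseteq> V\<close> by (simp add: card_Diff_subset of_nat_diff)
  qed
  also have "real (card (V - (V \<inter> (\<Inter>i\<in>I. D i)))) = real (card V) - real (card (V \<inter> (\<Inter>i\<in>I. D i)))"
    using assms by (subst card_Diff_subset) (auto simp: of_nat_diff card_mono)
  finally show ?thesis by simp
qed

lemma card_cross_edges:
  assumes "finite A" "finite D" "A \<inter> D = {}"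
  shows "card ((\<lambda>(a, d). {a, d}) ` (A \<times> D)) = card A * card D"
proof -
  have "inj_on (\<lambda>(a, d). {a, d}) (A \<times> D)"
    using assms by (auto simp: inj_on_def doubleton_eq_iff)
  thus ?thesis by (simp add: card_image card_cartesian_product)
qed

text \<open>
  Given the first layer of weights, every vertex has a small ball \<open>A\<close> and a large ball \<open>D\<close>; the
  independent second layer supplies a cheap edge from \<open>A v\<close> to the intersection of the large balls
  of the other terminals.
\<close>
lemma sprinkling_bound:
  assumes V: "finite V" "S \<subseteq> V" "card S = k" "2 \<le> k"
    and \<delta>: "0 < \<delta>" and s: "0 \<le> s" and b: "0 < a" "0 < m" "m \<le> real (card V) - (real k - 1) * (real (card V) - b)"
    and x: "\<And>f. f \<in> complete_edges V \<Longrightarrow> 0 \<le> x f"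
    and A: "\<And>v. v \<in> V \<Longrightarrow> \<exists>A\<subseteq>V. a \<le> real (card A) \<and> (\<forall>w\<in>A. reaches V x t1 v w)"
    and D: "\<And>v. v \<in> V \<Longrightarrow> \<exists>D\<subseteq>V. b \<le> real (card D) \<and> (\<forall>w\<in>D. reaches V x t2 v w)"
  obtains Y where "Y \<in> sets (Pi\<^sub>M (complete_edges V) (\<lambda>i. borel))"
    "emeasure (Pi\<^sub>M (complete_edges V) (\<lambda>i. expo \<delta>)) Y \<le> ennreal (exp (- (\<delta> * s * (a * m))))"
    "\<And>y. y \<in> space (Pi\<^sub>M (complete_edges V) (\<lambda>i. borel)) - Y \<Longrightarrow> (\<And>f. f \<in> complete_edges V \<Longrightarrow> 0 \<le> y f) \<Longrightarrow>
       steiner_weight V (complete_edges V) (\<lambda>e. min (x e) (y e)) S \<le> t1 + s + (real k - 1) * t2"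
proof -
  let ?E = "complete_edges V"
  have finS: "finite S" using V finite_subset by blast
  have "S \<noteq> {}" using V by auto
  then obtain v where v: "v \<in> S" by auto
  obtain A where A: "A \<subseteq> V" "a \<le> real (card A)" "\<And>w. w \<in> A \<Longrightarrow> reaches V x t1 v w"
    using A[of v] v V by (meson subsetD)
  have "\<forall>u\<in>S - {v}. \<exists>D. D \<subseteq> V \<and> b \<le> real (card D) \<and> (\<forall>w\<in>D. reaches V x t2 u w)"
    using D V by auto
  from bchoice[OF this] obtain D where
    D: "\<forall>u\<in>S - {v}. D u \<subseteq> V \<and> b \<le> real (card (D u)) \<and> (\<forall>w\<in>D u. reaches V x t2 u w)" ..
  define I where "I = V \<inter> (\<Inter>u\<in>S - {v}. D u)"
  have cSv: "real (card (S - {v})) = real k - 1"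
    using v V finS by (simp add: card_Diff_singleton of_nat_diff)
  have cI: "m \<le> real (card I)"
    using card_Inter_ge[of V "S - {v}" D b] D V finS b unfolding I_def cSv by force
  have finI: "finite I" and finA: "finite A" using V A finite_subset by (auto simp: I_def)
  have IR: "reaches V x t2 u d" if "d \<in> I" "u \<in> S - {v}" for d u
    using D that by (auto simp: I_def)
  have st: "steiner_weight V ?E (\<lambda>e. min (x e) (y e)) S \<le> t1 + s + (real k - 1) * t2"
    if "c \<in> A" "d \<in> I" "c = d \<or> y {c, d} \<le> s" "\<And>f. f \<in> ?E \<Longrightarrow> 0 \<le> y f" for c d y
  proof -
    have "c \<in> V" "d \<in> V" using that A by (auto simp: I_def)
    from steiner_weight_le_join[where a = c and d = d and x = x and y = y, OF V(1,2) v this x that(4)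
        A(3)[OF that(1)] IR[OF that(2)] that(3) s]
    show ?thesis by (simp only: V(3))
  qed
  show thesis
  proof (cases "A \<inter> I = {}")
    case False
    then obtain c where "c \<in> A" "c \<in> I" by blast
    thus thesis using st[of c c] by (intro that[of "{}"]) auto
  next
    case True
    define J where "J = (\<lambda>(a, d). {a, d}) ` (A \<times> I)"
    have JE: "J \<subseteq> ?E"
    proof
      fix e assume "e \<in> J"
      then obtain c d where cd: "e = {c, d}" "c \<in> A" "d \<in> I" by (auto simp: J_def)
      moreover have "c \<noteq> d" using cd True by blast
      ultimately show "e \<in> ?E" using A(1) by (auto simp: complete_edges_def I_def)
    qed
    have "a * m \<le> real (card A) * real (card I)" using A cI b by (intro mult_mono) auto
    also have "\<dots> = real (card J)" unfolding J_def by (subst card_cross_edges[OF finA finI True]) simp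
    finally have cJ: "a * m \<le> real (card J)" .
    have finJ: "finite J" using finA finI by (simp add: J_def)
    define Y where "Y = {y \<in> space (Pi\<^sub>M ?E (\<lambda>i. borel)). \<forall>i\<in>J. s \<le> y i}"
    show thesis
    proof (rule that[of Y])
      show "Y \<in> sets (Pi\<^sub>M ?E (\<lambda>i. borel))"
        unfolding Y_def using JE finJ
        by (intro sets.sets_Collect_finite_All borel_measurable_le measurable_const measurable_component_singleton) auto
      have "emeasure (Pi\<^sub>M ?E (\<lambda>i. expo \<delta>)) Y = ennreal (exp (- \<delta> * s * real (card J)))"
        unfolding Y_def using \<delta> s JE V by (intro emeasure_PiM_expo_atLeast finite_complete_edges) auto
      also have "\<dots> \<le> ennreal (exp (- (\<delta> * s * (a * m))))"
        using \<delta> s cJ by (intro ennreal_leI) (auto intro!: mult_left_mono)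
      finally show "emeasure (Pi\<^sub>M ?E (\<lambda>i. expo \<delta>)) Y \<le> ennreal (exp (- (\<delta> * s * (a * m))))" .
      fix y assume y: "y \<in> space (Pi\<^sub>M ?E (\<lambda>i. borel)) - Y" "\<And>f. f \<in> ?E \<Longrightarrow> 0 \<le> y f"
      then obtain i where "i \<in> J" "\<not> s \<le> y i" by (auto simp: Y_def)
      then obtain c d where "c \<in> A" "d \<in> I" "y {c, d} \<le> s" by (auto simp: J_def)
      thus "steiner_weight V ?E (\<lambda>e. min (x e) (y e)) S \<le> t1 + s + (real k - 1) * t2"
        using st y(2) by blast
    qed
  qed
qed

lemma emeasure_UN_le_card:
  assumes "finite I" "\<And>i. i \<in> I \<Longrightarrow> Z i \<in> sets M" "\<And>i. i \<in> I \<Longrightarrow> emeasure M (Z i) \<le> ennreal c" "0 \<le> c"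
  shows "emeasure M (\<Union>i\<in>I. Z i) \<le> ennreal (real (card I) * c)"
proof -
  have "emeasure M (\<Union>i\<in>I. Z i) \<le> (\<Sum>i\<in>I. emeasure M (Z i))"
    using assms by (intro emeasure_subadditive_finite) auto
  also have "\<dots> \<le> (\<Sum>i\<in>I. ennreal c)" using assms by (intro sum_mono) auto
  also have "\<dots> = ennreal (real (card I) * c)"
    using assms by (simp add: ennreal_mult' ennreal_of_nat_eq_real_of_nat)
  finally show ?thesis .
qed

text \<open>The first two summands are growth failures at the two radii, summed over vertices.
  Conditionally on a first layer without such a failure, the third summand is the union bound over
  at most \<open>n ^ k\<close> terminal sets, each failing with the probability of
  \<open>sprinkling_bound\<close>.\<close>

lemma max_steiner_weight_upper_tail:
  fixes V :: "'v set"
  assumes V: "finite V" "2 \<le> k" "k \<le> card V"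
    and \<delta>: "0 < \<delta>" "\<delta> < 1" and \<eta>: "1 < \<eta> * real (card V)" "\<eta> < 1" and s: "0 \<le> s"
    and r1: "1 \<le> r1" "r1 + 2 \<le> card V" and r2: "1 \<le> r2" "r2 + 2 \<le> card V"
    and m: "0 < m" "m \<le> real (card V) - (real k - 1) * (real (card V) - (real r2 + 1))"
  defines "K \<equiv> \<lambda>r::nat. (real (card V) - 1) / (\<eta> * real (card V) - 1) *
       (real r * (real (card V) - 2) / (real (card V) - real r - 1))"
  shows "emeasure (Pi\<^sub>M (complete_edges V) (\<lambda>i. expo 1))
     {x \<in> space (Pi\<^sub>M (complete_edges V) (\<lambda>i. borel)).
        t1 + s + (real k - 1) * t2 < max_steiner_weight V (complete_edges V) x k}
   \<le> ennreal (real (card V) * (exp (- ((1 - \<delta>) * (1 - \<eta>) * real (card V) * t1)) * K r1)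
      + real (card V) * (exp (- ((1 - \<delta>) * (1 - \<eta>) * real (card V) * t2)) * K r2)
      + real (card V) ^ k * exp (- (\<delta> * s * ((real r1 + 1) * m))))"
proof -
  let ?E = "complete_edges V" and ?n = "real (card V)"
  let ?B = "Pi\<^sub>M ?E (\<lambda>i. borel :: real measure)"
  let ?N1 = "Pi\<^sub>M ?E (\<lambda>i. expo (1 - \<delta>))" and ?N2 = "Pi\<^sub>M ?E (\<lambda>i. expo \<delta>)"
  let ?thr = "t1 + s + (real k - 1) * t2"
  define \<beta> where "\<beta> = (\<lambda>t r. exp (- ((1 - \<delta>) * (1 - \<eta>) * ?n * t)) * K r)"
  have finE: "finite ?E" using V finite_complete_edges by blast
  have K0: "0 \<le> K r" if "r + 2 \<le> card V" for r
    unfolding K_def using that \<eta> by (intro mult_nonneg_nonneg divide_nonneg_nonneg) auto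
  have \<beta>0: "0 \<le> \<beta> t r" if "r + 2 \<le> card V" for t r using K0[OF that] by (simp add: \<beta>_def)
  \<comment> \<open>The exceptional sets are indexed by vertices, not by terminal sets; this is why
    the growth terms carry a factor \<open>n\<close> and not \<open>n ^ k\<close>.\<close>
  have ex: "\<exists>Z. \<forall>v\<in>V. Z v \<in> sets ?B \<and> emeasure ?N1 (Z v) \<le> ennreal (\<beta> t r) \<and>
      (\<forall>x\<in>space ?B - Z v. (\<forall>f\<in>?E. 0 \<le> x f) \<longrightarrow> (\<exists>D\<subseteq>V. card D = r + 1 \<and> (\<forall>w\<in>D. reaches V x t v w)))"
    if r: "1 \<le> r" "r + 2 \<le> card V" for t r
  proof (intro bchoice ballI)
    fix v assume v: "v \<in> V"
    have "0 < 1 - \<delta>" using \<delta> by simp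
    from ball_growth_tail[OF V(1) v this \<eta> r, of t] obtain Z where
      "Z \<in> sets ?B" "emeasure ?N1 Z \<le> ennreal (\<beta> t r)"
      "\<And>x. x \<in> space ?B - Z \<Longrightarrow> (\<And>f. f \<in> ?E \<Longrightarrow> 0 \<le> x f) \<Longrightarrow> \<exists>D\<subseteq>V. card D = r + 1 \<and> (\<forall>w\<in>D. reaches V x t v w)"
      unfolding \<beta>_def K_def by metis
    thus "\<exists>Z. Z \<in> sets ?B \<and> emeasure ?N1 Z \<le> ennreal (\<beta> t r) \<and>
      (\<forall>x\<in>space ?B - Z. (\<forall>f\<in>?E. 0 \<le> x f) \<longrightarrow> (\<exists>D\<subseteq>V. card D = r + 1 \<and> (\<forall>w\<in>D. reaches V x t v w)))"
      by (intro exI[of _ Z]) simp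
  qed
  from ex[OF r1, of t1] obtain Z1 where
    Z1: "\<forall>v\<in>V. Z1 v \<in> sets ?B \<and> emeasure ?N1 (Z1 v) \<le> ennreal (\<beta> t1 r1) \<and>
      (\<forall>x\<in>space ?B - Z1 v. (\<forall>f\<in>?E. 0 \<le> x f) \<longrightarrow> (\<exists>D\<subseteq>V. card D = r1 + 1 \<and> (\<forall>w\<in>D. reaches V x t1 v w)))" ..
  from ex[OF r2, of t2] obtain Z2 where
    Z2: "\<forall>v\<in>V. Z2 v \<in> sets ?B \<and> emeasure ?N1 (Z2 v) \<le> ennreal (\<beta> t2 r2) \<and>
      (\<forall>x\<in>space ?B - Z2 v. (\<forall>f\<in>?E. 0 \<le> x f) \<longrightarrow> (\<exists>D\<subseteq>V. card D = r2 + 1 \<and> (\<forall>w\<in>D. reaches V x t2 v w)))" ..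
  have Z1D: "\<exists>D\<subseteq>V. card D = r1 + 1 \<and> (\<forall>w\<in>D. reaches V x t1 v w)"
    if "v \<in> V" "x \<in> space ?B - Z1 v" "\<forall>f\<in>?E. 0 \<le> x f" for v x
    using bspec[OF bspec[OF Z1 that(1), THEN conjunct2, THEN conjunct2] that(2)] that(3) by (rule mp)
  have Z2D: "\<exists>D\<subseteq>V. card D = r2 + 1 \<and> (\<forall>w\<in>D. reaches V x t2 v w)"
    if "v \<in> V" "x \<in> space ?B - Z2 v" "\<forall>f\<in>?E. 0 \<le> x f" for v x
    using bspec[OF bspec[OF Z2 that(1), THEN conjunct2, THEN conjunct2] that(2)] that(3) by (rule mp)
  have Zs: "Z1 v \<in> sets ?B" "emeasure ?N1 (Z1 v) \<le> ennreal (\<beta> t1 r1)"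
    "Z2 v \<in> sets ?B" "emeasure ?N1 (Z2 v) \<le> ennreal (\<beta> t2 r2)" if "v \<in> V" for v
    using bspec[OF Z1 that] bspec[OF Z2 that] by simp_all
  define Z where "Z = (\<Union>v\<in>V. Z1 v) \<union> (\<Union>v\<in>V. Z2 v)"
  have UZ: "(\<Union>v\<in>V. Z1 v) \<in> sets ?B" "(\<Union>v\<in>V. Z2 v) \<in> sets ?B"
    using Zs V by (auto intro!: sets.finite_UN)
  hence ZB: "Z \<in> sets ?B" by (auto simp: Z_def)
  have "emeasure ?N1 Z \<le> emeasure ?N1 (\<Union>v\<in>V. Z1 v) + emeasure ?N1 (\<Union>v\<in>V. Z2 v)"
    unfolding Z_def using UZ by (intro emeasure_subadditive) (simp_all add: sets_PiM_expo)
  also have "\<dots> \<le> ennreal (?n * \<beta> t1 r1) + ennreal (?n * \<beta> t2 r2)"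
    using Zs V r1 r2 by (intro add_mono emeasure_UN_le_card) (auto simp: sets_PiM_expo \<beta>0)
  finally have NZ: "emeasure ?N1 Z \<le> ennreal (?n * \<beta> t1 r1 + ?n * \<beta> t2 r2)"
    using \<beta>0 r1 r2 by (simp add: ennreal_plus)
  define q where "q = exp (- (\<delta> * s * ((real r1 + 1) * m)))"
  define Bad where "Bad = {x \<in> space ?B. ?thr < max_steiner_weight V ?E x k}"
  have Bad: "Bad \<in> sets ?B"
    unfolding Bad_def using max_steiner_weight_measurable[OF V(1)] by measurable
  let ?h = "\<lambda>p. \<lambda>i\<in>?E. min (fst p i) (snd p i)"
  have h: "?h \<in> measurable (?N1 \<Otimes>\<^sub>M ?N2) ?B" by measurable
  \<comment> \<open>With the first layer \<open>x\<close> fixed, the balls are fixed sets, and the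
    exceptional sets \<open>Y\<close> concern the second layer alone.\<close>
  have inner: "(\<integral>\<^sup>+ y. indicator Bad (?h (x, y)) \<partial>?N2) \<le> ennreal (?n ^ k * q)"
    if x: "x \<in> space ?B" "x \<notin> Z" "\<forall>f\<in>?E. 0 \<le> x f" for x
  proof -
    have x0: "\<And>f. f \<in> ?E \<Longrightarrow> 0 \<le> x f" using x by blast
    have "\<forall>S\<in>{S. S \<subseteq> V \<and> card S = k}. \<exists>Y. Y \<in> sets ?B \<and> emeasure ?N2 Y \<le> ennreal q \<and>
      (\<forall>y\<in>space ?B - Y. (\<forall>f\<in>?E. 0 \<le> y f) \<longrightarrow> steiner_weight V ?E (\<lambda>e. min (x e) (y e)) S \<le> ?thr)"
    proof
      fix S assume "S \<in> {S. S \<subseteq> V \<and> card S = k}"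
      hence S: "S \<subseteq> V" "card S = k" by auto
      have A: "\<exists>A\<subseteq>V. real r1 + 1 \<le> real (card A) \<and> (\<forall>w\<in>A. reaches V x t1 v w)" if v: "v \<in> V" for v
      proof -
        have "x \<in> space ?B - Z1 v" using x v by (auto simp: Z_def)
        from Z1D[OF v this x(3)] obtain D where "D \<subseteq> V" "card D = r1 + 1" "\<forall>w\<in>D. reaches V x t1 v w"
          by (elim exE conjE)
        thus ?thesis by (intro exI[of _ D] conjI) simp_all
      qed
      have D: "\<exists>A\<subseteq>V. real r2 + 1 \<le> real (card A) \<and> (\<forall>w\<in>A. reaches V x t2 v w)" if v: "v \<in> V" for v
      proof -
        have "x \<in> space ?B - Z2 v" using x v by (auto simp: Z_def)
        from Z2D[OF v this x(3)] obtain D where "D \<subseteq> V" "card D = r2 + 1" "\<forall>w\<in>D. reaches V x t2 v w"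
          by (elim exE conjE)
        thus ?thesis by (intro exI[of _ D] conjI) simp_all
      qed
      show "\<exists>Y. Y \<in> sets ?B \<and> emeasure ?N2 Y \<le> ennreal q \<and>
         (\<forall>y\<in>space ?B - Y. (\<forall>f\<in>?E. 0 \<le> y f) \<longrightarrow> steiner_weight V ?E (\<lambda>e. min (x e) (y e)) S \<le> ?thr)"
      proof (rule sprinkling_bound[where x = x and ?t1.0 = t1 and ?t2.0 = t2, OF V(1) S V(2) \<delta>(1) s _ m x0 A D])
        fix Y assume Y: "Y \<in> sets ?B" "emeasure ?N2 Y \<le> ennreal (exp (- (\<delta> * s * ((real r1 + 1) * m))))"
          "\<And>y. y \<in> space ?B - Y \<Longrightarrow> (\<And>f. f \<in> ?E \<Longrightarrow> 0 \<le> y f) \<Longrightarrow>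
           steiner_weight V ?E (\<lambda>e. min (x e) (y e)) S \<le> ?thr"
        have "\<forall>y\<in>space ?B - Y. (\<forall>f\<in>?E. 0 \<le> y f) \<longrightarrow> steiner_weight V ?E (\<lambda>e. min (x e) (y e)) S \<le> ?thr"
        proof (intro ballI impI)
          fix y assume "y \<in> space ?B - Y" "\<forall>f\<in>?E. 0 \<le> y f"
          from Y(3)[OF this(1) bspec[OF this(2)]]
          show "steiner_weight V ?E (\<lambda>e. min (x e) (y e)) S \<le> ?thr" .
        qed
        thus "\<exists>Y. Y \<in> sets ?B \<and> emeasure ?N2 Y \<le> ennreal q \<and>
         (\<forall>y\<in>space ?B - Y. (\<forall>f\<in>?E. 0 \<le> y f) \<longrightarrow> steiner_weight V ?E (\<lambda>e. min (x e) (y e)) S \<le> ?thr)"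
          using Y(1,2) unfolding q_def by (intro exI[of _ Y] conjI)
      qed simp_all
    qed
    from bchoice[OF this] obtain Y where Y: "\<forall>S\<in>{S. S \<subseteq> V \<and> card S = k}. Y S \<in> sets ?B \<and> emeasure ?N2 (Y S) \<le> ennreal q \<and>
      (\<forall>y\<in>space ?B - Y S. (\<forall>f\<in>?E. 0 \<le> y f) \<longrightarrow> steiner_weight V ?E (\<lambda>e. min (x e) (y e)) S \<le> ?thr)" ..
    have Y1: "Y S \<in> sets ?B" "emeasure ?N2 (Y S) \<le> ennreal q" if "S \<in> {S. S \<subseteq> V \<and> card S = k}" for S
      using bspec[OF Y that] by simp_all
    have Y2: "steiner_weight V ?E (\<lambda>e. min (x e) (y e)) S \<le> ?thr"
      if "S \<in> {S. S \<subseteq> V \<and> card S = k}" "y \<in> space ?B - Y S" "\<forall>f\<in>?E. 0 \<le> y f" for S y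
      using bspec[OF bspec[OF Y that(1), THEN conjunct2, THEN conjunct2] that(2)] that(3) by (rule mp)
    define YY where "YY = (\<Union>S\<in>{S. S \<subseteq> V \<and> card S = k}. Y S)"
    have YYs: "YY \<in> sets ?N2"
      unfolding YY_def sets_PiM_expo by (intro sets.finite_UN finite_nsubsets V(1) Y1(1))
    have YYm: "emeasure ?N2 YY \<le> ennreal (real (card {S. S \<subseteq> V \<and> card S = k}) * q)"
      unfolding YY_def using Y1
      by (intro emeasure_UN_le_card finite_nsubsets V(1)) (simp_all add: sets_PiM_expo q_def)
    have "card {S. S \<subseteq> V \<and> card S = k} = card V choose k" using V by (simp add: n_subsets)
    hence "real (card {S. S \<subseteq> V \<and> card S = k}) \<le> ?n ^ k"
      using binomial_le_pow[OF V(3)] by (metis of_nat_le_iff of_nat_power)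
    hence YYq: "emeasure ?N2 YY \<le> ennreal (?n ^ k * q)"
      using YYm by (elim order_trans) (auto intro!: ennreal_leI mult_right_mono simp: q_def)
    have "AE y in ?N2. indicator Bad (?h (x, y)) \<le> (indicator YY y :: ennreal)"
      using AE_PiM_expo_nonneg[OF finE \<delta>(1)] AE_space
    proof eventually_elim
      case (elim y)
      have "y \<in> YY" if "?h (x, y) \<in> Bad"
      proof (rule ccontr)
        assume nY: "y \<notin> YY"
        have "steiner_weight V ?E (?h (x, y)) S \<le> ?thr" if S: "S \<subseteq> V \<and> card S = k" for S
        proof -
          have "steiner_weight V ?E (?h (x, y)) S = steiner_weight V ?E (\<lambda>e. min (x e) (y e)) S"
            by (intro steiner_weight_cong) simp
          moreover have "y \<in> space ?B - Y S" using S nY elim(2) by (auto simp: YY_def)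
          ultimately show ?thesis using Y2[of S y] S elim(1) by simp
        qed
        hence "max_steiner_weight V ?E (?h (x, y)) k \<le> ?thr"
          by (subst max_steiner_weight_le_iff[OF V(1,3)]) blast
        thus False using that by (simp add: Bad_def)
      qed
      thus ?case by (auto simp: indicator_def)
    qed
    hence "(\<integral>\<^sup>+ y. indicator Bad (?h (x, y)) \<partial>?N2) \<le> (\<integral>\<^sup>+ y. indicator YY y \<partial>?N2)"
      by (rule nn_integral_mono_AE)
    also have "\<dots> = emeasure ?N2 YY" using YYs by simp
    finally show ?thesis using YYq by (rule order_trans)
  qed
  have pN1: "prob_space ?N1" and pN2: "prob_space ?N2"
    using \<delta> by (auto intro!: prob_space_PiM prob_space_exponential_density)
  \<comment> \<open>The rates \<open>1 - \<delta>\<close> and \<open>\<delta>\<close> add up to 1,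
    so the minimum of the layers has the original law.\<close>
  have "emeasure (Pi\<^sub>M ?E (\<lambda>i. expo 1)) Bad = emeasure (distr (?N1 \<Otimes>\<^sub>M ?N2) ?B ?h) Bad"
    using distr_min_PiM_expo[OF finE, of "1 - \<delta>" \<delta>] \<delta> by simp
  also have "\<dots> = (\<integral>\<^sup>+ p. indicator Bad (?h p) \<partial>(?N1 \<Otimes>\<^sub>M ?N2))"
    by (rule emeasure_distr_eq_nn_integral[OF h Bad])
  also have "\<dots> = (\<integral>\<^sup>+ x. \<integral>\<^sup>+ y. indicator Bad (?h (x, y)) \<partial>?N2 \<partial>?N1)"
    using h Bad by (intro sigma_finite_measure.nn_integral_fst[symmetric] prob_space_imp_sigma_finite pN2) simp
  also have "\<dots> \<le> (\<integral>\<^sup>+ x. indicator Z x + ennreal (?n ^ k * q) \<partial>?N1)"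
  proof (rule nn_integral_mono_AE)
    have "AE x in ?N1. \<forall>f\<in>?E. 0 \<le> x f" using finE \<delta> by (intro AE_PiM_expo_nonneg) auto
    thus "AE x in ?N1. (\<integral>\<^sup>+ y. indicator Bad (?h (x, y)) \<partial>?N2) \<le> indicator Z x + ennreal (?n ^ k * q)"
      using AE_space
    proof eventually_elim
      case (elim x)
      show ?case
      proof (cases "x \<in> Z")
        case True
        have "(\<integral>\<^sup>+ y. indicator Bad (?h (x, y)) \<partial>?N2) \<le> (\<integral>\<^sup>+ y. 1 \<partial>?N2)"
          by (intro nn_integral_mono) (auto simp: indicator_def)
        also have "\<dots> = 1" using prob_space.emeasure_space_1[OF pN2] by simp
        also have "\<dots> \<le> indicator Z x + ennreal (?n ^ k * q)" using True by simp
        finally show ?thesis .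
      next
        case False
        thus ?thesis using inner[of x] elim by simp
      qed
    qed
  qed
  also have "\<dots> = emeasure ?N1 Z + ennreal (?n ^ k * q)"
    using ZB prob_space.emeasure_space_1[OF pN1] by (subst nn_integral_add) (simp_all add: sets_PiM_expo)
  also have "\<dots> \<le> ennreal (?n * \<beta> t1 r1 + ?n * \<beta> t2 r2) + ennreal (?n ^ k * q)"
    using NZ by (rule add_right_mono)
  also have "\<dots> = ennreal (?n * \<beta> t1 r1 + ?n * \<beta> t2 r2 + ?n ^ k * q)"
    using \<beta>0 r1 r2 by (intro ennreal_plus[symmetric]) (auto simp: q_def)
  finally show ?thesis unfolding Bad_def \<beta>_def q_def .
qed

section \<open>The lower tail\<close>

text \<open>
  Trees spanning a set of terminals are encoded by growing them from a start vertex: append an edge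
  to a new vertex at the current vertex \<open>c\<close>, or declare \<open>c\<close> a terminal and jump to any vertex
  built so far. The \<open>k\<close> jumps contribute only a polynomial factor in \<open>m\<close>, so there are about \<open>n\<^bsup>m+1\<^esup>\<close> encodings
  with \<open>m\<close> edges.
\<close>
inductive grown :: "'v set \<Rightarrow> nat \<Rightarrow> nat \<Rightarrow> 'v set \<Rightarrow> 'v set \<Rightarrow> 'v set set \<Rightarrow> 'v \<Rightarrow> bool" for V where
  start: "v \<in> V \<Longrightarrow> grown V 0 0 {} {v} {} v"
| extend: "grown V k m S U F c \<Longrightarrow> w \<in> V - U \<Longrightarrow> grown V k (Suc m) S (insert w U) (insert {c, w} F) w"
| mark: "grown V k m S U F c \<Longrightarrow> u \<in> U \<Longrightarrow> grown V (Suc k) m (insert c S) U F u"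

text \<open>\<open>card F = m\<close> feeds the moment bound and \<open>card U = Suc m\<close>
  bounds the choices of a jump. Every built vertex lies on an edge except for the lone start vertex,
  hence the proviso \<open>m \<noteq> 0\<close>.\<close>

lemma grown_invariant:
  assumes "grown V k m S U F c"
  shows "c \<in> U \<and> U \<subseteq> V \<and> S \<subseteq> U \<and> finite U \<and> card U = Suc m \<and> F \<subseteq> Pow U \<and> F \<subseteq> complete_edges V \<and>
    finite F \<and> card F = m \<and> (m \<noteq> 0 \<longrightarrow> U \<subseteq> \<Union>F)"
  using assms
proof induction
  case (extend k m S U F c w)
  have "{c, w} \<notin> F" using extend by auto
  moreover have "insert w U \<subseteq> \<Union>(insert {c, w} F)"
  proof (cases "m = 0")
    case True
    then obtain z where "U = {z}" using extend by (auto simp: card_1_singleton_iff)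
    thus ?thesis using extend by auto
  next
    case False
    thus ?thesis using extend by auto
  qed
  moreover have "{c, w} \<in> complete_edges V"
    using extend by (auto simp: complete_edges_def card_insert_if)
  ultimately show ?case using extend by auto
qed auto

text \<open>The current vertex can be moved to any built \<open>z\<close> without an extra mark:
  extensions made since the last mark are undone until \<open>z\<close> is current, or, if that mark
  is reached, its free jump is redirected to \<open>z\<close>. Marks are never undone, so
  \<open>k\<close> and \<open>S\<close> stay the same.\<close>

lemma grown_switch:
  assumes "grown V k m S U F c" "z \<in> U"
  shows "\<exists>m' U' F'. grown V k m' S U' F' z \<and> U' \<subseteq> U \<and> F' \<subseteq> F"
  using assms
proof (induction arbitrary: z)
  case (start v)
  thus ?case using grown.start[of v V] by (intro exI[of _ 0] exI[of _ "{v}"] exI[of _ "{}"]) auto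
next
  case (extend k m S U F c w)
  show ?case
  proof (cases "z = w")
    case True
    thus ?thesis using grown.extend[OF extend.hyps] by (intro exI conjI) auto
  next
    case False
    hence "z \<in> U" using extend.prems by simp
    from extend.IH[OF this] obtain m' U' F' where "grown V k m' S U' F' z" "U' \<subseteq> U" "F' \<subseteq> F"
      by (elim exE conjE)
    thus ?thesis by (intro exI[of _ m'] exI[of _ U'] exI[of _ F']) auto
  qed
next
  case (mark k m S U F c u)
  thus ?case using grown.mark[OF mark.hyps(1) mark.prems] by (intro exI conjI) auto
qed

text \<open>Induction over the terminals: walk in \<open>F\<close> from the current vertex to the
  next terminal, extending at new vertices and using \<open>grown_switch\<close> at vertices already
  built, then mark it. The walk may repeat vertices, and no spanning tree has to be extracted
  beforehand.\<close>

lemma grown_in_connected: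
  assumes "connected_graph U F" "is_subgraph U F V E" "finite S" "S \<subseteq> U"
  shows "\<exists>m U' F' c. grown V (card S) m S U' F' c \<and> U' \<subseteq> U \<and> F' \<subseteq> F"
  using assms(3,4)
proof (induction S)
  case empty
  obtain u where "u \<in> U" using assms(1) by (auto simp: connected_graph_def)
  moreover have "u \<in> V" using calculation assms(2) by (auto simp: is_subgraph_def)
  ultimately show ?case using grown.start[of u V]
    by (intro exI[of _ 0] exI[of _ "{u}"] exI[of _ "{}"] exI[of _ u]) simp
next
  case (insert v S)
  from insert obtain m0 U0 F0 c where s: "grown V (card S) m0 S U0 F0 c" "U0 \<subseteq> U" "F0 \<subseteq> F"
    by (elim meta_impE) auto
  have "c \<in> U" using grown_invariant[OF s(1)] s(2) by auto
  hence "(c, v) \<in> (edge_rel F)\<^sup>*"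
    using assms(1) insert.prems by (auto simp: connected_graph_def)
  hence "\<exists>m U' F'. grown V (card S) m S U' F' v \<and> U' \<subseteq> U \<and> F' \<subseteq> F"
  proof (induction rule: rtrancl_induct)
    case base
    show ?case using s by (intro exI conjI)
  next
    case (step y z)
    from step.IH obtain m U' F' where g: "grown V (card S) m S U' F' y" "U' \<subseteq> U" "F' \<subseteq> F"
      by (elim exE conjE)
    have yz: "{y, z} \<in> F" using step by simp
    hence "z \<in> U" "U \<subseteq> V" using assms(2) by (auto simp: is_subgraph_def)
    show ?case
    proof (cases "z \<in> U'")
      case True
      from grown_switch[OF g(1) this] obtain m' U'' F'' where
        "grown V (card S) m' S U'' F'' z" "U'' \<subseteq> U'" "F'' \<subseteq> F'" by (elim exE conjE)
      thus ?thesis using g by (intro exI[of _ m'] exI[of _ U''] exI[of _ F'']) auto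
    next
      case False
      hence "grown V (card S) (Suc m) S (insert z U') (insert {y, z} F') z"
        using \<open>z \<in> U\<close> \<open>U \<subseteq> V\<close> by (intro grown.extend g) auto
      thus ?thesis using g \<open>z \<in> U\<close> yz
        by (intro exI[of _ "Suc m"] exI[of _ "insert z U'"] exI[of _ "insert {y, z} F'"]) auto
    qed
  qed
  then obtain m U' F' where g: "grown V (card S) m S U' F' v" "U' \<subseteq> U" "F' \<subseteq> F" by (elim exE conjE)
  \<comment> \<open>The jump after marking \<open>v\<close> goes to \<open>v\<close> itself, which
    is allowed since \<open>v\<close> is built.\<close>
  have "v \<in> U'" using grown_invariant[OF g(1)] by simp
  from grown.mark[OF g(1) this] show ?case using g insert.hyps
    by (intro exI[of _ m] exI[of _ U'] exI[of _ F'] exI[of _ v]) simp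
qed

definition grown_states :: "'v set \<Rightarrow> nat \<Rightarrow> nat \<Rightarrow> ('v set \<times> 'v set \<times> 'v set set \<times> 'v) set" where
  "grown_states V k m = {(S, U, F, c). grown V k m S U F c}"

lemma finite_grown_states: "finite V \<Longrightarrow> finite (grown_states V k m)"
  by (rule finite_subset[of _ "Pow V \<times> Pow V \<times> Pow (complete_edges V) \<times> V"])
    (auto simp: grown_states_def finite_complete_edges dest!: grown_invariant)

lemma card_grown_states_mark:
  assumes "finite V"
  shows "card ((\<lambda>((S, U, F, c), u). (insert c S, U, F, u)) ` (SIGMA s:grown_states V k m. fst (snd s)))
    \<le> Suc m * card (grown_states V k m)"
proof -
  let ?X = "SIGMA s:grown_states V k m. fst (snd s)"
  have c: "finite (fst (snd s)) \<and> card (fst (snd s)) = Suc m" if "s \<in> grown_states V k m" for s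
    using that by (auto simp: grown_states_def dest!: grown_invariant)
  have "finite ?X" using finite_grown_states[OF assms] c by (intro finite_SigmaI) auto
  hence "card ((\<lambda>((S, U, F, c), u). (insert c S, U, F, u)) ` ?X) \<le> card ?X" by (rule card_image_le)
  also have "card ?X = (\<Sum>s\<in>grown_states V k m. card (fst (snd s)))"
    using finite_grown_states[OF assms] c by (intro card_SigmaI) auto
  also have "\<dots> = Suc m * card (grown_states V k m)" using c by simp
  finally show ?thesis .
qed

lemma card_grown_states_extend:
  assumes "finite V"
  shows "card ((\<lambda>((S, U, F, c), w). (S, insert w U, insert {c, w} F, w)) ` (grown_states V k m \<times> V))
    \<le> card V * card (grown_states V k m)"
proof -
  have "card ((\<lambda>((S, U, F, c), w). (S, insert w U, insert {c, w} F, w)) ` (grown_states V k m \<times> V))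
    \<le> card (grown_states V k m \<times> V)"
    using finite_grown_states[OF assms] assms by (intro card_image_le) auto
  thus ?thesis by (simp add: card_cartesian_product mult.commute)
qed

text \<open>With \<open>N k m\<close> the number of states, the last step of an encoding gives
  \<open>N (k+1) (m+1) \<le> (m+2) * N k (m+1) + n * N (k+1) m\<close>, and the bound satisfies this
  recursion. Heuristically each mark brings one factor \<open>m + 1\<close> for the target of its
  jump and one for its position among the extensions.\<close>

lemma card_grown_states:
  assumes "finite V"
  shows "card (grown_states V k m) \<le> card V ^ Suc m * Suc m ^ (2 * k)"
proof (induction k arbitrary: m)
  case 0
  show ?case
  proof (induction m)
    case 0
    have "grown_states V 0 0 \<subseteq> (\<lambda>v. ({}, {v}, {}, v)) ` V"
      by (auto simp: grown_states_def elim: grown.cases)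
    hence "card (grown_states V 0 0) \<le> card V" using assms by (rule surj_card_le[rotated])
    thus ?case by simp
  next
    case (Suc m)
    have "grown_states V 0 (Suc m) \<subseteq> (\<lambda>((S, U, F, c), w). (S, insert w U, insert {c, w} F, w)) ` (grown_states V 0 m \<times> V)"
    proof
      fix s assume "s \<in> grown_states V 0 (Suc m)"
      then obtain S U F c where s: "s = (S, U, F, c)" "grown V 0 (Suc m) S U F c" by (auto simp: grown_states_def)
      from s(2) show "s \<in> (\<lambda>((S, U, F, c), w). (S, insert w U, insert {c, w} F, w)) ` (grown_states V 0 m \<times> V)"
      proof cases
        case (extend U' F' c')
        thus ?thesis unfolding s(1)
          by (intro image_eqI[of _ _ "((S, U', F', c'), c)"]) (auto simp: grown_states_def)
      qed
    qed
    hence "card (grown_states V 0 (Suc m)) \<le> card V * card (grown_states V 0 m)"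
      using assms card_grown_states_extend[OF assms, of 0 m]
      by (elim order_trans[OF card_mono, rotated]) (auto simp: finite_grown_states)
    also have "\<dots> \<le> card V * (card V ^ Suc m * Suc m ^ (2 * 0))" using Suc by (intro mult_left_mono) auto
    finally show ?case by simp
  qed
next
  case (Suc k)
  note IHk = Suc.IH
  show ?case
  proof (induction m)
    case 0
    have sub: "grown_states V (Suc k) 0 \<subseteq> (\<lambda>((S, U, F, c), u). (insert c S, U, F, u)) ` (SIGMA s:grown_states V k 0. fst (snd s))"
    proof
      fix s assume "s \<in> grown_states V (Suc k) 0"
      then obtain S U F c where s: "s = (S, U, F, c)" "grown V (Suc k) 0 S U F c" by (auto simp: grown_states_def)
      from s(2) show "s \<in> (\<lambda>((S, U, F, c), u). (insert c S, U, F, u)) ` (SIGMA s:grown_states V k 0. fst (snd s))"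
      proof cases
        case (mark S' c')
        thus ?thesis unfolding s(1)
          by (intro image_eqI[of _ _ "((S', U, F, c'), c)"]) (auto simp: grown_states_def)
      qed
    qed
    have "card (grown_states V (Suc k) 0) \<le> Suc 0 * card (grown_states V k 0)"
    proof (rule order_trans[OF card_mono[OF _ sub] card_grown_states_mark[OF assms]])
      have "finite (fst (snd s))" if "s \<in> grown_states V k 0" for s
        using that by (auto simp: grown_states_def dest!: grown_invariant)
      thus "finite ((\<lambda>((S, U, F, c), u). (insert c S, U, F, u)) ` (SIGMA s:grown_states V k 0. fst (snd s)))"
        by (intro finite_imageI finite_SigmaI finite_grown_states assms) auto
    qed
    thus ?case using IHk[of 0] by simp
  next
    case (Suc m)
    let ?X = "(\<lambda>((S, U, F, c), u). (insert c S, U, F, u)) ` (SIGMA s:grown_states V k (Suc m). fst (snd s))"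
    let ?Y = "(\<lambda>((S, U, F, c), w). (S, insert w U, insert {c, w} F, w)) ` (grown_states V (Suc k) m \<times> V)"
    have sub: "grown_states V (Suc k) (Suc m) \<subseteq> ?X \<union> ?Y"
    proof
      fix s assume "s \<in> grown_states V (Suc k) (Suc m)"
      then obtain S U F c where s: "s = (S, U, F, c)" "grown V (Suc k) (Suc m) S U F c" by (auto simp: grown_states_def)
      from s(2) show "s \<in> ?X \<union> ?Y"
      proof cases
        case (mark S' c')
        hence "s \<in> ?X" unfolding s(1)
          by (intro image_eqI[of _ _ "((S', U, F, c'), c)"]) (auto simp: grown_states_def)
        thus ?thesis by simp
      next
        case (extend U' F' c')
        hence "s \<in> ?Y" unfolding s(1)
          by (intro image_eqI[of _ _ "((S, U', F', c'), c)"]) (auto simp: grown_states_def)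
        thus ?thesis by simp
      qed
    qed
    have fU: "finite (fst (snd s))" if "s \<in> grown_states V k (Suc m)" for s
      using that by (auto simp: grown_states_def dest!: grown_invariant)
    have "finite (?X \<union> ?Y)"
      using finite_grown_states[OF assms] assms fU by (intro finite_UnI finite_imageI finite_SigmaI finite_cartesian_product) auto
    hence "card (grown_states V (Suc k) (Suc m)) \<le> card (?X \<union> ?Y)" using sub by (rule card_mono)
    also have "\<dots> \<le> card ?X + card ?Y" by (rule card_Un_le)
    also have "\<dots> \<le> Suc (Suc m) * card (grown_states V k (Suc m)) + card V * card (grown_states V (Suc k) m)"
      by (intro add_mono card_grown_states_mark card_grown_states_extend assms)
    also have "\<dots> \<le> Suc (Suc m) * (card V ^ Suc (Suc m) * Suc (Suc m) ^ (2 * k))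
        + card V * (card V ^ Suc m * Suc m ^ (2 * Suc k))"
      using IHk[of "Suc m"] Suc by (intro add_mono mult_left_mono) auto
    also have "\<dots> = card V ^ Suc (Suc m) * (Suc (Suc m) ^ (2 * k + 1) + Suc m * Suc m ^ (2 * k + 1))"
      by (simp add: algebra_simps)
    also have "\<dots> \<le> card V ^ Suc (Suc m) * (Suc (Suc m) ^ (2 * k + 1) + Suc m * Suc (Suc m) ^ (2 * k + 1))"
      by (intro mult_left_mono add_mono power_mono order.refl) auto
    also have "\<dots> = card V ^ Suc (Suc m) * Suc (Suc m) ^ (2 * Suc k)"
      by (simp add: algebra_simps)
    finally show ?case .
  qed
qed

section \<open>Exponential moments given heavy edges at the terminals\<close>

lemma nn_integral_PiM_expo_exp_sum:
  fixes \<mu> :: real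
  assumes "finite I" "F \<subseteq> I" "0 \<le> \<mu>"
  shows "(\<integral>\<^sup>+ x. ennreal (exp (- \<mu> * sum x F)) \<partial>Pi\<^sub>M I (\<lambda>i. expo 1)) = ennreal ((1 / (1 + \<mu>)) ^ card F)"
proof -
  interpret product_prob_space "\<lambda>i. expo 1" by (intro product_prob_space_expo) simp
  interpret e: prob_space "expo 1" by (intro prob_space_exponential_density) simp
  have finF: "finite F" using assms finite_subset by blast
  have "ennreal (exp (- \<mu> * sum x F)) = (\<Prod>i\<in>I. if i \<in> F then ennreal (exp (- \<mu> * x i)) else 1)" for x
  proof -
    have "exp (- \<mu> * sum x F) = (\<Prod>i\<in>F. exp (- \<mu> * x i))"
      using finF by (simp add: exp_sum sum_distrib_left)
    hence "ennreal (exp (- \<mu> * sum x F)) = (\<Prod>i\<in>F. ennreal (exp (- \<mu> * x i)))"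
      by (simp add: prod_ennreal)
    also have "\<dots> = (\<Prod>i\<in>I \<inter> F. ennreal (exp (- \<mu> * x i)))"
      using assms(2) by (intro prod.cong) auto
    finally show ?thesis using assms(1) by (simp only: prod.inter_restrict)
  qed
  hence "(\<integral>\<^sup>+ x. ennreal (exp (- \<mu> * sum x F)) \<partial>Pi\<^sub>M I (\<lambda>i. expo 1))
    = (\<integral>\<^sup>+ x. (\<Prod>i\<in>I. if i \<in> F then ennreal (exp (- \<mu> * x i)) else 1) \<partial>Pi\<^sub>M I (\<lambda>i. expo 1))" by simp
  also have "\<dots> = (\<Prod>i\<in>I. \<integral>\<^sup>+ z. (if i \<in> F then ennreal (exp (- \<mu> * z)) else 1) \<partial>expo 1)"
    by (rule product_nn_integral_prod) (use assms in auto)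
  also have "\<dots> = (\<Prod>i\<in>I. if i \<in> F then ennreal (1 / (1 + \<mu>)) else 1)"
    using assms(3) nn_integral_expo_exp[of 1 \<mu>] prob_space.emeasure_space_1[OF prob_space_exponential_density[of 1]]
    by (intro prod.cong) auto
  also have "\<dots> = (\<Prod>i\<in>I \<inter> F. ennreal (1 / (1 + \<mu>)))"
    using assms(1) by (simp only: prod.inter_restrict)
  also have "I \<inter> F = F" using assms(2) by auto
  finally show ?thesis using assms(3) by (simp add: ennreal_power)
qed

lemma sum_shift_on:
  assumes "finite F"
  shows "sum (shift_on J a x) F = sum x F - a * real (card (F \<inter> J))"
proof -
  have "sum (shift_on J a x) F = (\<Sum>i\<in>F. x i - (if i \<in> J then a else 0))"
    by (intro sum.cong) (auto simp: shift_on_def)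
  also have "\<dots> = sum x F - (\<Sum>i\<in>F \<inter> J. a)"
    by (simp only: sum_subtractf sum.inter_restrict[OF assms])
  finally show ?thesis by simp
qed

text \<open>Chernoff's inequality after conditioning: heaviness of \<open>J\<close> costs
  \<open>exp (- a * card J)\<close>, and by memorylessness every edge of \<open>F\<close> in
  \<open>J\<close> then carries a deterministic \<open>a\<close> on top of a fresh
  exponential.\<close>

lemma emeasure_conditioned_sum_less:
  assumes I: "finite I" "F \<subseteq> I" "J \<subseteq> I" and "0 \<le> a" "0 < \<mu>"
  shows "emeasure (Pi\<^sub>M I (\<lambda>i. expo 1)) {x \<in> space (Pi\<^sub>M I (\<lambda>i. borel)). (\<forall>i\<in>J. a \<le> x i) \<and> sum x F < c}
    \<le> ennreal (exp (- a * real (card J)) * (exp (\<mu> * (c - a * real (card (F \<inter> J)))) * (1 / (1 + \<mu>)) ^ card F))"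
proof -
  let ?P = "Pi\<^sub>M I (\<lambda>i. expo 1)" and ?B = "Pi\<^sub>M I (\<lambda>i. borel :: real measure)"
  define A where "A = {x \<in> space ?B. \<forall>i\<in>J. a \<le> x i}"
  have finF: "finite F" and finJ: "finite J" using I finite_subset by blast+
  have comp: "(\<lambda>x. x i) \<in> borel_measurable ?B" if "i \<in> I" for i using that by simp
  have A: "A \<in> sets ?B" unfolding A_def using I finJ
    by (intro sets.sets_Collect_finite_All borel_measurable_le measurable_const comp) auto
  have sm: "(\<lambda>x. sum x F) \<in> borel_measurable ?B" using I by (intro borel_measurable_sum comp) auto
  have "emeasure ?P {x \<in> space ?B. (\<forall>i\<in>J. a \<le> x i) \<and> sum x F < c} \<le> emeasure ?P {x \<in> A. sum x F \<le> c}"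
  proof (rule emeasure_mono)
    have "{x \<in> A. sum x F \<le> c} = A \<inter> {x \<in> space ?B. sum x F \<le> c}" by (auto simp: A_def)
    thus "{x \<in> A. sum x F \<le> c} \<in> sets ?P" using A sm by (simp add: sets_PiM_expo)
  qed (auto simp: A_def)
  also have "\<dots> \<le> ennreal (exp (\<mu> * c)) * (\<integral>\<^sup>+ x. ennreal (exp (- \<mu> * sum x F)) * indicator A x \<partial>?P)"
    using assms(5) A sm by (intro Chernoff_ineq_nn_integral_le) (simp_all add: sets_PiM_expo cong: measurable_cong_sets)
  also have "(\<integral>\<^sup>+ x. ennreal (exp (- \<mu> * sum x F)) * indicator A x \<partial>?P)
    = (\<integral>\<^sup>+ x. indicator {x. \<forall>i\<in>J. a \<le> x i} x * (ennreal (exp (- \<mu> * (a * real (card (F \<inter> J))))) *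
        ennreal (exp (- \<mu> * sum (shift_on J a x) F))) \<partial>?P)"
  proof (rule nn_integral_cong)
    fix x assume x: "x \<in> space ?P"
    have "exp (- \<mu> * sum x F) = exp (- \<mu> * (a * real (card (F \<inter> J)))) * exp (- \<mu> * sum (shift_on J a x) F)"
      by (simp add: sum_shift_on finF exp_add[symmetric] algebra_simps)
    thus "ennreal (exp (- \<mu> * sum x F)) * indicator A x = indicator {x. \<forall>i\<in>J. a \<le> x i} x *
       (ennreal (exp (- \<mu> * (a * real (card (F \<inter> J))))) * ennreal (exp (- \<mu> * sum (shift_on J a x) F)))"
      using x by (simp add: A_def indicator_def ennreal_mult')
  qed
  also have "\<dots> = ennreal (exp (- 1 * a * real (card J))) * (\<integral>\<^sup>+ x. ennreal (exp (- \<mu> * (a * real (card (F \<inter> J))))) *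
        ennreal (exp (- \<mu> * sum x F)) \<partial>?P)"
    using sm by (intro nn_integral_PiM_expo_shift I assms) simp_all
  also have "(\<integral>\<^sup>+ x. ennreal (exp (- \<mu> * (a * real (card (F \<inter> J))))) * ennreal (exp (- \<mu> * sum x F)) \<partial>?P)
    = ennreal (exp (- \<mu> * (a * real (card (F \<inter> J))))) * ennreal ((1 / (1 + \<mu>)) ^ card F)"
    using sm nn_integral_PiM_expo_exp_sum[OF I(1,2), of \<mu>] assms(5)
    by (subst nn_integral_cmult) (simp_all cong: measurable_cong_sets)
  also have "ennreal (exp (\<mu> * c)) * (ennreal (exp (- 1 * a * real (card J))) *
      (ennreal (exp (- \<mu> * (a * real (card (F \<inter> J))))) * ennreal ((1 / (1 + \<mu>)) ^ card F)))
    = ennreal (exp (\<mu> * c) * (exp (- 1 * a * real (card J)) * (exp (- \<mu> * (a * real (card (F \<inter> J)))) * (1 / (1 + \<mu>)) ^ card F)))"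
    by (simp only: ennreal_mult' exp_ge_zero)
  also have "exp (\<mu> * c) * (exp (- 1 * a * real (card J)) * (exp (- \<mu> * (a * real (card (F \<inter> J)))) * (1 / (1 + \<mu>)) ^ card F))
    = exp (- a * real (card J)) * (exp (\<mu> * (c - a * real (card (F \<inter> J)))) * (1 / (1 + \<mu>)) ^ card F)"
  proof -
    have "exp (\<mu> * (c - a * real (card (F \<inter> J)))) = exp (\<mu> * c) * exp (- \<mu> * (a * real (card (F \<inter> J))))"
      by (simp add: exp_add[symmetric] algebra_simps)
    thus ?thesis by simp
  qed
  finally show ?thesis .
qed

text \<open>A crude bound for one cheap edge that loses at most the factor \<open>c\<close>; it is
  enough for edges joining two terminals, of which there are boundedly many.\<close>

lemma emeasure_conditioned_coord_less:
  assumes I: "finite I" "J \<subseteq> I" "e \<in> I" and "0 \<le> a" "0 \<le> c"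
  shows "emeasure (Pi\<^sub>M I (\<lambda>i. expo 1)) {x \<in> space (Pi\<^sub>M I (\<lambda>i. borel)). (\<forall>i\<in>J. a \<le> x i) \<and> x e < c}
    \<le> ennreal (exp (- a * real (card J)) * c)"
proof -
  let ?P = "Pi\<^sub>M I (\<lambda>i. expo 1)" and ?B = "Pi\<^sub>M I (\<lambda>i. borel :: real measure)"
  interpret P: prob_space ?P by (intro prob_space_PiM prob_space_exponential_density) simp
  have finJ: "finite J" using I finite_subset by blast
  have comp: "(\<lambda>x. x i) \<in> borel_measurable ?B" if "i \<in> I" for i using that by simp
  let ?L = "{x \<in> space ?B. x e < c}"
  have L: "?L \<in> sets ?B" using comp[OF I(3)] by measurable
  have "{x \<in> space ?B. \<forall>i\<in>J. a \<le> x i} \<in> sets ?B" using I finJ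
    by (intro sets.sets_Collect_finite_All borel_measurable_le measurable_const comp) auto
  moreover have "{x \<in> space ?B. (\<forall>i\<in>J. a \<le> x i) \<and> x e < c} = {x \<in> space ?B. \<forall>i\<in>J. a \<le> x i} \<inter> ?L" by auto
  ultimately have "{x \<in> space ?B. (\<forall>i\<in>J. a \<le> x i) \<and> x e < c} \<in> sets ?P"
    using L by (simp add: sets_PiM_expo)
  hence "emeasure ?P {x \<in> space ?B. (\<forall>i\<in>J. a \<le> x i) \<and> x e < c}
    = (\<integral>\<^sup>+ x. indicator {x \<in> space ?B. (\<forall>i\<in>J. a \<le> x i) \<and> x e < c} x \<partial>?P)" by simp
  \<comment> \<open>Shifting only lowers coordinates, so \<open>x e < c\<close> survives whether or
    not \<open>e\<close> is in \<open>J\<close>.\<close>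
  also have "\<dots> \<le> (\<integral>\<^sup>+ x. indicator {x. \<forall>i\<in>J. a \<le> x i} x * indicator ?L (shift_on J a x) \<partial>?P)"
  proof (rule nn_integral_mono)
    fix x assume x: "x \<in> space ?P"
    have "shift_on J a x \<in> space ?B" using x I(2) by (auto simp: space_PiM shift_on_def PiE_iff extensional_def)
    moreover have "shift_on J a x e < c" if "x e < c" using that assms(4) by (simp add: shift_on_def)
    ultimately show "(indicator {x \<in> space ?B. (\<forall>i\<in>J. a \<le> x i) \<and> x e < c} x :: ennreal)
       \<le> indicator {x. \<forall>i\<in>J. a \<le> x i} x * indicator ?L (shift_on J a x)"
      by (auto simp: indicator_def)
  qed
  also have "\<dots> = ennreal (exp (- 1 * a * real (card J))) * (\<integral>\<^sup>+ x. indicator ?L x \<partial>?P)"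
    using L by (intro nn_integral_PiM_expo_shift I assms) simp_all
  also have "(\<integral>\<^sup>+ x. indicator ?L x \<partial>?P) = emeasure ?P ?L"
    using L by (intro nn_integral_indicator) (simp add: sets_PiM_expo)
  also have "\<dots> \<le> ennreal c"
  proof -
    have C: "?L = space ?P - {x \<in> space ?B. \<forall>i\<in>{e}. c \<le> x i}" by auto
    have "{x \<in> space ?B. \<forall>i\<in>{e}. c \<le> x i} \<in> sets ?P" using comp[OF I(3)] by (simp add: sets_PiM_expo)
    hence "emeasure ?P ?L = 1 - ennreal (exp (- 1 * c * real (card {e})))"
      unfolding C using emeasure_PiM_expo_atLeast[OF I(1), of "{e}" 1 c] assms
      by (subst emeasure_compl) (simp_all add: P.emeasure_space_1[unfolded space_PiM_expo])
    also have "\<dots> = ennreal (1 - exp (- c))" by (simp add: ennreal_minus flip: ennreal_1)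
    also have "\<dots> \<le> ennreal c" using exp_ge_add_one_self[of "- c"] by (intro ennreal_leI) simp
    finally show ?thesis .
  qed
  finally have "emeasure ?P {x \<in> space ?B. (\<forall>i\<in>J. a \<le> x i) \<and> x e < c} \<le> ennreal (exp (- 1 * a * real (card J))) * ennreal c"
    by (simp add: mult_left_mono)
  thus ?thesis by (simp add: ennreal_mult')
qed

section \<open>Edges at the terminals\<close>

definition incident_edges :: "'v set \<Rightarrow> 'v set \<Rightarrow> 'v set set" where
  "incident_edges V S = {e \<in> complete_edges V. e \<inter> S \<noteq> {}}"

lemma incident_edges_subset: "incident_edges V S \<subseteq> complete_edges V"
  by (auto simp: incident_edges_def)

lemma card_incident_edges_ge:
  assumes "finite V" "S \<subseteq> V"
  shows "real (card S) * (real (card V) - real (card S)) \<le> real (card (incident_edges V S))"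
proof -
  have "boundary V S \<subseteq> incident_edges V S" by (auto simp: boundary_def incident_edges_def)
  hence "card (boundary V S) \<le> card (incident_edges V S)"
    using finite_subset[OF incident_edges_subset finite_complete_edges[OF assms(1)]] by (intro card_mono)
  hence "real (card S * (card V - card S)) \<le> real (card (incident_edges V S))"
    using assms by (simp only: card_boundary of_nat_le_iff)
  thus ?thesis using card_mono[OF assms] by (simp add: of_nat_diff)
qed

lemma card_incident_edges_singleton:
  assumes "finite V" "v \<in> V"
  shows "real (card (incident_edges V {v})) = real (card V) - 1"
proof -
  have "incident_edges V {v} = boundary V {v}"
    by (auto simp: boundary_def incident_edges_def complete_edges_def subset_singleton_iff)
  moreover have "card V \<ge> 1" using assms by (simp add: Suc_le_eq card_gt_0_iff) blast
  ultimately show ?thesis using assms by (simp add: card_boundary of_nat_diff)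
qed

text \<open>Each vertex has \<open>n - 1\<close> edges and only \<open>{u, v}\<close> is shared.
  This one shared edge is the whole correlation between two vertices and produces the factor
  \<open>exp a\<close> in the second moment.\<close>

lemma card_incident_edges_pair:
  assumes "finite V" "u \<in> V" "v \<in> V" "u \<noteq> v"
  shows "2 * real (card V) - 3 \<le> real (card (incident_edges V {u, v}))"
proof -
  have "insert {u, v} (boundary V {u, v}) \<subseteq> incident_edges V {u, v}"
    using assms by (auto simp: boundary_def incident_edges_def complete_edges_def)
  hence "card (insert {u, v} (boundary V {u, v})) \<le> card (incident_edges V {u, v})"
    using finite_subset[OF incident_edges_subset finite_complete_edges[OF assms(1)]] by (intro card_mono)
  moreover have "card (insert {u, v} (boundary V {u, v})) = Suc (card (boundary V {u, v}))"
    by (intro card_insert_disjoint finite_subset[OF boundary_subset finite_complete_edges[OF assms(1)]])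
      (auto simp: boundary_def)
  moreover have "card (boundary V {u, v}) = 2 * (card V - 2)"
    using assms by (subst card_boundary) (auto simp: card_insert_if)
  moreover have "card {u, v} \<le> card V" using assms by (intro card_mono) auto
  ultimately show ?thesis using assms(4) by (simp add: card_insert_if)
qed

lemma connected_complete_graph:
  assumes "V \<noteq> {}"
  shows "connected_graph V (complete_edges V)"
  unfolding connected_graph_def
proof (intro conjI ballI)
  fix u v assume uv: "u \<in> V" "v \<in> V"
  show "(u, v) \<in> (edge_rel (complete_edges V))\<^sup>*"
  proof (cases "u = v")
    case False
    hence "(u, v) \<in> edge_rel (complete_edges V)"
      using uv by (auto simp: complete_edges_def card_insert_if)
    thus ?thesis by (rule r_into_rtrancl)
  qed simp
qed (rule assms)

lemma steiner_weight_attained: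
  assumes "finite V" "V \<noteq> {}" "S \<subseteq> V"
  obtains U F where "is_subgraph U F V (complete_edges V)" "connected_graph U F" "S \<subseteq> U"
    "steiner_weight V (complete_edges V) w S = sum w F"
proof -
  let ?E = "complete_edges V"
  let ?W = "{\<Sum>e\<in>F. w e | U F. is_subgraph U F V ?E \<and> connected_graph U F \<and> S \<subseteq> U}"
  have "finite ?W"
    by (rule finite_subset[of _ "sum w ` Pow ?E"])
      (use finite_complete_edges[OF assms(1)] in \<open>auto simp: is_subgraph_def\<close>)
  moreover have "is_subgraph V ?E V ?E" by (auto simp: is_subgraph_def complete_edges_def)
  hence "?W \<noteq> {}" using connected_complete_graph[OF assms(2)] assms(3) by blast
  ultimately have "Min ?W \<in> ?W" by (rule Min_in)
  thus thesis using that unfolding steiner_weight_def by blast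
qed

text \<open>Choose an edge of \<open>F\<close> at each terminal. Two terminals with the same choice
  would make that edge lie inside \<open>S\<close>, so the choice is injective.\<close>

lemma grown_terminal_edges:
  assumes g: "grown V k m S U F c" and S: "2 \<le> card S" and no: "\<And>e. e \<in> F \<Longrightarrow> \<not> e \<subseteq> S"
  shows "card S \<le> card (F \<inter> incident_edges V S)"
proof -
  note inv = grown_invariant[OF g]
  have "m \<noteq> 0"
  proof
    assume "m = 0"
    hence "card U = 1" using inv by simp
    moreover have "card S \<le> card U" using inv by (intro card_mono) auto
    ultimately show False using S by simp
  qed
  hence "\<forall>v\<in>S. \<exists>e. e \<in> F \<and> v \<in> e" using inv by blast
  from bchoice[OF this] obtain f where f: "\<forall>v\<in>S. f v \<in> F \<and> v \<in> f v" ..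
  have "inj_on f S"
  proof (rule inj_onI, rule ccontr)
    fix u v assume uv: "u \<in> S" "v \<in> S" "f u = f v" "u \<noteq> v"
    have "card (f u) = 2" using f uv inv by (auto simp: complete_edges_def)
    moreover have "{u, v} \<subseteq> f u" using f uv by auto
    ultimately have "f u = {u, v}" using uv(4)
      by (metis card_2_iff' card.infinite card_subset_eq card_2_iff zero_neq_numeral)
    thus False using no[of "f u"] f uv by auto
  qed
  moreover have "f ` S \<subseteq> F \<inter> incident_edges V S"
    using f inv by (auto simp: incident_edges_def)
  ultimately show ?thesis using inv by (intro card_inj_on_le[of f]) auto
qed

section \<open>First moment over tree encodings\<close>

definition states_with_terminals where
  "states_with_terminals V k m S = {s \<in> grown_states V k m. fst s = S}"

text \<open>A state determines its terminal set, so the families for different \<open>S\<close> are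
  disjoint. Hence summing over all terminal sets costs no factor beyond the total number of
  states.\<close>

lemma sum_card_states_with_terminals:
  assumes "finite V" "finite \<S>"
  shows "(\<Sum>S\<in>\<S>. card (states_with_terminals V k m S)) \<le> card V ^ Suc m * Suc m ^ (2 * k)"
proof -
  have fin: "finite (states_with_terminals V k m S)" for S
    using finite_grown_states[OF assms(1)] by (simp add: states_with_terminals_def)
  have "(\<Sum>S\<in>\<S>. card (states_with_terminals V k m S)) = card (\<Union>S\<in>\<S>. states_with_terminals V k m S)"
    using assms fin by (intro card_UN_disjoint[symmetric]) (auto simp: states_with_terminals_def)
  also have "\<dots> \<le> card (grown_states V k m)"
    using finite_grown_states[OF assms(1)] by (intro card_mono) (auto simp: states_with_terminals_def)
  also have "\<dots> \<le> card V ^ Suc m * Suc m ^ (2 * k)" by (rule card_grown_states[OF assms(1)])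
  finally show ?thesis .
qed

definition isolated_cheap where
  "isolated_cheap V a c S = {x \<in> space (Pi\<^sub>M (complete_edges V) (\<lambda>i. borel)).
     (\<forall>e\<in>incident_edges V S. a \<le> x e) \<and> steiner_weight V (complete_edges V) x S < c}"

lemma isolated_cheap_measurable:
  assumes "finite V"
  shows "isolated_cheap V a c S \<in> sets (Pi\<^sub>M (complete_edges V) (\<lambda>i. borel))"
proof -
  let ?B = "Pi\<^sub>M (complete_edges V) (\<lambda>i. borel :: real measure)"
  have "{x \<in> space ?B. \<forall>e\<in>incident_edges V S. a \<le> x e} \<in> sets ?B"
    using incident_edges_subset[of V S] finite_subset[OF incident_edges_subset finite_complete_edges[OF assms]]
    by (intro sets.sets_Collect_finite_All borel_measurable_le measurable_const measurable_component_singleton) auto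
  moreover have "{x \<in> space ?B. steiner_weight V (complete_edges V) x S < c} \<in> sets ?B"
    using steiner_weight_measurable[OF assms] by measurable
  moreover have "isolated_cheap V a c S = {x \<in> space ?B. \<forall>e\<in>incident_edges V S. a \<le> x e} \<inter>
      {x \<in> space ?B. steiner_weight V (complete_edges V) x S < c}"
    by (auto simp: isolated_cheap_def)
  ultimately show ?thesis by simp
qed

text \<open>
  If all edges at the \<open>k\<close> terminals weigh at least \<open>a\<close> and no edge joins two terminals, a spanning
  tree has \<open>k\<close> such edges, which costs a factor \<open>exp (- \<mu> * a * k)\<close> in the exponential moment;
  edges between terminals are handled by the first summand.
\<close>
lemma emeasure_isolated_cheap:
  assumes V: "finite V" and S: "S \<subseteq> V" "card S = k" and k: "2 \<le> k"
    and a: "0 \<le> a" and c: "0 \<le> c" and \<mu>: "0 < \<mu>"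
  shows "emeasure (Pi\<^sub>M (complete_edges V) (\<lambda>i. expo 1)) (isolated_cheap V a c S)
    \<le> ennreal (exp (- a * (real k * (real (card V) - real k))) * (real k ^ 2 * c +
        (\<Sum>m<card V. real (card (states_with_terminals V k m S)) * (exp (\<mu> * (c - a * real k)) * (1 / (1 + \<mu>)) ^ m))))"
proof -
  let ?E = "complete_edges V"
  let ?P = "Pi\<^sub>M ?E (\<lambda>i. expo 1)" and ?B = "Pi\<^sub>M ?E (\<lambda>i. borel :: real measure)"
  let ?J = "incident_edges V S"
  have finE: "finite ?E" by (rule finite_complete_edges[OF V])
  have finS: "finite S" using S V finite_subset by blast
  have J: "?J \<subseteq> ?E" by (rule incident_edges_subset)
  have finJ: "finite ?J" using J finE finite_subset by blast
  have comp: "(\<lambda>x. x i) \<in> borel_measurable ?B" if "i \<in> ?E" for i using that by simp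
  define p where "p = exp (- a * (real k * (real (card V) - real k)))"
  have pJ: "exp (- a * real (card ?J)) \<le> p"
    using card_incident_edges_ge[OF V S(1)] S(2) a by (simp add: p_def mult_left_mono)
  define inner where "inner = {e \<in> ?E. e \<subseteq> S}"
  define X where "X = (\<lambda>e. {x \<in> space ?B. (\<forall>i\<in>?J. a \<le> x i) \<and> x e < c})"
  define Q where "Q = (\<lambda>F. {x \<in> space ?B. (\<forall>i\<in>?J. a \<le> x i) \<and> sum x F < c})"
  \<comment> \<open>Only states with at least \<open>k\<close> edges at the terminals are kept:
    these gain the full exponent \<open>a * k\<close>.\<close>
  define T where "T = (\<lambda>m. {s \<in> states_with_terminals V k m S. k \<le> card (fst (snd (snd s)) \<inter> ?J)})"
  let ?F = "\<lambda>s :: 'a set \<times> 'a set \<times> 'a set set \<times> 'a. fst (snd (snd s))"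
  have finT: "finite (T m)" for m
    using finite_grown_states[OF V] by (simp add: T_def states_with_terminals_def)
  have A: "{x \<in> space ?B. \<forall>i\<in>?J. a \<le> x i} \<in> sets ?B" using J finJ
    by (intro sets.sets_Collect_finite_All borel_measurable_le measurable_const comp) auto
  have Xm: "X e \<in> sets ?P" if "e \<in> ?E" for e
  proof -
    have "X e = {x \<in> space ?B. \<forall>i\<in>?J. a \<le> x i} \<inter> {x \<in> space ?B. x e < c}" by (auto simp: X_def)
    moreover have "{x \<in> space ?B. x e < c} \<in> sets ?B" using comp[OF that] by measurable
    ultimately show ?thesis using A by (simp add: sets_PiM_expo)
  qed
  have Qm: "Q F \<in> sets ?P" if "F \<subseteq> ?E" for F
  proof -
    have "Q F = {x \<in> space ?B. \<forall>i\<in>?J. a \<le> x i} \<inter> {x \<in> space ?B. sum x F < c}" by (auto simp: Q_def)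
    moreover have "(\<lambda>x. sum x F) \<in> borel_measurable ?B" using that by (intro borel_measurable_sum comp) auto
    hence "{x \<in> space ?B. sum x F < c} \<in> sets ?B" by measurable
    ultimately show ?thesis using A by (simp add: sets_PiM_expo)
  qed
  have Tinv: "?F s \<subseteq> ?E \<and> card (?F s) = m" if "s \<in> T m" for s m
    using that by (auto simp: T_def states_with_terminals_def grown_states_def dest!: grown_invariant)
  have inner_pairs: "inner \<subseteq> (\<lambda>(u, v). {u, v}) ` (S \<times> S)"
  proof
    fix e assume "e \<in> inner"
    hence e: "card e = 2" "e \<subseteq> S" by (auto simp: inner_def complete_edges_def)
    then obtain u v where "e = {u, v}" by (auto simp: card_2_iff)
    thus "e \<in> (\<lambda>(u, v). {u, v}) ` (S \<times> S)" using e by (intro image_eqI[of _ _ "(u, v)"]) auto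
  qed
  hence "card inner \<le> card ((\<lambda>(u, v). {u, v}) ` (S \<times> S))" using finS by (intro card_mono) auto
  also have "\<dots> \<le> card (S \<times> S)" using finS by (intro card_image_le) auto
  also have "\<dots> = k ^ 2" using S by (simp add: card_cartesian_product power2_eq_square)
  finally have "real (card inner) \<le> real (k ^ 2)" by (simp only: of_nat_le_iff)
  hence cin: "real (card inner) \<le> real k ^ 2" by simp
  have finI: "finite inner" using finE by (simp add: inner_def)
  have PX: "emeasure ?P (X e) \<le> ennreal (p * c)" if "e \<in> ?E" for e
  proof -
    have "emeasure ?P (X e) \<le> ennreal (exp (- a * real (card ?J)) * c)"
      unfolding X_def using that by (intro emeasure_conditioned_coord_less finE J a c)
    also have "\<dots> \<le> ennreal (p * c)" using pJ c by (intro ennreal_leI mult_right_mono)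
    finally show ?thesis .
  qed
  define q where "q = exp (\<mu> * (c - a * real k))"
  have PQ: "emeasure ?P (Q (?F s)) \<le> ennreal (p * (q * (1 / (1 + \<mu>)) ^ m))" if "s \<in> T m" for s m
  proof -
    have "emeasure ?P (Q (?F s)) \<le> ennreal (exp (- a * real (card ?J)) *
        (exp (\<mu> * (c - a * real (card (?F s \<inter> ?J)))) * (1 / (1 + \<mu>)) ^ card (?F s)))"
      unfolding Q_def using Tinv[OF that] by (intro emeasure_conditioned_sum_less finE J a \<mu>) auto
    also have "\<dots> \<le> ennreal (p * (q * (1 / (1 + \<mu>)) ^ m))"
    proof (intro ennreal_leI mult_mono pJ)
      have "a * real k \<le> a * real (card (?F s \<inter> ?J))"
        using that a by (intro mult_left_mono) (auto simp: T_def)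
      thus "exp (\<mu> * (c - a * real (card (?F s \<inter> ?J)))) \<le> q"
        using \<mu> by (simp add: q_def)
      show "(1 / (1 + \<mu>)) ^ card (?F s) \<le> (1 / (1 + \<mu>)) ^ m" using Tinv[OF that] by simp
    qed (use \<mu> in \<open>auto simp: p_def q_def\<close>)
    finally show ?thesis .
  qed
  \<comment> \<open>A finite cover of the event up to a null set: either some edge inside
    \<open>S\<close> is cheap, or some encoded tree with \<open>k\<close> terminal edges is. Only
    \<open>m < card V\<close> occurs because the tree has \<open>m + 1\<close> vertices.\<close>
  define R where "R = (\<Union>e\<in>inner. X e) \<union> (\<Union>m\<in>{..<card V}. \<Union>s\<in>T m. Q (?F s))"
  have UX: "(\<Union>e\<in>inner. X e) \<in> sets ?P" using Xm finI by (intro sets.finite_UN) (auto simp: inner_def)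
  have UQ: "(\<Union>s\<in>T m. Q (?F s)) \<in> sets ?P" for m using Qm Tinv finT by (intro sets.finite_UN) auto
  have UUQ: "(\<Union>m\<in>{..<card V}. \<Union>s\<in>T m. Q (?F s)) \<in> sets ?P" by (rule sets.finite_UN[OF finite_lessThan UQ])
  have step: "x \<in> R" if x: "x \<in> isolated_cheap V a c S" "\<forall>i\<in>?E. 0 \<le> x i" for x
  proof -
    have xs: "x \<in> space ?B" "\<forall>i\<in>?J. a \<le> x i" "steiner_weight V ?E x S < c"
      using x by (auto simp: isolated_cheap_def)
    have "V \<noteq> {}" using S k by auto
    from steiner_weight_attained[OF V this S(1)] obtain U F where
      UF: "is_subgraph U F V ?E" "connected_graph U F" "S \<subseteq> U" "steiner_weight V ?E x S = sum x F" by metis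
    from grown_in_connected[OF UF(2,1) finS UF(3)] obtain m U' F' b where
      g: "grown V k m S U' F' b" "F' \<subseteq> F" unfolding S(2) by (elim exE conjE)
    note inv = grown_invariant[OF g(1)]
    have FE: "F \<subseteq> ?E" using UF(1) by (simp add: is_subgraph_def)
    have finF: "finite F" using FE finE finite_subset by blast
    have "sum x F' \<le> sum x F" using FE g(2) x(2) finF by (intro sum_mono2) auto
    hence less: "sum x F' < c" using xs UF by simp
    have "card U' \<le> card V" using inv V by (intro card_mono) auto
    hence m: "m < card V" using inv by simp
    show "x \<in> R"
    \<comment> \<open>An edge joining two terminals would serve both at once and break the count of
      \<open>k\<close> heavy edges. By nonnegativity that edge alone weighs less than
      \<open>c\<close>, which is rare enough.\<close>
    proof (cases "\<exists>e\<in>F'. e \<subseteq> S")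
      case True
      then obtain e where e: "e \<in> F'" "e \<subseteq> S" by blast
      have "x e \<le> sum x F'" using e inv x(2) by (intro member_le_sum) auto
      hence "x \<in> X e" using xs less by (simp add: X_def)
      moreover have "e \<in> inner" using e inv by (auto simp: inner_def)
      ultimately show ?thesis by (auto simp: R_def)
    next
      case False
      hence "k \<le> card (F' \<inter> ?J)" using grown_terminal_edges[OF g(1)] S(2) k by auto
      hence "(S, U', F', b) \<in> T m" using g by (simp add: T_def states_with_terminals_def grown_states_def)
      moreover have "x \<in> Q F'" using xs less by (simp add: Q_def)
      ultimately have "x \<in> (\<Union>s\<in>T m. Q (?F s))" by (intro UN_I[of "(S, U', F', b)"]) auto
      thus ?thesis using m by (auto simp: R_def)
    qed
  qed
  have "emeasure ?P (isolated_cheap V a c S) \<le> emeasure ?P R"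
  proof (rule emeasure_mono_AE)
    have "AE x in ?P. \<forall>i\<in>?E. 0 \<le> x i" using finE by (intro AE_PiM_expo_nonneg) auto
    thus "AE x in ?P. x \<in> isolated_cheap V a c S \<longrightarrow> x \<in> R" by eventually_elim (use step in blast)
    show "R \<in> sets ?P" unfolding R_def by (intro sets.Un UX UUQ)
  qed
  also have "\<dots> \<le> emeasure ?P (\<Union>e\<in>inner. X e) + emeasure ?P (\<Union>m\<in>{..<card V}. \<Union>s\<in>T m. Q (?F s))"
    unfolding R_def by (intro emeasure_subadditive UX UUQ)
  also have "\<dots> \<le> ennreal (real (card inner) * (p * c)) +
      (\<Sum>m<card V. ennreal (real (card (T m)) * (p * (q * (1 / (1 + \<mu>)) ^ m))))"
  proof (rule add_mono)
    show "emeasure ?P (\<Union>e\<in>inner. X e) \<le> ennreal (real (card inner) * (p * c))"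
      using finI Xm PX c by (intro emeasure_UN_le_card) (auto simp: inner_def p_def)
    have "emeasure ?P (\<Union>m\<in>{..<card V}. \<Union>s\<in>T m. Q (?F s)) \<le> (\<Sum>m<card V. emeasure ?P (\<Union>s\<in>T m. Q (?F s)))"
      using UQ by (intro emeasure_subadditive_finite) auto
    also have "\<dots> \<le> (\<Sum>m<card V. ennreal (real (card (T m)) * (p * (q * (1 / (1 + \<mu>)) ^ m))))"
      using Qm Tinv PQ finT \<mu> by (intro sum_mono emeasure_UN_le_card) (auto simp: p_def q_def)
    finally show "emeasure ?P (\<Union>m\<in>{..<card V}. \<Union>s\<in>T m. Q (?F s))
       \<le> (\<Sum>m<card V. ennreal (real (card (T m)) * (p * (q * (1 / (1 + \<mu>)) ^ m))))" .
  qed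
  also have "\<dots> = ennreal (real (card inner) * (p * c) + (\<Sum>m<card V. real (card (T m)) * (p * (q * (1 / (1 + \<mu>)) ^ m))))"
    using c \<mu> by (subst sum_ennreal) (auto simp: p_def q_def intro!: ennreal_plus[symmetric] sum_nonneg)
  also have "\<dots> \<le> ennreal (real k ^ 2 * (p * c) +
      (\<Sum>m<card V. real (card (states_with_terminals V k m S)) * (p * (q * (1 / (1 + \<mu>)) ^ m))))"
  proof (intro ennreal_leI add_mono sum_mono mult_right_mono cin)
    fix m
    have "finite (states_with_terminals V k m S)"
      using finite_grown_states[OF V] by (simp add: states_with_terminals_def)
    hence "card (T m) \<le> card (states_with_terminals V k m S)" by (intro card_mono) (auto simp: T_def)
    thus "real (card (T m)) \<le> real (card (states_with_terminals V k m S))" by simp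
  qed (use c \<mu> in \<open>auto simp: p_def q_def\<close>)
  also have "real k ^ 2 * (p * c) + (\<Sum>m<card V. real (card (states_with_terminals V k m S)) * (p * (q * (1 / (1 + \<mu>)) ^ m)))
    = p * (real k ^ 2 * c + (\<Sum>m<card V. real (card (states_with_terminals V k m S)) * (q * (1 / (1 + \<mu>)) ^ m)))"
    by (simp add: distrib_left sum_distrib_left mult_ac)
  finally show ?thesis unfolding p_def q_def .
qed

lemma sum_isolated_cheap_bound:
  fixes q r p0 :: real
  assumes "finite V" "0 \<le> q" "0 \<le> r" "0 \<le> p0" "0 \<le> c"
  shows "(\<Sum>S\<in>{S. S \<subseteq> V \<and> card S = k}. p0 * (real k ^ 2 * c +
        (\<Sum>m<card V. real (card (states_with_terminals V k m S)) * (q * r ^ m))))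
     \<le> p0 * (real (card V) ^ k * (real k ^ 2 * c) +
        q * (\<Sum>m<card V. real (card V) ^ Suc m * real (Suc m) ^ (2 * k) * r ^ m))"
proof -
  let ?\<S> = "{S. S \<subseteq> V \<and> card S = k}"
  have "card ?\<S> = card V choose k" using assms(1) by (simp add: n_subsets)
  moreover have "card V choose k \<le> card V ^ k"
    by (cases "k \<le> card V") (simp_all add: binomial_le_pow binomial_eq_0)
  ultimately have "real (card ?\<S>) \<le> real (card V) ^ k" by (metis of_nat_le_iff of_nat_power)
  hence 1: "real (card ?\<S>) * (real k ^ 2 * c) \<le> real (card V) ^ k * (real k ^ 2 * c)"
    using assms(5) by (intro mult_right_mono) auto
  have 2: "(\<Sum>S\<in>?\<S>. real (card (states_with_terminals V k m S))) \<le> real (card V) ^ Suc m * real (Suc m) ^ (2 * k)" for m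
  proof -
    have "real (\<Sum>S\<in>?\<S>. card (states_with_terminals V k m S)) \<le> real (card V ^ Suc m * Suc m ^ (2 * k))"
      using sum_card_states_with_terminals[OF assms(1) finite_nsubsets[OF assms(1)]] by (simp only: of_nat_le_iff)
    thus ?thesis by (simp only: of_nat_sum of_nat_mult of_nat_power)
  qed
  have "(\<Sum>S\<in>?\<S>. \<Sum>m<card V. real (card (states_with_terminals V k m S)) * (q * r ^ m))
    = (\<Sum>m<card V. (\<Sum>S\<in>?\<S>. real (card (states_with_terminals V k m S))) * (q * r ^ m))"
    by (subst sum.swap) (simp add: sum_distrib_right)
  also have "\<dots> \<le> (\<Sum>m<card V. real (card V) ^ Suc m * real (Suc m) ^ (2 * k) * (q * r ^ m))"
    using assms 2 by (intro sum_mono mult_right_mono) auto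
  also have "\<dots> = q * (\<Sum>m<card V. real (card V) ^ Suc m * real (Suc m) ^ (2 * k) * r ^ m)"
    by (simp add: sum_distrib_left mult_ac)
  finally have "real (card ?\<S>) * (real k ^ 2 * c) + (\<Sum>S\<in>?\<S>. \<Sum>m<card V. real (card (states_with_terminals V k m S)) * (q * r ^ m))
    \<le> real (card V) ^ k * (real k ^ 2 * c) + q * (\<Sum>m<card V. real (card V) ^ Suc m * real (Suc m) ^ (2 * k) * r ^ m)"
    using 1 by (rule add_mono[rotated])
  hence "p0 * (real (card ?\<S>) * (real k ^ 2 * c) + (\<Sum>S\<in>?\<S>. \<Sum>m<card V. real (card (states_with_terminals V k m S)) * (q * r ^ m)))
    \<le> p0 * (real (card V) ^ k * (real k ^ 2 * c) + q * (\<Sum>m<card V. real (card V) ^ Suc m * real (Suc m) ^ (2 * k) * r ^ m))"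
    using assms(4) by (rule mult_left_mono)
  thus ?thesis by (simp add: sum_distrib_left[symmetric] sum.distrib)
qed

section \<open>Number of vertices with only heavy edges, and the lower tail bound\<close>

text \<open>Chebyshev's inequality: \<open>L\<close> is the mean of the count, and its variance is
  at most \<open>L + L^2 * (exp a - 1)\<close>. A count of at most \<open>L / 2\<close> deviates
  from the mean by at least \<open>L / 2\<close>.\<close>

lemma few_isolated_vertices:
  fixes V :: "'v set"
  assumes V: "finite V" "V \<noteq> {}" and a: "0 \<le> a"
  defines "n \<equiv> real (card V)"
  defines "L \<equiv> n * exp (- a * (n - 1))"
  defines "I \<equiv> \<lambda>x. {v \<in> V. \<forall>e\<in>incident_edges V {v}. a \<le> x e}"
  shows "{x \<in> space (Pi\<^sub>M (complete_edges V) (\<lambda>i. borel)). real (card (I x)) \<le> L / 2}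
      \<in> sets (Pi\<^sub>M (complete_edges V) (\<lambda>i. borel))" (is "?Z \<in> _")
    and "measure (Pi\<^sub>M (complete_edges V) (\<lambda>i. expo 1))
      {x \<in> space (Pi\<^sub>M (complete_edges V) (\<lambda>i. borel)). real (card (I x)) \<le> L / 2} \<le> 4 / L + 4 * (exp a - 1)"
proof -
  let ?E = "complete_edges V"
  let ?P = "Pi\<^sub>M ?E (\<lambda>i. expo 1)" and ?B = "Pi\<^sub>M ?E (\<lambda>i. borel :: real measure)"
  interpret P: prob_space ?P by (intro prob_space_PiM prob_space_exponential_density) simp
  have finE: "finite ?E" by (rule finite_complete_edges[OF V(1)])
  define A where "A = (\<lambda>S. {x \<in> space ?B. \<forall>e\<in>incident_edges V S. a \<le> x e})"
  have Am: "A S \<in> sets ?P" for S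
    unfolding A_def sets_PiM_expo
    using incident_edges_subset[of V S] finite_subset[OF incident_edges_subset finE]
    by (intro sets.sets_Collect_finite_All borel_measurable_le measurable_const measurable_component_singleton) auto
  have PA: "P.prob (A S) = exp (- a * real (card (incident_edges V S)))" for S
    using emeasure_PiM_expo_atLeast[OF finE incident_edges_subset[of V S], of 1 a] a
    by (simp add: A_def measure_def)
  have Asp [simp]: "A S \<inter> space ?B = A S" "A S \<inter> A S' \<inter> space ?B = A S \<inter> A S'" for S S'
    by (auto simp: A_def)
  define p where "p = exp (- a * (n - 1))"
  have PA1: "P.prob (A {v}) = p" if "v \<in> V" for v
    using that V by (simp add: PA card_incident_edges_singleton p_def n_def)
  have PA2: "P.prob (A {u} \<inter> A {v}) \<le> p ^ 2 * exp a" if "u \<in> V" "v \<in> V" "u \<noteq> v" for u v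
  proof -
    have "A {u} \<inter> A {v} = A {u, v}" by (auto simp: A_def incident_edges_def)
    hence "P.prob (A {u} \<inter> A {v}) = exp (- a * real (card (incident_edges V {u, v})))" by (simp add: PA)
    also have "\<dots> \<le> exp (- a * (2 * n - 3))"
      using mult_left_mono[OF card_incident_edges_pair[OF V(1) that] a] by (simp add: n_def)
    also have "\<dots> = p ^ 2 * exp a"
      by (simp add: p_def power2_eq_square exp_add[symmetric] algebra_simps)
    finally show ?thesis .
  qed
  define N where "N = (\<lambda>x. \<Sum>v\<in>V. indicator (A {v}) x :: real)"
  have NI: "N x = real (card (I x))" if "x \<in> space ?B" for x
  proof -
    have "N x = (\<Sum>v\<in>V. if v \<in> I x then 1 else 0)"
      unfolding N_def using that by (intro sum.cong) (auto simp: A_def I_def indicator_def)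
    also have "\<dots> = real (card (I x))"
      using V by (simp add: sum.If_cases) (auto simp: I_def intro!: arg_cong[where f = card])
    finally show ?thesis .
  qed
  have Nm [measurable]: "N \<in> borel_measurable ?P" unfolding N_def using Am by simp
  have "{x \<in> space ?P. N x \<le> L / 2} \<in> sets ?P" by measurable
  moreover have Zeq: "?Z = {x \<in> space ?P. N x \<le> L / 2}" using NI by auto
  ultimately show "?Z \<in> sets ?B" by (simp add: sets_PiM_expo)
  have n0: "0 < n" using V by (simp add: n_def card_gt_0_iff)
  have Lp: "L = n * p" by (simp add: L_def p_def)
  have L0: "0 < L" using n0 by (simp add: L_def)
  have iA: "integrable ?P (indicator (A {v}) :: _ \<Rightarrow> real)" for v
    using Am by (simp add: P.emeasure_eq_measure)
  have EN: "P.expectation N = L"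
    unfolding N_def using iA Am PA1 by (subst Bochner_Integration.integral_sum) (auto simp: Lp n_def)
  have N2: "N x ^ 2 = (\<Sum>u\<in>V. \<Sum>v\<in>V. indicator (A {u} \<inter> A {v}) x)" for x
    by (simp add: N_def power2_eq_square sum_product indicator_inter_arith)
  have iAA: "integrable ?P (indicator (A {u} \<inter> A {v}) :: _ \<Rightarrow> real)" for u v
    using Am by (simp add: P.emeasure_eq_measure)
  have iN2: "integrable ?P (\<lambda>x. N x ^ 2)"
    unfolding N2 using iAA by (intro Bochner_Integration.integrable_sum)
  have iN: "integrable ?P N" unfolding N_def using iA by (intro Bochner_Integration.integrable_sum)
  have "P.expectation (\<lambda>x. N x ^ 2) = (\<Sum>u\<in>V. \<Sum>v\<in>V. P.prob (A {u} \<inter> A {v}))"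
    unfolding N2 using iAA Am
    by (simp add: Bochner_Integration.integral_sum Bochner_Integration.integrable_sum)
  \<comment> \<open>Diagonal pairs contribute \<open>p\<close>, all others at most
    \<open>p ^ 2 * exp a\<close>.\<close>
  also have "\<dots> \<le> (\<Sum>u\<in>V. \<Sum>v\<in>V. (if v = u then p else 0) + p ^ 2 * exp a)"
    using PA1 PA2 by (intro sum_mono) (auto simp: add_increasing2)
  also have "\<dots> = n * (p + n * (p ^ 2 * exp a))"
    using V by (simp add: sum.distrib n_def)
  also have "\<dots> = L + L ^ 2 * exp a" by (simp add: Lp algebra_simps power2_eq_square)
  finally have "P.variance N \<le> L + L ^ 2 * (exp a - 1)"
    using P.variance_eq[OF iN iN2] EN by (simp add: algebra_simps)
  moreover have "P.prob {x \<in> space ?P. L / 2 \<le> \<bar>N x - P.expectation N\<bar>} \<le> P.variance N / (L / 2) ^ 2"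
    using L0 by (intro P.Chebyshev_inequality Nm iN2) auto
  ultimately have "P.prob {x \<in> space ?P. L / 2 \<le> \<bar>N x - L\<bar>} \<le> (L + L ^ 2 * (exp a - 1)) / (L / 2) ^ 2"
    unfolding EN by (elim order_trans) (auto intro!: divide_right_mono)
  also have "\<dots> = 4 / L + 4 * (exp a - 1)"
    using L0 by (simp add: power2_eq_square field_simps)
  finally have *: "P.prob {x \<in> space ?P. L / 2 \<le> \<bar>N x - L\<bar>} \<le> 4 / L + 4 * (exp a - 1)" .
  have "P.prob ?Z \<le> P.prob {x \<in> space ?P. L / 2 \<le> \<bar>N x - L\<bar>}"
    unfolding Zeq using L0 by (intro P.finite_measure_mono) (auto simp: abs_if)
  thus "P.prob ?Z \<le> 4 / L + 4 * (exp a - 1)" using * by linarith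
qed

text \<open>If the maximum is below \<open>c\<close>, every \<open>k\<close>-subset of the vertices
  with only heavy edges belongs to \<open>isolated_cheap\<close>. Unless such vertices are few,
  there are at least \<open>(L / (2 * k)) ^ k\<close> of these subsets, and Markov's inequality for
  their number gives the last summand.\<close>

lemma max_steiner_weight_lower_tail:
  fixes V :: "'v set"
  assumes V: "finite V" and k: "2 \<le> k" "k \<le> card V"
    and a: "0 \<le> a" and c: "0 \<le> c" and \<mu>: "0 < \<mu>"
  defines "n \<equiv> real (card V)"
  defines "L \<equiv> n * exp (- a * (n - 1))"
  assumes L: "2 * real k \<le> L"
  shows "measure (Pi\<^sub>M (complete_edges V) (\<lambda>i. expo 1))
     {x \<in> space (Pi\<^sub>M (complete_edges V) (\<lambda>i. borel)). max_steiner_weight V (complete_edges V) x k < c}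
   \<le> 4 / L + 4 * (exp a - 1) + (2 * real k / L) ^ k * (exp (- a * (real k * (n - real k))) *
      (n ^ k * (real k ^ 2 * c) + exp (\<mu> * (c - a * real k)) *
        (\<Sum>m<card V. n ^ Suc m * real (Suc m) ^ (2 * k) * (1 / (1 + \<mu>)) ^ m)))"
proof -
  let ?E = "complete_edges V" and ?\<S> = "{S. S \<subseteq> V \<and> card S = k}"
  let ?P = "Pi\<^sub>M ?E (\<lambda>i. expo 1)" and ?B = "Pi\<^sub>M ?E (\<lambda>i. borel :: real measure)"
  interpret P: prob_space ?P by (intro prob_space_PiM prob_space_exponential_density) simp
  have fS: "finite ?\<S>" by (rule finite_nsubsets[OF V])
  have V0: "V \<noteq> {}" using k by auto
  define I where "I = (\<lambda>x. {v \<in> V. \<forall>e\<in>incident_edges V {v}. a \<le> x e})"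
  have few: "{x \<in> space ?B. real (card (I x)) \<le> L / 2} \<in> sets ?P"
    unfolding I_def L_def n_def sets_PiM_expo by (rule few_isolated_vertices(1)[OF V V0 a])
  have Pfew: "P.prob {x \<in> space ?B. real (card (I x)) \<le> L / 2} \<le> 4 / L + 4 * (exp a - 1)"
    unfolding I_def L_def n_def by (rule few_isolated_vertices(2)[OF V V0 a])
  \<comment> \<open>From \<open>N choose k \<ge> (N / k) ^ k\<close> with \<open>N > L / 2\<close>;
    the assumption \<open>2 * k \<le> L\<close> ensures \<open>k \<le> N\<close>.\<close>
  define t where "t = (L / (2 * real k)) ^ k"
  have t0: "0 < t" using L k by (auto simp: t_def intro!: zero_less_power divide_pos_pos)
  define p0 where "p0 = exp (- a * (real k * (n - real k)))"
  define q where "q = exp (\<mu> * (c - a * real k))"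
  define K where "K = p0 * (n ^ k * (real k ^ 2 * c) + q * (\<Sum>m<card V. n ^ Suc m * real (Suc m) ^ (2 * k) * (1 / (1 + \<mu>)) ^ m))"
  define C where "C = (\<lambda>x. \<Sum>S\<in>?\<S>. indicator (isolated_cheap V a c S) x :: ennreal)"
  have icm: "isolated_cheap V a c S \<in> sets ?P" for S
    using isolated_cheap_measurable[OF V] by (simp add: sets_PiM_expo)
  have Cm [measurable]: "C \<in> borel_measurable ?P" unfolding C_def using icm by simp
  let ?F = "\<lambda>S. p0 * (real k ^ 2 * c + (\<Sum>m<card V. real (card (states_with_terminals V k m S)) * (q * (1 / (1 + \<mu>)) ^ m)))"
  have F0: "0 \<le> ?F S" for S
    using c \<mu> by (auto simp: p0_def q_def intro!: mult_nonneg_nonneg add_nonneg_nonneg sum_nonneg)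
  have "(\<integral>\<^sup>+ x. C x \<partial>?P) = (\<Sum>S\<in>?\<S>. emeasure ?P (isolated_cheap V a c S))"
    unfolding C_def using icm by (simp add: nn_integral_sum)
  also have "\<dots> \<le> (\<Sum>S\<in>?\<S>. ennreal (?F S))"
    using emeasure_isolated_cheap[OF V _ _ k(1) a c \<mu>] unfolding p0_def q_def n_def by (intro sum_mono) auto
  also have "\<dots> = ennreal (\<Sum>S\<in>?\<S>. ?F S)" using F0 by (intro sum_ennreal)
  also have "\<dots> \<le> ennreal K"
    unfolding K_def n_def using V c \<mu> by (intro ennreal_leI sum_isolated_cheap_bound) (auto simp: p0_def q_def)
  finally have IC: "(\<integral>\<^sup>+ x. C x \<partial>?P) \<le> ennreal K" .
  have K0: "0 \<le> K"
    using c \<mu> by (auto simp: K_def p0_def q_def n_def intro!: mult_nonneg_nonneg add_nonneg_nonneg sum_nonneg)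
  define Z2 where "Z2 = {x \<in> space ?P. 1 \<le> ennreal (1 / t) * C x}"
  have Z2m: "Z2 \<in> sets ?P" unfolding Z2_def by measurable
  have "emeasure ?P Z2 \<le> ennreal (1 / t) * (\<integral>\<^sup>+ x. C x * indicator (space ?P) x \<partial>?P)"
    unfolding Z2_def by (intro nn_integral_Markov_inequality) simp_all
  also have "(\<integral>\<^sup>+ x. C x * indicator (space ?P) x \<partial>?P) = (\<integral>\<^sup>+ x. C x \<partial>?P)"
    by (intro nn_integral_cong) simp
  also have "ennreal (1 / t) * \<dots> \<le> ennreal (1 / t) * ennreal K" by (intro mult_left_mono IC) simp
  also have "\<dots> = ennreal (1 / t * K)" using t0 by (intro ennreal_mult'[symmetric]) simp
  finally have PZ2: "P.prob Z2 \<le> 1 / t * K"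
    using t0 K0 by (simp add: P.emeasure_eq_measure)
  let ?Z1 = "{x \<in> space ?B. real (card (I x)) \<le> L / 2}"
  let ?Bad = "{x \<in> space ?B. max_steiner_weight V ?E x k < c}"
  have "?Bad \<subseteq> ?Z1 \<union> Z2"
  proof
    fix x assume "x \<in> ?Bad"
    hence x: "x \<in> space ?B" "max_steiner_weight V ?E x k < c" by auto
    show "x \<in> ?Z1 \<union> Z2"
    proof (cases "real (card (I x)) \<le> L / 2")
      case False
      have finI: "finite (I x)" using V by (simp add: I_def)
      have kI: "k \<le> card (I x)" using False L by linarith
      have "x \<in> isolated_cheap V a c S" if S: "S \<subseteq> I x" "card S = k" for S
      proof -
        have "S \<subseteq> V" using S by (auto simp: I_def)
        hence "steiner_weight V ?E x S < c"
          using x(2) S by (subst (asm) max_steiner_weight_less_iff[OF V k(2)]) auto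
        moreover have "a \<le> x e" if eS: "e \<in> incident_edges V S" for e
        proof -
          obtain v where "v \<in> e" "v \<in> S" using eS by (auto simp: incident_edges_def)
          moreover from this have "e \<in> incident_edges V {v}" using eS by (auto simp: incident_edges_def)
          ultimately show ?thesis using S by (auto simp: I_def)
        qed
        ultimately show ?thesis using x(1) by (simp add: isolated_cheap_def)
      qed
      hence "(\<Sum>S\<in>{S. S \<subseteq> I x \<and> card S = k}. 1) \<le> (\<Sum>S\<in>{S. S \<subseteq> I x \<and> card S = k}. indicator (isolated_cheap V a c S) x :: ennreal)"
        by (intro sum_mono) simp
      also have "\<dots> \<le> C x" unfolding C_def using fS by (intro sum_mono2) (auto simp: I_def)
      finally have le: "of_nat (card (I x) choose k) \<le> C x" using finI by (simp add: n_subsets)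
      have "t \<le> real (card (I x) choose k)"
      proof -
        have "t \<le> (real (card (I x)) / real k) ^ k"
          unfolding t_def using False L k by (intro power_mono) (auto simp: field_simps)
        also have "\<dots> \<le> real (card (I x) choose k)"
          using binomial_ge_n_over_k_pow_k[OF kI, where 'a = real] by simp
        finally show ?thesis .
      qed
      hence "ennreal t \<le> of_nat (card (I x) choose k)" by (simp add: ennreal_of_nat_eq_real_of_nat ennreal_leI)
      hence "ennreal t \<le> C x" using le by (rule order_trans)
      hence "ennreal (1 / t) * ennreal t \<le> ennreal (1 / t) * C x" by (intro mult_left_mono) auto
      moreover have "ennreal (1 / t) * ennreal t = 1" using t0 by (simp flip: ennreal_mult')
      ultimately have "x \<in> Z2" using x by (simp add: Z2_def)
      thus ?thesis by simp
    qed (use x in simp)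
  qed
  hence "P.prob ?Bad \<le> P.prob (?Z1 \<union> Z2)"
    by (intro P.finite_measure_mono sets.Un few Z2m)
  also have "\<dots> \<le> P.prob ?Z1 + P.prob Z2"
    by (intro measure_Un_le few Z2m)
  also have "\<dots> \<le> (4 / L + 4 * (exp a - 1)) + 1 / t * K" using Pfew PZ2 by (rule add_mono)
  also have "1 / t * K = (2 * real k / L) ^ k * K" by (simp add: t_def power_divide)
  finally show ?thesis unfolding K_def p0_def q_def .
qed

section \<open>Asymptotics\<close>

text \<open>Independence together with the marginals identifies the joint law as a product measure;
  afterwards only the product space of weights matters.\<close>

lemma distr_weights:
  assumes "prob_space M"
    and "prob_space.indep_vars M (\<lambda>_. borel) T E"
    and "E \<noteq> {}"
    and d: "\<And>e. e \<in> E \<Longrightarrow> distributed M lborel (T e) (exponential_density 1)"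
  shows "(\<lambda>\<omega>. \<lambda>e\<in>E. T e \<omega>) \<in> measurable M (Pi\<^sub>M E (\<lambda>_. borel))"
    and "distr M (Pi\<^sub>M E (\<lambda>_. borel)) (\<lambda>\<omega>. \<lambda>e\<in>E. T e \<omega>) = Pi\<^sub>M E (\<lambda>_. expo 1)"
proof -
  interpret prob_space M by fact
  have rv: "T e \<in> borel_measurable M" if "e \<in> E" for e
    using d[OF that] by (simp add: distributed_def)
  thus "(\<lambda>\<omega>. \<lambda>e\<in>E. T e \<omega>) \<in> measurable M (Pi\<^sub>M E (\<lambda>_. borel))" by (intro measurable_restrict)
  have "distr M (Pi\<^sub>M E (\<lambda>_. borel)) (\<lambda>\<omega>. \<lambda>e\<in>E. T e \<omega>) = Pi\<^sub>M E (\<lambda>e. distr M borel (T e))"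
    using indep_vars_iff_distr_eq_PiM'[where I = E and X = T and M' = "\<lambda>_. borel"] assms rv by auto
  also have "\<dots> = Pi\<^sub>M E (\<lambda>_. expo 1)"
  proof (rule PiM_cong)
    fix e assume "e \<in> E"
    have "distr M borel (T e) = distr M lborel (T e)" by (intro distr_cong) auto
    also have "\<dots> = expo 1" using d[OF \<open>e \<in> E\<close>] by (simp add: distributed_def)
    finally show "distr M borel (T e) = expo 1" .
  qed simp
  finally show "distr M (Pi\<^sub>M E (\<lambda>_. borel)) (\<lambda>\<omega>. \<lambda>e\<in>E. T e \<omega>) = Pi\<^sub>M E (\<lambda>_. expo 1)" .
qed

lemma measure_weights:
  assumes "(\<lambda>\<omega>. \<lambda>e\<in>E. T e \<omega>) \<in> measurable M (Pi\<^sub>M E (\<lambda>_. borel))"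
    and "distr M (Pi\<^sub>M E (\<lambda>_. borel)) (\<lambda>\<omega>. \<lambda>e\<in>E. T e \<omega>) = Pi\<^sub>M E (\<lambda>_. expo 1)"
    and "{x \<in> space (Pi\<^sub>M E (\<lambda>_. borel)). Q x} \<in> sets (Pi\<^sub>M E (\<lambda>_. borel))"
  shows "measure M {\<omega> \<in> space M. Q (\<lambda>e\<in>E. T e \<omega>)} = measure (Pi\<^sub>M E (\<lambda>_. expo 1)) {x \<in> space (Pi\<^sub>M E (\<lambda>_. borel)). Q x}"
proof -
  let ?f = "\<lambda>\<omega>. \<lambda>e\<in>E. T e \<omega>"
  have "measure (Pi\<^sub>M E (\<lambda>_. expo 1)) {x \<in> space (Pi\<^sub>M E (\<lambda>_. borel)). Q x}
      = measure M (?f -` {x \<in> space (Pi\<^sub>M E (\<lambda>_. borel)). Q x} \<inter> space M)"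
    unfolding assms(2)[symmetric] by (rule measure_distr[OF assms(1,3)])
  also have "?f -` {x \<in> space (Pi\<^sub>M E (\<lambda>_. borel)). Q x} \<inter> space M = {\<omega> \<in> space M. Q (?f \<omega>)}"
    using measurable_space[OF assms(1)] by auto
  finally show ?thesis by simp
qed

text \<open>Ratio test: the quotients tend to \<open>\<theta>\<close> and are eventually below the
  midpoint of \<open>\<theta>\<close> and 1.\<close>

lemma summable_power_times_geometric:
  fixes \<theta> :: real
  assumes "0 < \<theta>" "\<theta> < 1"
  shows "summable (\<lambda>m. real (Suc m) ^ p * \<theta> ^ m)"
proof -
  have "(\<lambda>m. real (Suc (Suc m)) / real (Suc m)) \<longlonglongrightarrow> 1" by real_asymp
  hence "(\<lambda>m. (real (Suc (Suc m)) / real (Suc m)) ^ p * \<theta>) \<longlonglongrightarrow> 1 ^ p * \<theta>" by (intro tendsto_intros)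
  moreover have "1 ^ p * \<theta> < (\<theta> + 1) / 2" using assms by simp
  ultimately have "eventually (\<lambda>m. (real (Suc (Suc m)) / real (Suc m)) ^ p * \<theta> < (\<theta> + 1) / 2) sequentially"
    by (rule order_tendstoD)
  then obtain M where M: "\<And>m. m \<ge> M \<Longrightarrow> (real (Suc (Suc m)) / real (Suc m)) ^ p * \<theta> < (\<theta> + 1) / 2"
    by (auto simp: eventually_sequentially)
  show ?thesis
  proof (rule summable_ratio_test)
    show "(\<theta> + 1) / 2 < 1" using assms by simp
    fix m assume "M \<le> m"
    have "real (Suc (Suc m)) ^ p * \<theta> ^ Suc m
        = (real (Suc (Suc m)) / real (Suc m)) ^ p * \<theta> * (real (Suc m) ^ p * \<theta> ^ m)"
      by (simp add: power_divide)
    also have "\<dots> \<le> (\<theta> + 1) / 2 * (real (Suc m) ^ p * \<theta> ^ m)"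
      using M[OF \<open>M \<le> m\<close>] assms by (intro mult_right_mono) auto
    finally show "norm (real (Suc (Suc m)) ^ p * \<theta> ^ Suc m) \<le> (\<theta> + 1) / 2 * norm (real (Suc m) ^ p * \<theta> ^ m)"
      using assms by simp
  qed
qed

abbreviation weights :: "nat \<Rightarrow> (nat set \<Rightarrow> real) measure" where
  "weights n \<equiv> Pi\<^sub>M (complete_edges {1..n}) (\<lambda>_. expo 1)"

lemma upper_deviation:
  assumes k: "2 \<le> k" and \<epsilon>: "0 < \<epsilon>" "\<epsilon> \<le> 1"
  shows "(\<lambda>n. measure (weights n) {x \<in> space (weights n).
     (2 * real k - 1 + \<epsilon>) * (ln (real n) / real n) < max_steiner_weight {1..n} (complete_edges {1..n}) x k}) \<longlonglongrightarrow> 0"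
proof -
  \<comment> \<open>The slack \<open>e\<close> is spent \<open>k + 1\<close> times: on the small
    radius, on the bridge, and on each of the \<open>k - 1\<close> large radii.\<close>
  define e where "e = \<epsilon> / (real k + 1)"
  have e: "0 < e" "e \<le> 1" using \<epsilon> k by (auto simp: e_def divide_simps)
  \<comment> \<open>Used both as the rate of the second layer and as the parameter
    \<open>\<eta>\<close> of the growth moment, whence the square of \<open>1 - \<delta>\<close>
    below.\<close>
  define \<delta> where "\<delta> = e / 8"
  have \<delta>: "0 < \<delta>" "\<delta> < 1" using e by (auto simp: \<delta>_def)
  define Lg where "Lg = (\<lambda>n. ln (real n) / real n)"
  define r1 where "r1 = (\<lambda>n. nat \<lceil>ln (real n)\<rceil>)"
  define r2 where "r2 = (\<lambda>n. nat \<lceil>(1 - 1 / (2 * real k)) * real n\<rceil>)"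
  \<comment> \<open>\<open>B1\<close> and \<open>B2\<close> are the growth failures at the small and
    the large radius, summed over vertices. In \<open>B2\<close> the moment is itself of order
    \<open>n\<close>, so two factors \<open>n\<close> must be beaten. \<open>B3\<close> is the
    second layer summed over terminal sets.\<close>
  define B1 where "B1 = (\<lambda>n. exp (- (e / 2) * ln (real n)) * (4 / \<delta> * (ln (real n) + 1)))"
  define B2 where "B2 = (\<lambda>n. exp (- (e / 4) * ln (real n)) * (8 * real k / \<delta>))"
  define B3 where "B3 = (\<lambda>n. exp (real k * ln (real n) - \<delta> * e / 2 * (ln (real n))\<^sup>2))"
  have thr: "(1 + e) * Lg n + e * Lg n + (real k - 1) * ((2 + e) * Lg n) = (2 * real k - 1 + \<epsilon>) * (ln (real n) / real n)" for n
  proof -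
    have "\<epsilon> = (real k + 1) * e" using k by (simp add: e_def)
    hence "(1 + e) * Lg n + e * Lg n + (real k - 1) * ((2 + e) * Lg n) = (2 * real k - 1 + \<epsilon>) * Lg n"
      by (simp add: algebra_simps)
    thus ?thesis by (simp only: Lg_def)
  qed
  \<comment> \<open>The loss of \<open>(1 - \<delta>)^2\<close> in the exponent must leave a
    positive margin over the 1, respectively 2, powers of \<open>n\<close>;
    \<open>\<delta> = e / 8\<close> leaves \<open>e / 2\<close> and \<open>e / 4\<close>.\<close>
  have quad1: "1 + e / 2 \<le> (1 - \<delta>) * (1 - \<delta>) * (1 + e)" and quad2: "2 + e / 4 \<le> (1 - \<delta>) * (1 - \<delta>) * (2 + e)"
  proof -
    have "e * e \<le> e" using e by (simp add: mult_left_le)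
    moreover have "0 \<le> e * e * e" using e by simp
    moreover have "(1 - \<delta>) * (1 - \<delta>) * (1 + e) = 1 + 3 / 4 * e - 15 / 64 * (e * e) + 1 / 64 * (e * e * e)"
      by (simp add: \<delta>_def field_simps)
    moreover have "(1 - \<delta>) * (1 - \<delta>) * (2 + e) = 2 + 1 / 2 * e - 7 / 32 * (e * e) + 1 / 64 * (e * e * e)"
      by (simp add: \<delta>_def field_simps)
    ultimately show "1 + e / 2 \<le> (1 - \<delta>) * (1 - \<delta>) * (1 + e)" "2 + e / 4 \<le> (1 - \<delta>) * (1 - \<delta>) * (2 + e)"
      using e by linarith+
  qed
  have ev: "eventually (\<lambda>n. measure (weights n) {x \<in> space (weights n).
     (2 * real k - 1 + \<epsilon>) * (ln (real n) / real n) < max_steiner_weight {1..n} (complete_edges {1..n}) x k}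
     \<le> B1 n + B2 n + B3 n) sequentially"
  proof -
    have "eventually (\<lambda>n::nat. 2 \<le> \<delta> * real n) sequentially" using \<delta> by real_asymp
    moreover have "eventually (\<lambda>n::nat. 12 * real k \<le> real n) sequentially" by real_asymp
    moreover have "eventually (\<lambda>n::nat. ln (real n) + 1 \<le> real n / 2) sequentially" by real_asymp
    moreover have "eventually (\<lambda>n::nat. 1 \<le> ln (real n)) sequentially" by real_asymp
    ultimately show ?thesis
    proof eventually_elim
      case (elim n)
      have kr: "2 \<le> real k" using k by simp
      have n: "24 \<le> real n" using elim kr by linarith
      let ?V = "{1..n}"
      have r1: "ln (real n) \<le> real (r1 n)" "real (r1 n) \<le> ln (real n) + 1" "1 \<le> real (r1 n)"
        using elim unfolding r1_def by linarith+
      have r1n: "2 * real (r1 n) \<le> real n" using r1(2) elim(3) by linarith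
      have nonneg: "0 \<le> (1 - 1 / (2 * real k)) * real n" using kr by (intro mult_nonneg_nonneg) auto
      have r2: "(1 - 1 / (2 * real k)) * real n \<le> real (r2 n)" "real (r2 n) \<le> (1 - 1 / (2 * real k)) * real n + 1"
        using nonneg unfolding r2_def by linarith+
      have r2n: "real n - real n / (2 * real k) \<le> real (r2 n)" "real (r2 n) \<le> real n - real n / (2 * real k) + 1"
        using r2 by (simp_all add: algebra_simps)
      have six: "6 \<le> real n / (2 * real k)" using elim kr by (simp add: field_simps)
      have half: "real n / (2 * real k) \<le> real n / 4" using kr n by (intro divide_left_mono) auto
      have K1: "(real n - 1) / (\<delta> * real n - 1) \<le> 2 / \<delta>"
      proof -
        have "(real n - 1) / (\<delta> * real n - 1) \<le> real n / (\<delta> * real n / 2)"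
          using elim n \<delta> by (intro frac_le) auto
        thus ?thesis using n \<delta> by simp
      qed
      have K10: "0 \<le> (real n - 1) / (\<delta> * real n - 1)" using elim n by auto
      have K2: "real (r1 n) * (real n - 2) / (real n - real (r1 n) - 1) \<le> 2 * (ln (real n) + 1)"
      proof -
        have d: "0 < real n - real (r1 n) - 1" using r1n n by linarith
        have d2: "real n - 2 \<le> 2 * (real n - real (r1 n) - 1)" using r1n by (simp add: algebra_simps)
        have "real (r1 n) * (real n - 2) \<le> (ln (real n) + 1) * (2 * (real n - real (r1 n) - 1))"
          using r1 d d2 n by (intro mult_mono) auto
        thus ?thesis unfolding pos_divide_le_eq[OF d] by (simp only: mult_ac)
      qed
      have K20: "0 \<le> real (r1 n) * (real n - 2) / (real n - real (r1 n) - 1)"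
        using r1n r1(3) n by (intro divide_nonneg_nonneg mult_nonneg_nonneg) auto
      have K3: "real (r2 n) * (real n - 2) / (real n - real (r2 n) - 1) \<le> 4 * real k * real n"
      proof -
        have d: "real n / (4 * real k) \<le> real n - real (r2 n) - 1" using r2n six by simp
        have "real (r2 n) * (real n - 2) / (real n - real (r2 n) - 1) \<le> real n * real n / (real n / (4 * real k))"
          using d n kr r2n six by (intro frac_le mult_mono) auto
        also have "\<dots> = 4 * real k * real n" using n by simp
        finally show ?thesis .
      qed
      have K30: "0 \<le> real (r2 n) * (real n - 2) / (real n - real (r2 n) - 1)"
        using r2n six n by (intro divide_nonneg_nonneg mult_nonneg_nonneg) auto
      \<comment> \<open>Each of the \<open>k - 1\<close> large balls misses at most
        \<open>n / (2 * k)\<close> vertices, so half of all vertices lie in all of them.\<close>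
      have m: "real n / 2 \<le> real n - (real k - 1) * (real n - (real (r2 n) + 1))"
      proof -
        have "(real k - 1) * (real n - (real (r2 n) + 1)) \<le> real k * (real n / (2 * real k))"
          using kr r2n six by (intro mult_mono) auto
        also have "\<dots> = real n / 2" using kr by simp
        finally show ?thesis by simp
      qed
      have kn: "real k \<le> real n" using elim kr by linarith
      have nL: "real n * Lg n = ln (real n)" using n by (simp add: Lg_def)
      have ex: "real n * exp y = exp (ln (real n) + y)" for y using n by (simp add: exp_add)
      have ar: "(1 - \<delta>) * (1 - \<delta>) * real n * (b * Lg n) = (1 - \<delta>) * (1 - \<delta>) * b * ln (real n)" for b
        unfolding nL[symmetric] by (simp only: mult_ac)
      have "emeasure (weights n) {x \<in> space (Pi\<^sub>M (complete_edges ?V) (\<lambda>i. borel)).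
          (1 + e) * Lg n + e * Lg n + (real k - 1) * ((2 + e) * Lg n) < max_steiner_weight ?V (complete_edges ?V) x k}
        \<le> ennreal (real (card ?V) * (exp (- ((1 - \<delta>) * (1 - \<delta>) * real (card ?V) * ((1 + e) * Lg n))) *
              ((real (card ?V) - 1) / (\<delta> * real (card ?V) - 1) *
                (real (r1 n) * (real (card ?V) - 2) / (real (card ?V) - real (r1 n) - 1))))
          + real (card ?V) * (exp (- ((1 - \<delta>) * (1 - \<delta>) * real (card ?V) * ((2 + e) * Lg n))) *
              ((real (card ?V) - 1) / (\<delta> * real (card ?V) - 1) *
                (real (r2 n) * (real (card ?V) - 2) / (real (card ?V) - real (r2 n) - 1))))
          + real (card ?V) ^ k * exp (- (\<delta> * (e * Lg n) * ((real (r1 n) + 1) * (real n / 2)))))"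
        using elim n k kn \<delta> e r1 r2n six m half
        by (intro max_steiner_weight_upper_tail) (auto simp: Lg_def)
      also have "\<dots> \<le> ennreal (B1 n + B2 n + B3 n)"
      proof (intro ennreal_leI add_mono)
        have "real n * exp (- ((1 - \<delta>) * (1 - \<delta>) * real n * ((1 + e) * Lg n)))
            = exp (ln (real n) + - ((1 - \<delta>) * (1 - \<delta>) * (1 + e) * ln (real n)))"
          unfolding ex ar ..
        also have "\<dots> \<le> exp (- (e / 2) * ln (real n))"
          using mult_right_mono[OF quad1, of "ln (real n)"] elim by (simp add: algebra_simps)
        finally have 1: "real n * exp (- ((1 - \<delta>) * (1 - \<delta>) * real n * ((1 + e) * Lg n))) \<le> exp (- (e / 2) * ln (real n))" .
        have 12: "(real n - 1) / (\<delta> * real n - 1) * (real (r1 n) * (real n - 2) / (real n - real (r1 n) - 1))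
          \<le> 2 / \<delta> * (2 * (ln (real n) + 1))"
          using K1 K2 K20 \<delta> by (intro mult_mono) auto
        have "real n * exp (- ((1 - \<delta>) * (1 - \<delta>) * real n * ((1 + e) * Lg n))) *
            ((real n - 1) / (\<delta> * real n - 1) * (real (r1 n) * (real n - 2) / (real n - real (r1 n) - 1)))
           \<le> exp (- (e / 2) * ln (real n)) * (2 / \<delta> * (2 * (ln (real n) + 1)))"
          by (rule mult_mono[OF 1 12 exp_ge_zero mult_nonneg_nonneg[OF K10 K20]])
        thus "real (card ?V) * (exp (- ((1 - \<delta>) * (1 - \<delta>) * real (card ?V) * ((1 + e) * Lg n))) *
              ((real (card ?V) - 1) / (\<delta> * real (card ?V) - 1) *
                (real (r1 n) * (real (card ?V) - 2) / (real (card ?V) - real (r1 n) - 1)))) \<le> B1 n"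
          by (simp add: B1_def mult.assoc)
        have "real n * real n * exp (- ((1 - \<delta>) * (1 - \<delta>) * real n * ((2 + e) * Lg n)))
            = exp (ln (real n) + (ln (real n) + - ((1 - \<delta>) * (1 - \<delta>) * (2 + e) * ln (real n))))"
          unfolding mult.assoc[of "real n" "real n"] ex ar ..
        also have "\<dots> \<le> exp (- (e / 4) * ln (real n))"
          using mult_right_mono[OF quad2, of "ln (real n)"] elim by (simp add: algebra_simps)
        finally have 2: "real n * real n * exp (- ((1 - \<delta>) * (1 - \<delta>) * real n * ((2 + e) * Lg n))) \<le> exp (- (e / 4) * ln (real n))" .
        let ?x = "exp (- ((1 - \<delta>) * (1 - \<delta>) * real n * ((2 + e) * Lg n)))"
        have "(real n - 1) / (\<delta> * real n - 1) * (real (r2 n) * (real n - 2) / (real n - real (r2 n) - 1))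
          \<le> 2 / \<delta> * (4 * real k * real n)"
          using K1 K3 K30 \<delta> by (intro mult_mono) auto
        hence "real n * ?x * ((real n - 1) / (\<delta> * real n - 1) * (real (r2 n) * (real n - 2) / (real n - real (r2 n) - 1)))
           \<le> real n * ?x * (2 / \<delta> * (4 * real k * real n))"
          by (intro mult_left_mono) auto
        also have "\<dots> = real n * real n * ?x * (8 * real k / \<delta>)" by simp
        also have "\<dots> \<le> exp (- (e / 4) * ln (real n)) * (8 * real k / \<delta>)"
          using 2 \<delta> by (intro mult_right_mono) auto
        finally show "real (card ?V) * (exp (- ((1 - \<delta>) * (1 - \<delta>) * real (card ?V) * ((2 + e) * Lg n))) *
              ((real (card ?V) - 1) / (\<delta> * real (card ?V) - 1) *
                (real (r2 n) * (real (card ?V) - 2) / (real (card ?V) - real (r2 n) - 1)))) \<le> B2 n"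
          by (simp add: B2_def mult.assoc)
        have "real n ^ k = exp (real k * ln (real n))" using n by (simp add: exp_of_nat_mult)
        moreover have "\<delta> * e / 2 * (ln (real n))\<^sup>2 \<le> \<delta> * (e * Lg n) * ((real (r1 n) + 1) * (real n / 2))"
        proof -
          have "\<delta> * e / 2 * (ln (real n) * ln (real n)) \<le> \<delta> * e / 2 * (ln (real n) * (real (r1 n) + 1))"
            using r1 elim \<delta> e by (intro mult_left_mono) auto
          also have "\<dots> = \<delta> * (e * Lg n) * ((real (r1 n) + 1) * (real n / 2))"
            by (simp add: mult_ac flip: nL)
          finally show ?thesis by (simp add: power2_eq_square)
        qed
        ultimately show "real (card ?V) ^ k * exp (- (\<delta> * (e * Lg n) * ((real (r1 n) + 1) * (real n / 2)))) \<le> B3 n"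
          by (simp add: B3_def exp_add[symmetric])
      qed
      finally have "emeasure (weights n) {x \<in> space (weights n).
          (2 * real k - 1 + \<epsilon>) * (ln (real n) / real n) < max_steiner_weight ?V (complete_edges ?V) x k}
          \<le> ennreal (B1 n + B2 n + B3 n)" by (simp only: thr space_PiM_expo)
      moreover have "0 \<le> B1 n + B2 n + B3 n"
        using elim \<delta> by (simp add: B1_def B2_def B3_def)
      ultimately show ?case by (simp add: measure_def enn2real_leI)
    qed
  qed
  have "B1 \<longlonglongrightarrow> 0" unfolding B1_def using e \<delta> by real_asymp
  moreover have "B2 \<longlonglongrightarrow> 0" unfolding B2_def using e \<delta> by real_asymp
  moreover have "B3 \<longlonglongrightarrow> 0" unfolding B3_def using e \<delta> k by real_asymp
  ultimately have "(\<lambda>n. B1 n + B2 n + B3 n) \<longlonglongrightarrow> 0 + 0 + 0" by (intro tendsto_add)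
  hence "(\<lambda>n. B1 n + B2 n + B3 n) \<longlonglongrightarrow> 0" by simp
  from ev show ?thesis
    by (rule tendsto_sandwich[OF _ _ tendsto_const, rotated]) (use \<open>(\<lambda>n. B1 n + B2 n + B3 n) \<longlonglongrightarrow> 0\<close> in auto)
qed

lemma lower_deviation:
  assumes k: "2 \<le> k" and \<epsilon>: "0 < \<epsilon>" "\<epsilon> \<le> 1"
  shows "(\<lambda>n. measure (weights n) {x \<in> space (weights n).
     max_steiner_weight {1..n} (complete_edges {1..n}) x k < (2 * real k - 1 - \<epsilon>) * (ln (real n) / real n)}) \<longlonglongrightarrow> 0"
proof -
  have kr: "2 \<le> real k" using k by simp
  \<comment> \<open>Chosen so that \<open>c n - a n * k\<close> is exactly
    \<open>(k - 1 - \<epsilon> / 2) * Lg n\<close>, while the mean number of vertices with only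
    heavy edges is still at least \<open>n\<close> to the power \<open>\<delta>\<close>.\<close>
  define \<delta> where "\<delta> = \<epsilon> / (2 * real k)"
  \<comment> \<open>Small enough that taking \<open>\<mu> = (1 + \<eta>) * n\<close> instead of
    \<open>n\<close> costs at most \<open>\<epsilon> / 4\<close> in the exponent, yet positive,
    which makes the sum over tree sizes converge.\<close>
  define \<eta> where "\<eta> = \<epsilon> / (4 * real k)"
  have \<delta>: "0 < \<delta>" "\<delta> < 1" using \<epsilon> kr by (auto simp: \<delta>_def field_simps)
  have \<eta>: "0 < \<eta>" using \<epsilon> kr by (auto simp: \<eta>_def)
  define \<theta> where "\<theta> = 1 / (1 + \<eta>)"
  have \<theta>: "0 < \<theta>" "\<theta> < 1" using \<eta> by (auto simp: \<theta>_def)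
  define Lg where "Lg = (\<lambda>n. ln (real n) / real n)"
  define K where "K = (\<Sum>m. real (Suc m) ^ (2 * k) * \<theta> ^ m)"
  define c where "c = (\<lambda>n. (2 * real k - 1 - \<epsilon>) * Lg n)"
  define a where "a = (\<lambda>n. (1 - \<delta>) * Lg n)"
  define B where "B = (\<lambda>n. 4 * exp (- \<delta> * ln (real n)) + 4 * (exp (a n) - 1) +
    (2 * real k) ^ k * (exp (a n * (real k * (real k - 1))) * (real k ^ 2 * c n + exp (- (\<epsilon> / 4) * ln (real n)) * K)))"
  have ev: "eventually (\<lambda>n. measure (weights n) {x \<in> space (weights n).
     max_steiner_weight {1..n} (complete_edges {1..n}) x k < (2 * real k - 1 - \<epsilon>) * (ln (real n) / real n)} \<le> B n) sequentially"
  proof -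
    have "eventually (\<lambda>n::nat. 2 * real k \<le> exp (\<delta> * ln (real n))) sequentially" using \<delta> by real_asymp
    moreover have "eventually (\<lambda>n::nat. 1 \<le> ln (real n)) sequentially" by real_asymp
    moreover have "eventually (\<lambda>n::nat. k \<le> n) sequentially" by (rule eventually_ge_at_top)
    ultimately show ?thesis
    proof eventually_elim
      case (elim n)
      have n: "1 \<le> real n" "real k \<le> real n" using elim kr by auto
      have Lg0: "0 \<le> Lg n" using elim n by (simp add: Lg_def)
      have nL: "real n * Lg n = ln (real n)" using n by (simp add: Lg_def)
      have a0: "0 \<le> a n" using Lg0 \<delta> by (simp add: a_def)
      have c0: "0 \<le> c n" using Lg0 kr \<epsilon> by (simp add: c_def)
      define \<mu> where "\<mu> = (1 + \<eta>) * real n"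
      have \<mu>: "0 < \<mu>" using \<eta> n by (simp add: \<mu>_def)
      define L where "L = real n * exp (- a n * (real n - 1))"
      have eL: "exp (\<delta> * ln (real n)) \<le> L"
      proof -
        have "a n * real n = (1 - \<delta>) * ln (real n)" by (simp add: a_def nL[symmetric] mult_ac)
        hence "\<delta> * ln (real n) = ln (real n) - a n * real n" by (simp add: algebra_simps)
        also have "\<dots> \<le> ln (real n) + - a n * (real n - 1)" using a0 by (simp add: algebra_simps)
        finally have "exp (\<delta> * ln (real n)) \<le> exp (ln (real n) + - a n * (real n - 1))" by simp
        also have "\<dots> = L" unfolding L_def exp_add using n by simp
        finally show ?thesis .
      qed
      have L0: "0 < L" using eL exp_gt_zero by (rule less_le_trans[rotated])
      define \<Sigma> where "\<Sigma> = (\<Sum>m<n. real n ^ Suc m * real (Suc m) ^ (2 * k) * (1 / (1 + \<mu>)) ^ m)"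
      have main: "measure (weights n) {x \<in> space (weights n). max_steiner_weight {1..n} (complete_edges {1..n}) x k < c n}
        \<le> 4 / L + 4 * (exp (a n) - 1) + (2 * real k / L) ^ k * (exp (- a n * (real k * (real n - real k))) *
            (real n ^ k * (real k ^ 2 * c n) + exp (\<mu> * (c n - a n * real k)) * \<Sigma>))"
        using max_steiner_weight_lower_tail[of "{1..n}" k "a n" "c n" \<mu>] elim k a0 c0 \<mu> eL
        by (simp add: L_def \<Sigma>_def)
      \<comment> \<open>Each further vertex brings at most \<open>n\<close> choices and a moment
        factor \<open>1 / (1 + \<mu>)\<close>; their product is at most \<open>\<theta> < 1\<close>,
        so trees of all sizes together contribute \<open>O(n)\<close>.\<close>
      have "\<Sigma> \<le> real n * K"
      proof -
        have "\<Sigma> \<le> (\<Sum>m<n. real n * (real (Suc m) ^ (2 * k) * \<theta> ^ m))"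
          unfolding \<Sigma>_def
        proof (rule sum_mono)
          fix m
          have "real n * (1 / (1 + \<mu>)) \<le> \<theta>"
          proof -
            have "real n / (1 + \<mu>) \<le> real n / \<mu>" using \<mu> by (intro divide_left_mono) auto
            also have "\<dots> = \<theta>" using n by (simp add: \<theta>_def \<mu>_def)
            finally show ?thesis by simp
          qed
          hence "(real n * (1 / (1 + \<mu>))) ^ m \<le> \<theta> ^ m" using \<mu> by (intro power_mono) auto
          hence "real n * (real (Suc m) ^ (2 * k) * (real n * (1 / (1 + \<mu>))) ^ m) \<le> real n * (real (Suc m) ^ (2 * k) * \<theta> ^ m)"
            by (intro mult_left_mono) auto
          thus "real n ^ Suc m * real (Suc m) ^ (2 * k) * (1 / (1 + \<mu>)) ^ m \<le> real n * (real (Suc m) ^ (2 * k) * \<theta> ^ m)"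
            by (simp only: power_mult_distrib power_Suc mult_ac)
        qed
        also have "\<dots> = real n * (\<Sum>m<n. real (Suc m) ^ (2 * k) * \<theta> ^ m)" by (simp only: sum_distrib_left)
        also have "\<dots> \<le> real n * K"
          unfolding K_def using \<theta> summable_power_times_geometric[OF \<theta>]
          by (intro mult_left_mono sum_le_suminf) auto
        finally show ?thesis .
      qed
      have S0: "0 \<le> \<Sigma>" unfolding \<Sigma>_def using \<mu> by (intro sum_nonneg) auto
      have expo: "exp (\<mu> * (c n - a n * real k)) \<le> real n ^ k * exp (- (\<epsilon> / 4) * ln (real n)) / real n"
      proof -
        have "c n - a n * real k = (real k - 1 - \<epsilon> / 2) * Lg n"
          using kr by (simp add: c_def a_def \<delta>_def field_simps)
        hence "\<mu> * (c n - a n * real k) = (1 + \<eta>) * (real k - 1 - \<epsilon> / 2) * ln (real n)"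
          by (simp add: \<mu>_def nL[symmetric] mult_ac)
        also have "\<dots> \<le> (real k - 1 - \<epsilon> / 4) * ln (real n)"
        proof (rule mult_right_mono)
          have "\<eta> * (real k - 1 - \<epsilon> / 2) \<le> \<eta> * real k" using \<eta> \<epsilon> by (intro mult_left_mono) auto
          also have "\<dots> = \<epsilon> / 4" using kr by (simp add: \<eta>_def)
          finally have "\<eta> * (real k - 1 - \<epsilon> / 2) \<le> \<epsilon> / 4" .
          moreover have "(1 + \<eta>) * (real k - 1 - \<epsilon> / 2) = (real k - 1 - \<epsilon> / 2) + \<eta> * (real k - 1 - \<epsilon> / 2)"
            by (simp only: distrib_right mult_1_left)
          ultimately show "(1 + \<eta>) * (real k - 1 - \<epsilon> / 2) \<le> real k - 1 - \<epsilon> / 4" by linarith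
        qed (use elim in simp)
        also have "\<dots> = real k * ln (real n) + - (\<epsilon> / 4) * ln (real n) - ln (real n)" by (simp add: algebra_simps)
        finally have "exp (\<mu> * (c n - a n * real k)) \<le> exp (real k * ln (real n) + - (\<epsilon> / 4) * ln (real n) - ln (real n))"
          by simp
        also have "\<dots> = exp (real k * ln (real n)) * exp (- (\<epsilon> / 4) * ln (real n)) / exp (ln (real n))"
          by (simp only: exp_diff exp_add)
        also have "\<dots> = real n ^ k * exp (- (\<epsilon> / 4) * ln (real n)) / real n"
          using n by (simp add: exp_of_nat_mult)
        finally show ?thesis .
      qed
      have "exp (\<mu> * (c n - a n * real k)) * \<Sigma> \<le> real n ^ k * exp (- (\<epsilon> / 4) * ln (real n)) / real n * (real n * K)"
        using expo \<open>\<Sigma> \<le> real n * K\<close> S0 by (intro mult_mono) auto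
      also have "\<dots> = real n ^ k * (exp (- (\<epsilon> / 4) * ln (real n)) * K)" using n by simp
      finally have "real n ^ k * (real k ^ 2 * c n) + exp (\<mu> * (c n - a n * real k)) * \<Sigma>
         \<le> real n ^ k * (real k ^ 2 * c n + exp (- (\<epsilon> / 4) * ln (real n)) * K)"
        by (simp add: distrib_left)
      hence "(2 * real k / L) ^ k * (exp (- a n * (real k * (real n - real k))) *
            (real n ^ k * (real k ^ 2 * c n) + exp (\<mu> * (c n - a n * real k)) * \<Sigma>))
         \<le> (2 * real k / L) ^ k * (exp (- a n * (real k * (real n - real k))) *
            (real n ^ k * (real k ^ 2 * c n + exp (- (\<epsilon> / 4) * ln (real n)) * K)))"
        using L0 by (intro mult_left_mono) auto
      also have "\<dots> = ((2 * real k / L) ^ k * exp (- a n * (real k * (real n - real k))) * real n ^ k) *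
          (real k ^ 2 * c n + exp (- (\<epsilon> / 4) * ln (real n)) * K)" by (simp only: mult_ac)
      \<comment> \<open>The bound on the probability that \<open>k\<close> given vertices have only
        heavy edges, times \<open>n ^ k\<close>, matches \<open>L ^ k\<close> up to
        \<open>exp (a n * k * (k - 1))\<close>, which tends to 1. The powers of \<open>n\<close>
        cancel.\<close>
      also have "(2 * real k / L) ^ k * exp (- a n * (real k * (real n - real k))) * real n ^ k
          = (2 * real k) ^ k * exp (a n * (real k * (real k - 1)))"
      proof -
        have "L ^ k = real n ^ k * exp (real k * (- a n * (real n - 1)))"
          by (simp only: L_def power_mult_distrib exp_of_nat_mult)
        hence "(2 * real k / L) ^ k * exp (- a n * (real k * (real n - real k))) * real n ^ k
          = (2 * real k) ^ k * (exp (- a n * (real k * (real n - real k))) / exp (real k * (- a n * (real n - 1))))"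
          using n by (simp add: power_divide)
        also have "exp (- a n * (real k * (real n - real k))) / exp (real k * (- a n * (real n - 1)))
          = exp (a n * (real k * (real k - 1)))"
          unfolding exp_diff[symmetric] by (simp add: algebra_simps)
        finally show ?thesis .
      qed
      finally have third: "(2 * real k / L) ^ k * (exp (- a n * (real k * (real n - real k))) *
            (real n ^ k * (real k ^ 2 * c n) + exp (\<mu> * (c n - a n * real k)) * \<Sigma>))
         \<le> (2 * real k) ^ k * (exp (a n * (real k * (real k - 1))) * (real k ^ 2 * c n + exp (- (\<epsilon> / 4) * ln (real n)) * K))"
        by (simp only: mult_ac)
      have first: "4 / L \<le> 4 * exp (- \<delta> * ln (real n))"
      proof -
        have "4 / L \<le> 4 / exp (\<delta> * ln (real n))" using eL L0 by (intro divide_left_mono) auto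
        thus ?thesis by (simp add: exp_minus divide_inverse)
      qed
      show ?case
        using main first third unfolding B_def c_def[symmetric] Lg_def[symmetric] by (simp add: c_def Lg_def)
    qed
  qed
  have Lg0: "Lg \<longlonglongrightarrow> 0" unfolding Lg_def by real_asymp
  have a0: "a \<longlonglongrightarrow> 0" unfolding a_def using tendsto_mult_left[OF Lg0, of "1 - \<delta>"] by simp
  have c0: "c \<longlonglongrightarrow> 0" unfolding c_def using tendsto_mult_left[OF Lg0, of "2 * real k - 1 - \<epsilon>"] by simp
  have e1: "(\<lambda>n::nat. exp (- \<delta> * ln (real n))) \<longlonglongrightarrow> 0" using \<delta> by real_asymp
  have e2: "(\<lambda>n::nat. exp (- (\<epsilon> / 4) * ln (real n))) \<longlonglongrightarrow> 0" using \<epsilon> by real_asymp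
  have "B \<longlonglongrightarrow> 4 * 0 + 4 * (exp 0 - 1) + (2 * real k) ^ k * (exp (0 * (real k * (real k - 1))) * (real k ^ 2 * 0 + 0 * K))"
    unfolding B_def by (intro tendsto_intros a0 c0 e1 e2)
  hence "B \<longlonglongrightarrow> 0" by simp
  from ev show ?thesis
    by (rule tendsto_sandwich[OF _ _ tendsto_const, rotated]) (use \<open>B \<longlonglongrightarrow> 0\<close> in auto)
qed

theorem theorem3:
  fixes k :: nat
    and M :: "nat \<Rightarrow> 'a measure"
    and T :: "nat \<Rightarrow> nat set \<Rightarrow> 'a \<Rightarrow> real"
  assumes "k \<ge> 2"
    and "\<And>n. n \<ge> k \<Longrightarrow> prob_space (M n)"
    and "\<And>n. n \<ge> k \<Longrightarrow>
           prob_space.indep_vars (M n) (\<lambda>_. borel) (T n) (complete_edges {1..n})"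
    and "\<And>n e. n \<ge> k \<Longrightarrow> e \<in> complete_edges {1..n} \<Longrightarrow>
           distributed (M n) lborel (T n e) (exponential_density 1)"
  shows "converges_in_probability M
           (\<lambda>n \<omega>. max_steiner_weight {1..n} (complete_edges {1..n}) (\<lambda>e. T n e \<omega>) k
                    / (ln (real n) / real n))
           (2 * real k - 1)"
proof -
  define h where "h = (\<lambda>n x. max_steiner_weight {1..n} (complete_edges {1..n}) x k / (ln (real n) / real n))"
  let ?B = "\<lambda>n. Pi\<^sub>M (complete_edges {1..n}) (\<lambda>_. borel :: real measure)"
  let ?f = "\<lambda>n \<omega>. \<lambda>e\<in>complete_edges {1..n}. T n e \<omega>"
  have hm: "h n \<in> borel_measurable (?B n)" for n
    unfolding h_def using max_steiner_weight_measurable[of "{1..n}" k] by simp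
  \<comment> \<open>Only weights of edges matter, so the weight function may be cut down to an
    element of the product space.\<close>
  have X: "max_steiner_weight {1..n} (complete_edges {1..n}) (\<lambda>e. T n e \<omega>) k / (ln (real n) / real n) = h n (?f n \<omega>)" for n \<omega>
    unfolding h_def by (intro arg_cong2[where f = "(/)"] max_steiner_weight_cong) auto
  have law: "?f n \<in> measurable (M n) (?B n)" "distr (M n) (?B n) (?f n) = weights n" if "k \<le> n" for n
  proof -
    \<comment> \<open>\<open>n \<ge> k \<ge> 2\<close> provides an edge, so the index set of the
      product is nonempty.\<close>
    have "{1, 2} \<in> complete_edges {1..n}" using that assms(1) by (auto simp: complete_edges_def)
    hence ne: "complete_edges {1..n} \<noteq> {}" by blast
    show "?f n \<in> measurable (M n) (?B n)" "distr (M n) (?B n) (?f n) = weights n"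
      by (rule distr_weights[OF assms(2)[OF that] assms(3)[OF that] ne assms(4)[OF that]], assumption)+
  qed
  show ?thesis
    unfolding converges_in_probability_def X
  proof (intro conjI allI impI)
    show "\<forall>\<^sub>F n in sequentially. (\<lambda>\<omega>. h n (?f n \<omega>)) \<in> borel_measurable (M n)"
      using eventually_ge_at_top[of k] by eventually_elim (rule measurable_compose[OF law(1) hm])
    fix \<epsilon> :: real assume "0 < \<epsilon>"
    \<comment> \<open>The deviation bounds are stated for \<open>\<epsilon> \<le> 1\<close>;
      lowering \<open>\<epsilon>\<close> only enlarges the deviation event.\<close>
    define \<epsilon>' where "\<epsilon>' = min \<epsilon> 1"
    have \<epsilon>': "0 < \<epsilon>'" "\<epsilon>' \<le> 1" using \<open>0 < \<epsilon>\<close> by (auto simp: \<epsilon>'_def)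
    let ?U = "\<lambda>n. {x \<in> space (weights n). (2 * real k - 1 + \<epsilon>') * (ln (real n) / real n) <
      max_steiner_weight {1..n} (complete_edges {1..n}) x k}"
    let ?L = "\<lambda>n. {x \<in> space (weights n). max_steiner_weight {1..n} (complete_edges {1..n}) x k <
      (2 * real k - 1 - \<epsilon>') * (ln (real n) / real n)}"
    let ?c = "2 * real k - 1"
    have lim: "(\<lambda>n. measure (weights n) (?U n) + measure (weights n) (?L n)) \<longlonglongrightarrow> 0"
      using tendsto_add[OF upper_deviation[OF assms(1) \<epsilon>'] lower_deviation[OF assms(1) \<epsilon>']] by simp
    have le: "\<forall>\<^sub>F n in sequentially. measure (M n) {\<omega> \<in> space (M n). \<epsilon> < \<bar>h n (?f n \<omega>) - ?c\<bar>}
        \<le> measure (weights n) (?U n) + measure (weights n) (?L n)"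
      using eventually_ge_at_top[of k]
    proof eventually_elim
      case (elim n)
      interpret P: prob_space "weights n" by (intro prob_space_PiM prob_space_exponential_density) simp
      have pos: "0 < ln (real n) / real n" using elim assms(1) by (intro divide_pos_pos) auto
      have "{x \<in> space (?B n). \<epsilon> < \<bar>h n x - ?c\<bar>} \<in> sets (?B n)" using hm[of n] by measurable
      hence "measure (M n) {\<omega> \<in> space (M n). \<epsilon> < \<bar>h n (?f n \<omega>) - ?c\<bar>}
          = measure (weights n) {x \<in> space (?B n). \<epsilon> < \<bar>h n x - ?c\<bar>}"
        by (rule measure_weights[OF law[OF elim]])
      also have "\<dots> \<le> measure (weights n) (?U n \<union> ?L n)"
      proof (rule P.finite_measure_mono)
        have [measurable]: "(\<lambda>x. max_steiner_weight {1..n} (complete_edges {1..n}) x k) \<in> borel_measurable (weights n)"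
          using max_steiner_weight_measurable[of "{1..n}" k] by (simp cong: measurable_cong_sets)
        show "?U n \<union> ?L n \<in> sets (weights n)" by measurable
        show "{x \<in> space (?B n). \<epsilon> < \<bar>h n x - ?c\<bar>} \<subseteq> ?U n \<union> ?L n"
        proof
          fix x assume "x \<in> {x \<in> space (?B n). \<epsilon> < \<bar>h n x - ?c\<bar>}"
          hence x: "x \<in> space (weights n)" "\<epsilon>' < \<bar>h n x - ?c\<bar>" by (auto simp: \<epsilon>'_def)
          hence "?c + \<epsilon>' < h n x \<or> h n x < ?c - \<epsilon>'" by linarith
          thus "x \<in> ?U n \<union> ?L n"
            using x(1) pos_less_divide_eq[OF pos, of "?c + \<epsilon>'"] pos_divide_less_eq[OF pos, of _ "?c - \<epsilon>'"]
            unfolding h_def by blast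
        qed
      qed
      also have "\<dots> \<le> measure (weights n) (?U n) + measure (weights n) (?L n)"
      proof (rule measure_Un_le)
        have [measurable]: "(\<lambda>x. max_steiner_weight {1..n} (complete_edges {1..n}) x k) \<in> borel_measurable (weights n)"
          using max_steiner_weight_measurable[of "{1..n}" k] by (simp cong: measurable_cong_sets)
        show "?U n \<in> sets (weights n)" "?L n \<in> sets (weights n)" by measurable
      qed
      finally show ?case .
    qed
    show "(\<lambda>n. measure (M n) {\<omega> \<in> space (M n). \<epsilon> < \<bar>h n (?f n \<omega>) - ?c\<bar>}) \<longlonglongrightarrow> 0"
      by (rule tendsto_sandwich[OF _ le tendsto_const lim]) simp
  qed
qed

end
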